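(* Let $P=(a^p \, | \, b^q)$, where $a,b,p,q$ are integers with $1 \le a \le b$ and $p, q \ge 1$, be a bipartite biregular pair. (1) The pair $P$ is Eulerian if and only if it has one of the following forms (all parameters being positive integers subject to the indicated restrictions): - $P=(1^{bq} \, | \, b^q)$; - $P=(2^{br} \, | \, b^{2r})$ with $r \ge 1$; - $P=(2^{qr} \, | \, (2r)^q)$ with $q \ge 3$ odd; - $P = (3^p \, | \, 3^p)$ with $p \ge 4$; - $P=(3^{4r} \, | \, 4^{3r})$ with $r \ge 2$; - $P = (3^{5r} \, | \, 5^{3r})$ with $r \ge 4$. (2) The pair $P$ is planar graphic if and only if it is Eulerian and is different from $(3^5 \, | \, 3^5)$ and $(3^{25} \, | \, 5^{15})$.
   Context: For integers $1 \le a \le b$ and $p,q \ge 1$, $(a^p \, | \, b^q)$ denotes the pair of sequences in which the first sequence consists of $p$ repeats of the number $a$ and the second consists of $q$ repeats of the number $b$. Such a pair is called a bipartite biregular pair. The pair $(a^p \, | \, b^q)$ is called planar graphic (or planar) if there exists a simple (no loops, no multiple edges), bipartite, planar graph, not necessarily connected, for which one part consists of $p$ vertices of degree $a$ and the other part consists of $q$ vertices of degree $b$. The pair $(a^p \, | \, b^q)$ is called Eulerian if $ap=bq$, $q \ge a$, and, when $p+q\ge 3$, Euler's inequality $m \le 2(p+q)-4$ holds, where $m=ap=bq$. *)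

theory Defs
  imports "HOL-Analysis.Analysis"
begin

text \<open>
  The pair of sequences $(a^p \mid b^q)$. For positive p and q it determines a, p, b, q.
\<close>

definition biregular_pair :: "nat \<Rightarrow> nat \<Rightarrow> nat \<Rightarrow> nat \<Rightarrow> nat list \<times> nat list" where
  "biregular_pair a p b q = (replicate p a, replicate q b)"

text \<open>
  A graph is given by its vertex set and a set of edges, each edge being the set of its two
  distinct endpoints; this excludes loops and multiple edges.
\<close>

definition simple_graph :: "'a set \<Rightarrow> 'a set set \<Rightarrow> bool" where
  "simple_graph V E \<longleftrightarrow> finite V \<and> (\<forall>e\<in>E. e \<subseteq> V \<and> card e = 2)"

definition bipartition :: "'a set \<Rightarrow> 'a set \<Rightarrow> 'a set set \<Rightarrow> bool" where
  "bipartition X Y E \<longleftrightarrow> X \<inter> Y = {} \<and> (\<forall>e\<in>E. \<exists>x\<in>X. \<exists>y\<in>Y. e = {x, y})"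

definition vertex_degree :: "'a set set \<Rightarrow> 'a \<Rightarrow> nat" where
  "vertex_degree E v = card {e \<in> E. v \<in> e}"

text \<open>
  A drawing in the plane without crossings: distinct vertices are distinct points, an edge is a
  Jordan arc joining its endpoints and passing through no other vertex, and two
  edges meet only in common endpoints.
\<close>

definition plane_drawing ::
    "'a set \<Rightarrow> 'a set set \<Rightarrow> ('a \<Rightarrow> complex) \<Rightarrow> ('a set \<Rightarrow> real \<Rightarrow> complex) \<Rightarrow> bool" where
  "plane_drawing V E pos \<gamma> \<longleftrightarrow>
     inj_on pos V \<and>
     (\<forall>e\<in>E. arc (\<gamma> e) \<and> {pathstart (\<gamma> e), pathfinish (\<gamma> e)} = pos ` e \<and>
            path_image (\<gamma> e) \<inter> pos ` V = pos ` e) \<and>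
     (\<forall>e\<in>E. \<forall>f\<in>E. e \<noteq> f \<longrightarrow> path_image (\<gamma> e) \<inter> path_image (\<gamma> f) = pos ` (e \<inter> f))"

definition planar_graph :: "'a set \<Rightarrow> 'a set set \<Rightarrow> bool" where
  "planar_graph V E \<longleftrightarrow> simple_graph V E \<and> (\<exists>pos \<gamma>. plane_drawing V E pos \<gamma>)"

text \<open>
  Taking natural numbers as vertices is no restriction, since the graphs are finite.
\<close>

definition planar_graphic :: "nat \<Rightarrow> nat \<Rightarrow> nat \<Rightarrow> nat \<Rightarrow> bool" where
  "planar_graphic a p b q \<longleftrightarrow>
     (\<exists>(X :: nat set) Y E.
        planar_graph (X \<union> Y) E \<and> bipartition X Y E \<and>
        card X = p \<and> (\<forall>x\<in>X. vertex_degree E x = a) \<and>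
        card Y = q \<and> (\<forall>y\<in>Y. vertex_degree E y = b))"

text \<open>
  The subtraction is not truncated, as it is only relevant for $p + q \geq 3$.
\<close>

definition eulerian_pair :: "nat \<Rightarrow> nat \<Rightarrow> nat \<Rightarrow> nat \<Rightarrow> bool" where
  "eulerian_pair a p b q \<longleftrightarrow>
     a * p = b * q \<and> q \<ge> a \<and> (p + q \<ge> 3 \<longrightarrow> a * p \<le> 2 * (p + q) - 4)"

end

(*
  Necessity. A two-connected plane graph arises from a cycle by adding ears, and the theta graph
  version of the Jordan curve theorem splits the face containing an ear into two faces bounded by
  cycles. This yields a rotation system with Euler's formula, hence m <= 2n - 4 for bipartite plane
  graphs after splitting at cut vertices. For (3^5 | 3^5) and (3^25 | 5^15) there is exactly one edge
  less than in a quadrangulation, so all faces are quadrilaterals except for one hexagon; following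
  the rotations outwards from the hexagon leads to a contradiction or to a K_{3,3}.

  Sufficiency. Disjoint unions reduce all pairs to stars, K_{2,b}, a triangle with multiplied and
  subdivided edges, and ten fixed graphs, which come from triangulations of the sphere on the
  vertices of the second part by placing vertices of degree 3 into suitable triangles.
*)

theory Submission
  imports Defs "HOL-Complex_Analysis.Winding_Numbers" "HOL-Library.Multiset"
begin

section \<open>Theta graphs in the plane\<close>

text \<open>Arbitrary arcs occur only in necessity; sufficiency uses straight segments between
  explicit points. The obstacle in necessity is to extract faces from a drawing. A face is
  represented as one side of a Jordan curve, with no distinction between the bounded and the
  unbounded side, so that ears inside and outside are treated alike. This is possible because the
  subgraphs grown by ears remain two-connected and all their faces are bounded by cycles. Topology
  serves only to find the face that contains an ear and to split it; Euler's formula, the symmetry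
  of darts and the cyclic order at the vertices follow by induction on the list of faces. The two
  exceptional pairs satisfy Euler's inequality. What makes them tractable is that they lack just one
  edge: since all degrees are at least 2, a cut vertex would force m <= 2n - 6, so their graphs are
  two-connected. In sufficiency, 5 is the gap both for p in (3^p | 3^p) and for r in (3^{5r} |
  5^{3r}); all other values from 4 on are sums of 4, 6, 7 and 9. Together with r = 2 and r = 3 for
  degree 4 this makes ten fixed graphs.\<close>

definition jordan_side :: "complex set \<Rightarrow> complex set \<Rightarrow> bool" where
  "jordan_side J R \<longleftrightarrow> R = inside J \<or> R = outside J"

lemma simple_closed_path_arcs:
  assumes "arc A" "arc B" "pathstart A = a" "pathfinish A = b" "pathstart B = a" "pathfinish B = b"
    and "path_image A \<inter> path_image B = {a, b}"
  shows "simple_path (A +++ reversepath B)"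
  using assms by (auto simp: simple_path_join_loop_eq arc_simple_path simple_path_reversepath)

lemma Jordan_inside_outside_arcs:
  fixes A B :: "real \<Rightarrow> complex"
  assumes "arc A" "arc B" "pathstart A = a" "pathfinish A = b" "pathstart B = a" "pathfinish B = b"
    and "path_image A \<inter> path_image B = {a, b}"
  defines "J \<equiv> path_image A \<union> path_image B"
  shows "inside J \<noteq> {}" "connected (inside J)" "connected (outside J)"
    "open (inside J)" "open (outside J)" "frontier (inside J) = J" "frontier (outside J) = J"
    "inside J \<inter> outside J = {}" "inside J \<union> outside J = - J" "outside J \<noteq> {}"
proof -
  let ?g = "A +++ reversepath B"
  have im: "path_image ?g = J"
    using assms by (simp add: path_image_join J_def)
  have sp: "simple_path ?g"
    using simple_closed_path_arcs[OF assms(1-7)] by simp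
  have "pathfinish ?g = pathstart ?g"
    using assms by simp
  from Jordan_inside_outside[OF sp this] show "inside J \<noteq> {}" "connected (inside J)" "connected (outside J)"
    "open (inside J)" "open (outside J)" "frontier (inside J) = J" "frontier (outside J) = J"
    "inside J \<inter> outside J = {}" "inside J \<union> outside J = - J" "outside J \<noteq> {}"
    unfolding im by auto
qed

text \<open>The loop along A and back along B has winding number w(A) - w(B), which is nonzero
  exactly at the enclosed points. The winding numbers of the single open arcs thus detect the
  inside, and those of three arcs with common ends can be compared with each other.\<close>

lemma winding_number_arcs_ne:
  assumes "arc A" "arc B" "pathstart A = a" "pathfinish A = b" "pathstart B = a" "pathfinish B = b"
    and "path_image A \<inter> path_image B = {a, b}"
    and "z \<notin> path_image A" "z \<notin> path_image B"
  shows "z \<in> inside (path_image A \<union> path_image B) \<longleftrightarrow> winding_number A z \<noteq> winding_number B z"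
proof -
  let ?g = "A +++ reversepath B"
  have im: "path_image ?g = path_image A \<union> path_image B"
    using assms by (simp add: path_image_join)
  have sp: "simple_path ?g"
    using simple_closed_path_arcs[OF assms(1-7)] by simp
  have cl: "pathfinish ?g = pathstart ?g"
    using assms by simp
  have "winding_number ?g z = winding_number A z + winding_number (reversepath B) z"
    using assms by (intro winding_number_join) (auto simp: arc_imp_path)
  also have "winding_number (reversepath B) z = - winding_number B z"
    using assms by (intro winding_number_reversepath) (auto simp: arc_imp_path)
  finally have wn: "winding_number ?g z = winding_number A z - winding_number B z"
    by simp
  have zim: "z \<notin> path_image ?g"
    using assms im by auto
  show ?thesis
  proof
    assume "z \<in> inside (path_image A \<union> path_image B)"
    then have "norm (winding_number ?g z) = 1"
      using simple_closed_path_norm_winding_number_inside[OF sp] im by auto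
    then show "winding_number A z \<noteq> winding_number B z"
      using wn by auto
  next
    assume ne: "winding_number A z \<noteq> winding_number B z"
    show "z \<in> inside (path_image A \<union> path_image B)"
    proof (rule ccontr)
      assume "z \<notin> inside (path_image A \<union> path_image B)"
      then have "z \<in> outside (path_image ?g)"
        using inside_Un_outside[of "path_image ?g"] zim unfolding im by blast
      then have "winding_number ?g z = 0"
        using sp cl simple_path_imp_path winding_number_zero_in_outside by blast
      then show False
        using wn ne by simp
    qed
  qed
qed

lemma arc_interior_point:
  fixes c :: "real \<Rightarrow> complex"
  assumes "arc c" "pathstart c = a" "pathfinish c = b"
  shows "path_image c - {a, b} \<noteq> {}"
proof -
  have "infinite (path_image c)"
  proof -
    have "inj_on c {0..1}"
      using assms(1) by (simp add: arc_def)
    moreover have "infinite {0..1::real}"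
      by simp
    ultimately show ?thesis
      unfolding path_image_def using finite_imageD by blast
  qed
  then show ?thesis
    by (metis Diff_infinite_finite finite.emptyI finite_insert)
qed

text \<open>Once w(A) and w(c) differ at z, the curve A c encloses z, hence all of the inside of A
  B, and B becomes a chord inside A c. The known splitting of the inside of a Jordan curve by a
  chord then applies with the roles of B and c interchanged, and taking complements gives the
  claim.\<close>

lemma theta_split_outside_aux:
  assumes "arc A" "arc B" "arc c" "pathstart A = a" "pathfinish A = b"
    "pathstart B = a" "pathfinish B = b" "pathstart c = a" "pathfinish c = b"
    and AB: "path_image A \<inter> path_image B = {a, b}"
    and Ac: "path_image A \<inter> path_image c = {a, b}"
    and Bc: "path_image B \<inter> path_image c = {a, b}"
    and out: "path_image c - {a, b} \<subseteq> outside (path_image A \<union> path_image B)"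
    and z: "z \<in> inside (path_image A \<union> path_image B)"
    and wn: "winding_number A z \<noteq> winding_number c z"
  shows "outside (path_image A \<union> path_image c) \<inter> inside (path_image c \<union> path_image B) = {}
    \<and> outside (path_image A \<union> path_image c) \<union> inside (path_image c \<union> path_image B)
        \<union> (path_image c - {a, b}) = outside (path_image A \<union> path_image B)"
proof -
  let ?A = "path_image A" and ?B = "path_image B" and ?c = "path_image c"
  have sA: "simple_path A" and sB: "simple_path B" and sc: "simple_path c"
    using assms(1-3) arc_imp_simple_path by auto
  note JAB = Jordan_inside_outside_arcs[OF assms(1,2,4,5,6,7) AB]
  note JAc = Jordan_inside_outside_arcs[OF assms(1,3,4,5,8,9) Ac]
  have cB: "?c \<inter> ?B = {a, b}" using Bc by auto
  note JcB = Jordan_inside_outside_arcs[OF assms(3,2,8,9,6,7) cB]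
  have ab: "a \<in> ?A" "b \<in> ?A" "a \<in> ?B" "b \<in> ?B" "a \<in> ?c" "b \<in> ?c"
    using AB Ac by auto
  have c_disj: "?c \<inter> inside (?A \<union> ?B) = {}"
    using out JAB(8,9) ab by blast
  have zA: "z \<notin> ?A" "z \<notin> ?B" "z \<notin> ?c"
    using z JAB(9) c_disj by blast+
  have zin: "z \<in> inside (?A \<union> ?c)"
    using winding_number_arcs_ne[OF assms(1,3,4,5,8,9) Ac zA(1,3)] wn by simp
  \<comment> \<open>The inside of A B is connected, contains z and meets neither A nor c, which form
    the frontier of the inside of A c; so it cannot leave the latter.\<close>
  have sub: "inside (?A \<union> ?B) \<subseteq> inside (?A \<union> ?c)"
  proof (rule ccontr)
    assume "\<not> ?thesis"
    then obtain w where w: "w \<in> inside (?A \<union> ?B)" "w \<notin> inside (?A \<union> ?c)"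
      by auto
    have "inside (?A \<union> ?B) \<inter> frontier (inside (?A \<union> ?c)) \<noteq> {}"
      using connected_Int_frontier[OF JAB(2), of "inside (?A \<union> ?c)"] z zin w by auto
    then show False
      using JAc(6) JAB(9) c_disj by blast
  qed
  \<comment> \<open>B is on the frontier of the inside of A B, so it lies in the closed region
    bounded by A c; its inner points avoid A and c and are therefore inside.\<close>
  have "?B \<subseteq> closure (inside (?A \<union> ?B))"
    using JAB(6) unfolding frontier_def by blast
  also have "\<dots> \<subseteq> closure (inside (?A \<union> ?c))"
    by (rule closure_mono[OF sub])
  also have "\<dots> \<subseteq> inside (?A \<union> ?c) \<union> (?A \<union> ?c)"
    using JAc(4,6) unfolding frontier_def by (simp add: interior_open) blast
  finally have Bsub: "?B \<subseteq> inside (?A \<union> ?c) \<union> (?A \<union> ?c)" .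
  obtain w where w: "w \<in> ?B" "w \<notin> {a, b}"
    using arc_interior_point[OF assms(2,6,7)] by auto
  then have ne: "?B \<inter> inside (?A \<union> ?c) \<noteq> {}"
    using Bsub AB Bc by blast
  have "a \<noteq> b"
    using assms(1,4,5) arc_distinct_ends by blast
  obtain
    sp: "inside (?A \<union> ?B) \<inter> inside (?c \<union> ?B) = {}"
     "inside (?A \<union> ?B) \<union> inside (?c \<union> ?B) \<union> (?B - {a, b}) = inside (?A \<union> ?c)"
    by (rule split_inside_simple_closed_curve[OF sA assms(4,5) sc assms(8,9) sB assms(6,7)
          \<open>a \<noteq> b\<close> Ac AB cB ne])
  have 1: "outside (?A \<union> ?B) = - (?A \<union> ?B \<union> inside (?A \<union> ?B))"
    using JAB(8,9) by blast
  have 2: "outside (?A \<union> ?c) = - (?A \<union> ?c \<union> inside (?A \<union> ?c))"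
    using JAc(8,9) by blast
  have 3: "inside (?c \<union> ?B) \<inter> ?A = {}" "inside (?c \<union> ?B) \<inter> ?B = {}"
    using sp(2) JAc(9) JcB(9) by blast+
  have 4: "inside (?A \<union> ?c) \<inter> (?A \<union> ?c) = {}"
    using JAc(9) by blast
  show ?thesis
  proof
    show "outside (?A \<union> ?c) \<inter> inside (?c \<union> ?B) = {}"
      unfolding 2 using sp(2) by blast
    have i: "inside (?c \<union> ?B) \<subseteq> outside (?A \<union> ?B)"
      unfolding 1 using sp(1) 3 by blast
    have o: "outside (?A \<union> ?c) \<subseteq> outside (?A \<union> ?B)"
      unfolding 1 2 using sp(2) ab by blast
    have "outside (?A \<union> ?B) \<subseteq> outside (?A \<union> ?c) \<union> inside (?c \<union> ?B) \<union> (?c - {a, b})"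
      unfolding 1 2 using sp(2) ab by blast
    with i o out show "outside (?A \<union> ?c) \<union> inside (?c \<union> ?B) \<union> (?c - {a, b}) = outside (?A \<union> ?B)"
      by blast
  qed
qed

text \<open>For an ear inside the curve this is the known chord case. For an ear outside, w(A) and
  w(B) differ at a point z inside A B, so w(c) differs from one of them; this tells which of the
  curves A c and B c encloses the remaining arc.\<close>

lemma theta_split:
  assumes "arc A" "arc B" "arc c" "pathstart A = a" "pathfinish A = b"
    "pathstart B = a" "pathfinish B = b" "pathstart c = a" "pathfinish c = b"
    and AB: "path_image A \<inter> path_image B = {a, b}"
    and Ac: "path_image A \<inter> path_image c = {a, b}"
    and Bc: "path_image B \<inter> path_image c = {a, b}"
    and R: "jordan_side (path_image A \<union> path_image B) R"
    and cR: "path_image c - {a, b} \<subseteq> R"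
  obtains R1 R2 where "jordan_side (path_image A \<union> path_image c) R1"
    "jordan_side (path_image B \<union> path_image c) R2"
    "R1 \<inter> R2 = {}" "R1 \<union> R2 \<union> (path_image c - {a, b}) = R"
proof -
  let ?A = "path_image A" and ?B = "path_image B" and ?c = "path_image c"
  have BA: "?B \<inter> ?A = {a, b}" using AB by auto
  have "a \<noteq> b"
    using assms(1,4,5) arc_distinct_ends by blast
  have sA: "simple_path A" and sB: "simple_path B" and sc: "simple_path c"
    using assms(1-3) arc_imp_simple_path by auto
  note JAB = Jordan_inside_outside_arcs[OF assms(1,2,4,5,6,7) AB]
  show thesis
  proof (cases "R = inside (?A \<union> ?B)")
    case True
    then have ne: "?c \<inter> inside (?A \<union> ?B) \<noteq> {}"
      using arc_interior_point[OF assms(3,8,9)] cR by blast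
    obtain "inside (?A \<union> ?c) \<inter> inside (?B \<union> ?c) = {}"
     "inside (?A \<union> ?c) \<union> inside (?B \<union> ?c) \<union> (?c - {a, b}) = inside (?A \<union> ?B)"
      by (rule split_inside_simple_closed_curve[OF sA assms(4,5) sB assms(6,7) sc assms(8,9)
          \<open>a \<noteq> b\<close> AB Ac Bc ne])
    then show thesis
      using that[of "inside (?A \<union> ?c)" "inside (?B \<union> ?c)"] True by (auto simp: jordan_side_def)
  next
    case False
    then have Rout: "R = outside (?A \<union> ?B)"
      using R by (auto simp: jordan_side_def)
    obtain z where z: "z \<in> inside (?A \<union> ?B)"
      using JAB(1) by auto
    then have zA: "z \<notin> ?A" "z \<notin> ?B" using JAB(9) by blast+
    have "winding_number A z \<noteq> winding_number B z"
      using winding_number_arcs_ne[OF assms(1,2,4,5,6,7) AB zA] z by simp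
    then consider "winding_number A z \<noteq> winding_number c z" | "winding_number B z \<noteq> winding_number c z"
      by metis
    then show thesis
    proof cases
      case 1
      from theta_split_outside_aux[OF assms(1-9) AB Ac Bc _ z this] cR Rout show thesis
        using that[of "outside (?A \<union> ?c)" "inside (?B \<union> ?c)"] by (auto simp: jordan_side_def Un_commute)
    next
      case 2
      from z have z': "z \<in> inside (?B \<union> ?A)"
        by (simp add: Un_commute)
      have cR': "?c - {a, b} \<subseteq> outside (?B \<union> ?A)"
        using cR Rout by (simp add: Un_commute)
      from theta_split_outside_aux[OF assms(2,1,3,6,7,4,5,8,9) BA Bc Ac cR' z' 2] 
      have "outside (?B \<union> ?c) \<inter> inside (?A \<union> ?c) = {}"
         "outside (?B \<union> ?c) \<union> inside (?A \<union> ?c) \<union> (?c - {a, b}) = outside (?A \<union> ?B)"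
        by (simp_all add: Un_commute)
      then show thesis
        using that[of "inside (?A \<union> ?c)" "outside (?B \<union> ?c)"] Rout
        by (auto simp: jordan_side_def)
    qed
  qed
qed

section \<open>Combinatorial plane maps\<close>

fun pdarts :: "'a list \<Rightarrow> ('a \<times> 'a) list" where
  "pdarts (x # y # xs) = (x, y) # pdarts (y # xs)"
| "pdarts xs = []"

lemma in_swap_image: "(x, y) \<in> prod.swap ` S \<longleftrightarrow> (y, x) \<in> S"
  by force

text \<open>Appending the head closes the cycle. A face is a cyclic sequence; by
  \<open>mset_cdarts_rotate\<close> the multiset of its darts does not depend on the starting
  point.\<close>

definition cdarts :: "'a list \<Rightarrow> ('a \<times> 'a) list" where
  "cdarts C = pdarts (C @ [hd C])"

lemma pdarts_append: "pdarts (xs @ v # ys) = pdarts (xs @ [v]) @ pdarts (v # ys)"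
  by (induction xs rule: pdarts.induct) auto

lemma pdarts_snoc: "pdarts (xs @ [x, y]) = pdarts (xs @ [x]) @ [(x, y)]"
  using pdarts_append[of xs x "[y]"] by simp

lemma pdarts_rev: "pdarts (rev xs) = rev (map prod.swap (pdarts xs))"
proof (induction xs rule: pdarts.induct)
  case (1 x y xs)
  have "pdarts (rev (x # y # xs)) = pdarts (rev (y # xs) @ [x])"
    by simp
  also have "\<dots> = pdarts (rev (y # xs)) @ [(y, x)]"
    by (simp add: pdarts_snoc)
  finally show ?case using 1 by simp
qed auto

lemma length_pdarts: "length (pdarts xs) = length xs - 1"
  by (induction xs rule: pdarts.induct) auto

lemma pdarts_in_set: "(x, y) \<in> set (pdarts xs) \<Longrightarrow> x \<in> set xs \<and> y \<in> set xs"
  by (induction xs rule: pdarts.induct) auto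

lemma pdarts_butlast_tl: "(x, y) \<in> set (pdarts xs) \<Longrightarrow> x \<in> set (butlast xs) \<and> y \<in> set (tl xs)"
  by (induction xs rule: pdarts.induct) (auto dest: pdarts_in_set)

lemma pdarts_irrefl: "distinct xs \<Longrightarrow> (x, y) \<in> set (pdarts xs) \<Longrightarrow> x \<noteq> y"
  by (induction xs rule: pdarts.induct) (auto dest: pdarts_in_set)

lemma distinct_pdarts: "distinct xs \<Longrightarrow> distinct (pdarts xs)"
  by (induction xs rule: pdarts.induct) (auto dest: pdarts_in_set)

lemma pdarts_antisym: "distinct xs \<Longrightarrow> (x, y) \<in> set (pdarts xs) \<Longrightarrow> (y, x) \<notin> set (pdarts xs)"
  by (induction xs rule: pdarts.induct) (auto dest: pdarts_in_set)

lemma pdarts_fun: "distinct xs \<Longrightarrow> (x, y) \<in> set (pdarts xs) \<Longrightarrow> (x, z) \<in> set (pdarts xs) \<Longrightarrow> y = z"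
  by (induction xs rule: pdarts.induct) (auto dest: pdarts_in_set)

lemma cdarts_split: "cdarts (u # A @ v # B) = pdarts (u # A @ [v]) @ pdarts (v # B @ [u])"
  unfolding cdarts_def using pdarts_append[of "u # A" v "B @ [u]"] by simp

lemma cdarts_last: "C \<noteq> [] \<Longrightarrow> cdarts C = pdarts C @ [(last C, hd C)]"
  unfolding cdarts_def using pdarts_snoc[of "butlast C" "last C" "hd C"]
  by (metis append.assoc append_butlast_last_id append_Cons append_Nil)

lemma mset_cdarts_rotate1: "mset (cdarts (rotate1 C)) = mset (cdarts C)"
proof (cases C)
  case (Cons x xs)
  show ?thesis
  proof (cases xs)
    case (Cons y ys)
    then show ?thesis
      using \<open>C = x # xs\<close> pdarts_snoc[of "y # ys" x y] by (simp add: cdarts_def)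
  qed (simp add: \<open>C = x # xs\<close> cdarts_def)
qed (simp add: cdarts_def)

lemma mset_cdarts_rotate: "mset (cdarts (rotate k C)) = mset (cdarts C)"
  by (induction k) (auto simp: mset_cdarts_rotate1)

lemma set_cdarts_rotate: "set (cdarts (rotate k C)) = set (cdarts C)"
  using mset_cdarts_rotate[of k C] by (metis set_mset_mset)

lemma rotate_to:
  assumes "u \<in> set C" "v \<in> set C" "u \<noteq> v"
  obtains k A B where "rotate k C = u # A @ v # B"
proof -
  obtain X Y where C: "C = X @ u # Y"
    using assms(1) by (meson split_list)
  then have r: "rotate (length X) C = u # Y @ X"
    by (simp add: rotate_append)
  moreover have "v \<in> set (Y @ X)"
    using assms C by auto
  then obtain A B where "Y @ X = A @ v # B"
    by (meson split_list)
  ultimately show thesis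
    using that by metis
qed

lemma cdarts_in_set: "(x, y) \<in> set (cdarts C) \<Longrightarrow> x \<in> set C \<and> y \<in> set C"
  unfolding cdarts_def by (cases C) (auto dest: pdarts_in_set)

lemma length_cdarts: "C \<noteq> [] \<Longrightarrow> length (cdarts C) = length C"
  by (simp add: cdarts_def length_pdarts)

lemma ex_cdart_from:
  assumes "x \<in> set C"
  shows "\<exists>y. (x, y) \<in> set (cdarts C)"
proof -
  obtain X Y where C: "C = X @ x # Y"
    using assms by (meson split_list)
  have "pdarts (C @ [hd C]) = pdarts (X @ [x]) @ pdarts (x # (Y @ [hd C]))"
    using pdarts_append[of X x "Y @ [hd C]"] C by simp
  moreover obtain y Z where "Y @ [hd C] = y # Z"
    by (cases "Y @ [hd C]") auto
  ultimately have "(x, y) \<in> set (cdarts C)"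
    unfolding cdarts_def by simp
  then show ?thesis ..
qed

text \<open>A multiset, so that \<open>plane_map_count\<close> can express that no dart is used
  twice and Euler's formula can count darts by the size.\<close>

definition map_darts :: "'a list list \<Rightarrow> ('a \<times> 'a) multiset" where
  "map_darts Fs = \<Sum>\<^sub># (mset (map (\<lambda>C. mset (cdarts C)) Fs))"

abbreviation dart_set :: "'a list list \<Rightarrow> ('a \<times> 'a) set" where
  "dart_set Fs \<equiv> set_mset (map_darts Fs)"

abbreviation map_verts :: "'a list list \<Rightarrow> 'a set" where
  "map_verts Fs \<equiv> \<Union> (set ` set Fs)"

lemma map_darts_simps [simp]:
  "map_darts [] = {#}"
  "map_darts (C # Fs) = mset (cdarts C) + map_darts Fs"
  "map_darts (Fs @ Gs) = map_darts Fs + map_darts Gs"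
  by (simp_all add: map_darts_def)

lemma dart_set_eq: "dart_set Fs = (\<Union>C\<in>set Fs. set (cdarts C))"
  by (induction Fs) auto

text \<open>
  The faces of a plane two-connected graph, as cyclic vertex lists that are traversed in such a
  way that every edge is used once in each direction; they arise from a cycle by adding ears.
\<close>

inductive plane_map :: "'a list list \<Rightarrow> bool" where
  cycle: "distinct C \<Longrightarrow> length C \<ge> 3 \<Longrightarrow> plane_map [C, rev C]"
| ear: "plane_map (Fs @ C # Gs) \<Longrightarrow> rotate k C = u # A @ v # B \<Longrightarrow> distinct P \<Longrightarrow>
    set P \<inter> map_verts (Fs @ C # Gs) = {} \<Longrightarrow>
    (P = [] \<Longrightarrow> (u, v) \<notin> dart_set (Fs @ C # Gs) \<and> (v, u) \<notin> dart_set (Fs @ C # Gs)) \<Longrightarrow>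
    plane_map ((u # A @ v # rev P) # (v # B @ u # P) # Fs @ Gs)"

lemma cdarts_face1: "cdarts (u # A @ v # rev P) = pdarts (u # A @ [v]) @ pdarts (v # rev P @ [u])"
  by (rule cdarts_split)

lemma cdarts_face2: "cdarts (v # B @ u # P) = pdarts (v # B @ [u]) @ pdarts (u # P @ [v])"
  by (rule cdarts_split)

lemma pdarts_rev_ear: "set (pdarts (v # rev P @ [u])) = prod.swap ` set (pdarts (u # P @ [v]))"
  using pdarts_rev[of "u # P @ [v]"] by simp

lemma cdarts_rev:
  assumes "C \<noteq> []"
  shows "mset (cdarts (rev C)) = mset (map prod.swap (cdarts C))"
proof -
  obtain x xs where C: "C = x # xs"
    using assms by (cases C) auto
  have "rotate (length xs) (rev xs @ [x]) = x # rev xs"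
    by (metis length_rev rotate_append append_Cons append_Nil)
  then have "mset (cdarts (rev C)) = mset (cdarts (x # rev xs))"
    using mset_cdarts_rotate[of "length xs" "rev xs @ [x]"] C by simp
  also have "cdarts (x # rev xs) = pdarts (rev (x # xs @ [x]))"
    by (simp add: cdarts_def)
  also have "\<dots> = rev (map prod.swap (cdarts C))"
    by (simp only: pdarts_rev) (simp add: C cdarts_def)
  finally show ?thesis by simp
qed

text \<open>The cycle C is cut at u and v; one half is closed up by the ear traversed backwards, the
  other by the ear traversed forwards. The inductions for symmetry, multiplicity and Euler's formula
  rest on this identity.\<close>

lemma plane_map_ear_darts:
  assumes "rotate k C = u # A @ v # B"
  shows "map_darts ((u # A @ v # rev P) # (v # B @ u # P) # Fs @ Gs)
    = map_darts (Fs @ C # Gs) + mset (pdarts (u # P @ [v])) + mset (map prod.swap (pdarts (u # P @ [v])))"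
proof -
  have "mset (cdarts C) = mset (pdarts (u # A @ [v])) + mset (pdarts (v # B @ [u]))"
    using mset_cdarts_rotate[of k C] assms by (simp add: cdarts_split)
  moreover have "mset (pdarts (v # rev P @ [u])) = mset (map prod.swap (pdarts (u # P @ [v])))"
    using pdarts_rev[of "u # P @ [v]"] by simp
  ultimately show ?thesis
    by (simp add: cdarts_face1 cdarts_face2)
qed

lemma plane_map_ear_verts:
  assumes "rotate k C = u # A @ v # B"
  shows "map_verts ((u # A @ v # rev P) # (v # B @ u # P) # Fs @ Gs) = map_verts (Fs @ C # Gs) \<union> set P"
proof -
  have "set C = {u, v} \<union> set A \<union> set B"
    using assms by (metis set_rotate insert_is_Un list.set(2) set_append Un_assoc Un_left_commute Un_insert_left Un_insert_right sup_bot_left)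
  then show ?thesis by auto
qed

text \<open>A new face could be too short only if the ear were a single edge parallel to an edge of
  C, which the last premise of \<open>ear\<close> excludes.\<close>

lemma plane_map_faces: "plane_map Fs \<Longrightarrow> C \<in> set Fs \<Longrightarrow> distinct C \<and> length C \<ge> 3"
proof (induction arbitrary: C rule: plane_map.induct)
  case (ear Fs C Gs k u A v B P D)
  have C: "distinct C" "length C \<ge> 3"
    using ear.IH[of C] by auto
  have uv: "distinct (u # A @ v # B)"
    using C ear.hyps(2) by (metis distinct_rotate)
  have set: "set (u # A @ v # B) = set C"
    using ear.hyps(2) by (metis set_rotate)
  have disj: "set P \<inter> set (u # A @ v # B) = {}"
    using ear.hyps(4) set by auto
  have AP: "A \<noteq> [] \<or> P \<noteq> []"
  proof (rule ccontr)
    assume "\<not> ?thesis"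
    then have "P = []" "A = []" by auto
    then have "(u, v) \<in> set (cdarts C)"
      using ear.hyps(2) set_cdarts_rotate[of k C] cdarts_split[of u A v B] by auto
    then show False
      using ear.hyps(5) \<open>P = []\<close> by simp
  qed
  have BP: "B \<noteq> [] \<or> P \<noteq> []"
  proof (rule ccontr)
    assume "\<not> ?thesis"
    then have "P = []" "B = []" by auto
    then have "(v, u) \<in> set (cdarts C)"
      using ear.hyps(2) set_cdarts_rotate[of k C] cdarts_split[of u A v B] by auto
    then show False
      using ear.hyps(5) \<open>P = []\<close> by simp
  qed
  have len: "length A + length P \<ge> 1" "length B + length P \<ge> 1"
    using AP BP by (auto simp: Suc_le_eq)
  from ear.prems consider "D = u # A @ v # rev P" | "D = v # B @ u # P" | "D \<in> set (Fs @ C # Gs)"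
    by auto
  then show ?case
  proof cases
    case 1
    then show ?thesis using uv disj ear.hyps(3) len by auto
  next
    case 2
    then show ?thesis using uv disj ear.hyps(3) len by auto
  qed (use ear.IH in auto)
qed auto

lemma plane_map_dart_sym: "plane_map Fs \<Longrightarrow> (x, y) \<in> dart_set Fs \<Longrightarrow> (y, x) \<in> dart_set Fs"
proof (induction arbitrary: x y rule: plane_map.induct)
  case (cycle C)
  then have "C \<noteq> []" by auto
  from cdarts_rev[OF this] have "set (cdarts (rev C)) = prod.swap ` set (cdarts C)"
    by (metis mset_eq_setD set_map)
  with cycle show ?case by auto
next
  case (ear Fs C Gs k u A v B P)
  have *: "dart_set ((u # A @ v # rev P) # (v # B @ u # P) # Fs @ Gs)
    = dart_set (Fs @ C # Gs) \<union> set (pdarts (u # P @ [v])) \<union> prod.swap ` set (pdarts (u # P @ [v]))"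
    by (simp only: plane_map_ear_darts[OF ear.hyps(2)]) auto
  from ear.prems ear.IH show ?case
    unfolding * by (auto simp: in_swap_image)
qed

text \<open>With at least three vertices a cycle never runs back along an edge. In
  \<open>cycle_arcs\<close> this keeps the two halves of a cycle edge-disjoint regardless of
  direction.\<close>

lemma distinct_cycle_antisym:
  assumes "distinct C" "length C \<ge> 3" "(x, y) \<in> set (cdarts C)"
  shows "(y, x) \<notin> set (cdarts C)" "x \<noteq> y"
proof -
  obtain a b c ys where C: "C = a # b # c # ys"
    using assms(2) by (metis Suc_le_length_iff numeral_3_eq_3)
  have cd: "cdarts C = pdarts C @ [(last C, a)]"
    using cdarts_last[of C] C by simp
  have d: "a \<noteq> last C" "b \<noteq> last C"
    using assms(1) C by auto
  have ab: "(a, z) \<in> set (pdarts C) \<Longrightarrow> z = b" for z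
    using pdarts_fun[OF assms(1), of a z b] C by simp
  have last: "(last C, z) \<notin> set (pdarts C)" for z
  proof
    assume "(last C, z) \<in> set (pdarts C)"
    then have "last C \<in> set (butlast C)"
      using pdarts_butlast_tl by metis
    then show False
      using assms(1) C by (metis append_butlast_last_id distinct_butlast list.distinct(1) not_distinct_conv_prefix)
  qed
  show "(y, x) \<notin> set (cdarts C)" "x \<noteq> y"
    using assms(3) pdarts_antisym[OF assms(1), of x y] pdarts_irrefl[OF assms(1), of x y] ab last d
    unfolding cd by auto
qed

lemma cdarts_from_unique:
  assumes "distinct C" "(x, y) \<in> set (cdarts C)" "(x, z) \<in> set (cdarts C)"
  shows "y = z"
proof -
  have "x \<in> set C" using assms(2) cdarts_in_set by metis
  then obtain X Y where C: "C = X @ x # Y"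
    by (meson split_list)
  have r: "rotate (length X) C = x # (Y @ X)"
    using C by (simp add: rotate_append)
  let ?C = "x # (Y @ X)"
  have d: "distinct ?C"
    using assms(1) C by auto
  have sets: "set (cdarts C) = set (cdarts ?C)"
    by (metis set_cdarts_rotate r)
  obtain w W where W: "Y @ X @ [x] = w # W"
    by (cases "Y @ X @ [x]") auto
  have cd: "cdarts ?C = (x, w) # pdarts (w # W)"
    by (simp add: cdarts_def W)
  have "butlast (w # W) = Y @ X"
    by (metis W append.assoc butlast_snoc)
  then have "(x, t) \<notin> set (pdarts (w # W))" for t
    using pdarts_butlast_tl[of x t "w # W"] d by auto
  then show ?thesis
    using assms(2,3) unfolding sets cd by auto
qed

lemma cdarts_to_unique:
  assumes "distinct C" "(y, x) \<in> set (cdarts C)" "(z, x) \<in> set (cdarts C)"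
  shows "y = z"
proof -
  have "C \<noteq> []" using assms(2) cdarts_in_set by fastforce
  have "(x, y) \<in> set (cdarts (rev C))" "(x, z) \<in> set (cdarts (rev C))"
    using assms(2,3) mset_eq_setD[OF cdarts_rev[OF \<open>C \<noteq> []\<close>]] by (auto simp: in_swap_image)
  then show ?thesis
    using assms(1) cdarts_from_unique[of "rev C" x y z] by simp
qed

lemma distinct_cdarts:
  assumes "distinct C"
  shows "distinct (cdarts C)"
proof (cases C)
  case (Cons x xs)
  have "distinct (pdarts C)"
    using assms by (rule distinct_pdarts)
  moreover have "cdarts C = pdarts C @ [(last C, x)]"
    using cdarts_last[of C] Cons by simp
  moreover have "(last C, x) \<notin> set (pdarts C)"
    using pdarts_butlast_tl[of "last C" x C] assms Cons by auto
  ultimately show ?thesis by simp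
qed (simp add: cdarts_def)

lemma count_mset_distinct: "distinct xs \<Longrightarrow> count (mset xs) d \<le> 1"
  by (simp add: distinct_count_atmost_1)

text \<open>If an ear has inner vertices, each of its darts touches one of them; if it has none, it
  is a new edge by the side condition of \<open>ear\<close>. So no dart of an ear occurred before,
  in either direction.\<close>

lemma plane_map_count: "plane_map Fs \<Longrightarrow> count (map_darts Fs) d \<le> 1"
proof (induction rule: plane_map.induct)
  case (cycle C)
  then have ne: "C \<noteq> []" by auto
  have *: "mset (cdarts (rev C)) = mset (map prod.swap (cdarts C))"
    by (rule cdarts_rev[OF ne])
  obtain x y where d: "d = (x, y)" by force
  have "distinct (cdarts C)" "distinct (cdarts (rev C))"
    using cycle distinct_cdarts[of C] distinct_cdarts[of "rev C"] by auto
  then have 1: "count (mset (cdarts C)) d \<le> 1" "count (mset (cdarts (rev C))) d \<le> 1"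
    using count_mset_distinct[of "cdarts C"] count_mset_distinct[of "cdarts (rev C)"] by blast+
  have "\<not> (d \<in> set (cdarts C) \<and> d \<in> set (cdarts (rev C)))"
    using distinct_cycle_antisym[OF cycle, of x y] mset_eq_setD[OF *] d by (auto simp: in_swap_image)
  then have "count (mset (cdarts C)) d = 0 \<or> count (mset (cdarts (rev C))) d = 0"
    by (simp add: count_eq_zero_iff)
  with 1 have "count (mset (cdarts C)) d + count (mset (cdarts (rev C))) d \<le> 1"
    by linarith
  then show ?case by simp
next
  case (ear Fs C Gs k u A v B P)
  let ?p = "pdarts (u # P @ [v])"
  have C: "distinct C" "u \<in> set C" "v \<in> set C" "u \<noteq> v"
    using plane_map_faces[OF ear.hyps(1), of C] ear.hyps(2) 
    by (auto simp flip: set_rotate[of k C] distinct_rotate[of k C])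
  have dist: "distinct (u # P @ [v])"
    using ear.hyps(3,4) C by auto
  obtain x y where d: "d = (x, y)" by force
  have 1: "count (mset ?p) d \<le> 1" "count (mset (map prod.swap ?p)) d \<le> 1"
    using distinct_pdarts[OF dist] count_mset_distinct[of ?p] count_mset_distinct[of "map prod.swap ?p"]
    by (simp_all add: distinct_map)
  have 2: "\<not> (d \<in> set ?p \<and> d \<in> set (map prod.swap ?p))"
    using pdarts_antisym[OF dist, of x y] d by auto
  have new: "(a, b) \<in> set ?p \<Longrightarrow> (a, b) \<notin> dart_set (Fs @ C # Gs) \<and> (b, a) \<notin> dart_set (Fs @ C # Gs)" for a b
  proof (cases "P = []")
    case False
    assume ab: "(a, b) \<in> set ?p"
    \<comment> \<open>A dart that avoids P could only be (u, v), but u is followed by the first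
      inner vertex of the ear.\<close>
    have "a \<in> set P \<or> b \<in> set P"
    proof (rule ccontr)
      assume n: "\<not> ?thesis"
      then have "a = u" "b = v"
        using pdarts_butlast_tl[OF ab] False by (auto simp: butlast_append)
      moreover obtain p Q where "P = p # Q" using False by (cases P) auto
      ultimately show False
        using pdarts_fun[OF dist ab, of p] n by auto
    qed
    then have "\<not> (a \<in> map_verts (Fs @ C # Gs) \<and> b \<in> map_verts (Fs @ C # Gs))"
      using ear.hyps(4) by blast
    then show ?thesis
      unfolding dart_set_eq by (auto dest: cdarts_in_set)
  qed (use ear.hyps(5) in auto)
  then have 3: "d \<in> set ?p \<or> d \<in> set (map prod.swap ?p) \<Longrightarrow> d \<notin> dart_set (Fs @ C # Gs)"
    using d by auto
  have "count (map_darts (Fs @ C # Gs)) d + count (mset ?p) d + count (mset (map prod.swap ?p)) d \<le> 1"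
  proof (cases "d \<in> set ?p \<or> d \<in> set (map prod.swap ?p)")
    case True
    then have "count (map_darts (Fs @ C # Gs)) d = 0"
      using 3 by (simp add: count_eq_zero_iff)
    moreover have "count (mset ?p) d = 0 \<or> count (mset (map prod.swap ?p)) d = 0"
      using 2 by (metis count_eq_zero_iff set_mset_mset)
    ultimately show ?thesis using 1 by linarith
  next
    case False
    then have "count (mset ?p) d = 0" "count (mset (map prod.swap ?p)) d = 0"
      by (metis count_eq_zero_iff set_mset_mset)+
    then show ?thesis using ear.IH by linarith
  qed
  then show ?case
    unfolding plane_map_ear_darts[OF ear.hyps(2)] by simp
qed

text \<open>This is n - m + F = 2, doubled since there are 2m darts. An ear with l inner vertices
  adds l vertices, l + 1 edges and one face.\<close>

lemma plane_map_euler: "plane_map Fs \<Longrightarrow> 2 * length Fs + 2 * card (map_verts Fs) = size (map_darts Fs) + 4"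
proof (induction rule: plane_map.induct)
  case (cycle C)
  then have "C \<noteq> []" "rev C \<noteq> []" by auto
  with cycle show ?case
    by (simp add: length_cdarts distinct_card)
next
  case (ear Fs C Gs k u A v B P)
  have "card (map_verts (Fs @ C # Gs) \<union> set P) = card (map_verts (Fs @ C # Gs)) + length P"
    using ear.hyps(3,4) by (subst card_Un_disjoint) (auto simp: distinct_card)
  moreover have "length (pdarts (u # P @ [v])) = length P + 1"
    by (simp add: length_pdarts)
  ultimately show ?case
    using ear.IH unfolding plane_map_ear_verts[OF ear.hyps(2)] plane_map_ear_darts[OF ear.hyps(2)]
    by simp
qed

section \<open>The cyclic order of the neighbours of a vertex\<close>

definition corner :: "'a list list \<Rightarrow> 'a \<Rightarrow> ('a \<times> 'a) set" where
  "corner Fs v = {(x, y). \<exists>C\<in>set Fs. (x, v) \<in> set (cdarts C) \<and> (v, y) \<in> set (cdarts C)}"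

lemma rtrancl_extend:
  assumes "\<And>x y. (x, y) \<in> r \<Longrightarrow> (x, y) \<in> s\<^sup>*" "(x, y) \<in> r\<^sup>*"
  shows "(x, y) \<in> s\<^sup>*"
  using assms(2) by (induction) (auto intro: rtrancl_trans assms(1))

text \<open>The corners at a vertex form a single orbit, so that the surface has no pinch point
  there. An ear ending at the vertex merely inserts one neighbour into the corner that it splits,
  and an inner vertex of an ear has just two neighbours, which are exchanged.\<close>

lemma plane_map_corner_trans:
  "plane_map Fs \<Longrightarrow> (v, x) \<in> dart_set Fs \<Longrightarrow> (v, y) \<in> dart_set Fs \<Longrightarrow> (x, y) \<in> (corner Fs v)\<^sup>*"
proof (induction arbitrary: v x y rule: plane_map.induct)
  case (cycle C)
  then have ne: "C \<noteq> []" by auto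
  have rev: "(a, b) \<in> set (cdarts (rev C)) \<longleftrightarrow> (b, a) \<in> set (cdarts C)" for a b
    using mset_eq_setD[OF cdarts_rev[OF ne]] by (simp add: in_swap_image)
  have 1: "(a, b) \<in> corner [C, rev C] v" if "(v, a) \<in> set (cdarts C)" "(b, v) \<in> set (cdarts C)" for a b
    using that rev by (auto simp: corner_def)
  have 2: "(b, a) \<in> corner [C, rev C] v" if "(v, a) \<in> set (cdarts C)" "(b, v) \<in> set (cdarts C)" for a b
    using that rev by (auto simp: corner_def)
  have "(v, x) \<in> set (cdarts C) \<or> (x, v) \<in> set (cdarts C)" "(v, y) \<in> set (cdarts C) \<or> (y, v) \<in> set (cdarts C)"
    using cycle.prems rev by auto
  then show ?case
    using 1 2 cdarts_from_unique[OF cycle.hyps(1), of v x y] cdarts_to_unique[OF cycle.hyps(1), of x v y]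
    by blast
next
  case (ear Fs C Gs k u A v B P w)
  let ?F = "(u # A @ v # rev P) # (v # B @ u # P) # Fs @ Gs"
  let ?p = "set (pdarts (u # P @ [v]))"
  have C: "distinct C" "u \<noteq> v" "distinct (u # A @ v # B)" "set C = set (u # A @ v # B)"
    using plane_map_faces[OF ear.hyps(1), of C] ear.hyps(2) 
    by (auto simp flip: set_rotate[of k C] distinct_rotate[of k C])
  have CP: "set C \<inter> set P = {}"
    using ear.hyps(4) by auto
  have dist: "distinct (u # P @ [v])"
    using ear.hyps(3) CP C by auto
  have setC: "set (cdarts C) = set (pdarts (u # A @ [v])) \<union> set (pdarts (v # B @ [u]))"
    using set_cdarts_rotate[of k C] ear.hyps(2) by (simp add: cdarts_split)
  have set1: "set (cdarts (u # A @ v # rev P)) = set (pdarts (u # A @ [v])) \<union> prod.swap ` ?p"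
    using pdarts_rev_ear[of v P u] by (simp add: cdarts_face1)
  have set2: "set (cdarts (v # B @ u # P)) = set (pdarts (v # B @ [u])) \<union> ?p"
    by (simp add: cdarts_face2)
  have ds: "dart_set ?F = dart_set (Fs @ C # Gs) \<union> ?p \<union> prod.swap ` ?p"
    by (simp only: plane_map_ear_darts[OF ear.hyps(2)]) auto
  have n1: "(a, b) \<in> corner ?F z" if "(a, z) \<in> set (pdarts (u # A @ [v])) \<union> prod.swap ` ?p"
      "(z, b) \<in> set (pdarts (u # A @ [v])) \<union> prod.swap ` ?p" for a b z
    unfolding corner_def using that set1 by auto
  have n2: "(a, b) \<in> corner ?F z" if "(a, z) \<in> set (pdarts (v # B @ [u])) \<union> ?p"
      "(z, b) \<in> set (pdarts (v # B @ [u])) \<union> ?p" for a b z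
    unfolding corner_def using that set2 by auto
  obtain p0 where p0: "(u, p0) \<in> ?p"
    by (cases P) auto
  obtain p1 where p1: "(p1, v) \<in> ?p"
    using pdarts_snoc[of "butlast (u # P)" "last (u # P)" v]
    by (metis (no_types, lifting) append.assoc append_Cons append_Nil append_butlast_last_id in_set_conv_decomp list.distinct(1) list.set_intros(1) rotate1.simps(2) set_rotate1)
  obtain a1 where a1: "(a1, v) \<in> set (pdarts (u # A @ [v]))"
    using pdarts_snoc[of "butlast (u # A)" "last (u # A)" v]
    by (metis (no_types, lifting) append.assoc append_Cons append_Nil append_butlast_last_id in_set_conv_decomp list.distinct(1) list.set_intros(1) rotate1.simps(2) set_rotate1)
  obtain b1 where b1: "(b1, u) \<in> set (pdarts (v # B @ [u]))"
    using pdarts_snoc[of "butlast (v # B)" "last (v # B)" u]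
    by (metis (no_types, lifting) append.assoc append_Cons append_Nil append_butlast_last_id in_set_conv_decomp list.distinct(1) list.set_intros(1) rotate1.simps(2) set_rotate1)
  obtain a0 where a0: "(u, a0) \<in> set (pdarts (u # A @ [v]))"
    by (cases A) auto
  obtain b0 where b0: "(v, b0) \<in> set (pdarts (v # B @ [u]))"
    by (cases B) auto
  \<comment> \<open>The corners destroyed are those of C at u and v where the two halves meet; each
    is replaced by two corners through the adjacent vertex of the ear, \<open>p0\<close> or
    \<open>p1\<close>.\<close>
  have old: "(a, b) \<in> (corner ?F w)\<^sup>*" if "(a, b) \<in> corner (Fs @ C # Gs) w" for a b
  proof -
    from that consider "(a, b) \<in> corner (Fs @ Gs) w" | "(a, w) \<in> set (cdarts C)" "(w, b) \<in> set (cdarts C)"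
      unfolding corner_def by auto
    then show ?thesis
    proof cases
      case 1
      then have "(a, b) \<in> corner ?F w"
        unfolding corner_def by auto
      then show ?thesis by auto
    next
      case 2
      then consider "(a, w) \<in> set (pdarts (u # A @ [v]))" "(w, b) \<in> set (pdarts (u # A @ [v]))"
        | "(a, w) \<in> set (pdarts (v # B @ [u]))" "(w, b) \<in> set (pdarts (v # B @ [u]))"
        | "(a, w) \<in> set (pdarts (u # A @ [v]))" "(w, b) \<in> set (pdarts (v # B @ [u]))"
        | "(a, w) \<in> set (pdarts (v # B @ [u]))" "(w, b) \<in> set (pdarts (u # A @ [v]))"
        unfolding setC by auto
      then show ?thesis
      proof cases
        case 1
        then show ?thesis using n1[of a w b] by auto
      next
        case 2
        then show ?thesis using n2[of a w b] by auto
      next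
        case 3
        have "w \<in> set (A @ [v])" "w \<in> set (v # B)"
          using pdarts_butlast_tl[OF 3(1)] pdarts_butlast_tl[OF 3(2)] by (auto simp: butlast_append)
        then have w: "w = v" using C(3) by auto
        have "(a, p1) \<in> corner ?F w" "(p1, b) \<in> corner ?F w"
          using n1[of a w p1] n2[of p1 w b] 3 p1 w by (auto simp: in_swap_image)
        then show ?thesis by auto
      next
        case 4
        have "w \<in> set (B @ [u])" "w \<in> set (u # A)"
          using pdarts_butlast_tl[OF 4(1)] pdarts_butlast_tl[OF 4(2)] by (auto simp: butlast_append)
        then have w: "w = u" using C(3) by auto
        have "(a, p0) \<in> corner ?F w" "(p0, b) \<in> corner ?F w"
          using n2[of a w p0] n1[of p0 w b] 4 p0 w by (auto simp: in_swap_image)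
        then show ?thesis by auto
      qed
    qed
  qed
  have oldD: "(a, b) \<in> (corner ?F w)\<^sup>*" if "(w, a) \<in> dart_set (Fs @ C # Gs)" "(w, b) \<in> dart_set (Fs @ C # Gs)" for a b
    using rtrancl_extend[OF old ear.IH[OF that]] .
  have Cd: "set (cdarts C) \<subseteq> dart_set (Fs @ C # Gs)"
    by auto
  have sym: "(b, a) \<in> dart_set (Fs @ C # Gs)" if "(a, b) \<in> set (cdarts C)" for a b
    using plane_map_dart_sym[OF ear.hyps(1)] Cd that by blast
  show ?case
  proof (cases "w \<in> set P")
    case True
    have no: "(w, z) \<notin> dart_set (Fs @ C # Gs)" for z
      using True ear.hyps(4) unfolding dart_set_eq by (auto dest: cdarts_in_set)
    have 3: "(a, b) \<in> corner ?F w \<and> (b, a) \<in> corner ?F w" if "(w, a) \<in> ?p" "(b, w) \<in> ?p" for a b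
      using n2[of b w a] n1[of a w b] that by (auto simp: in_swap_image)
    have un: "a = b" if "(a, w) \<in> ?p" "(b, w) \<in> ?p" for a b
      using that pdarts_fun[of "rev (u # P @ [v])" w a b] dist unfolding pdarts_rev by (auto simp: in_swap_image)
    have "(w, x) \<in> ?p \<or> (x, w) \<in> ?p" "(w, y) \<in> ?p \<or> (y, w) \<in> ?p"
      using ear.prems no unfolding ds by (auto simp: in_swap_image)
    then consider "(w, x) \<in> ?p" "(w, y) \<in> ?p" | "(x, w) \<in> ?p" "(y, w) \<in> ?p"
      | "(w, x) \<in> ?p" "(y, w) \<in> ?p" | "(x, w) \<in> ?p" "(w, y) \<in> ?p"
      by argo
    then show ?thesis
    proof cases
      case 1
      then have "x = y" by (rule pdarts_fun[OF dist])
      then show ?thesis by simp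
    next
      case 2
      then have "x = y" by (rule un)
      then show ?thesis by simp
    qed (use 3[of x y] 3[of y x] in auto)
  next
    case False
    \<comment> \<open>A neighbour gained through the ear lies between two old ones, so the question
      reduces to old neighbours.\<close>
    have nb: "\<exists>z. (w, z) \<in> dart_set (Fs @ C # Gs) \<and> (x', z) \<in> (corner ?F w)\<^sup>* \<and> (z, x') \<in> (corner ?F w)\<^sup>*"
      if x': "(w, x') \<in> dart_set ?F" for x'
    proof (cases "(w, x') \<in> dart_set (Fs @ C # Gs)")
      case old: True
      then show ?thesis by auto
    next
      case new: False
      then consider "(w, x') \<in> ?p" | "(x', w) \<in> ?p"
        using x' unfolding ds by (auto simp: in_swap_image)
      then show ?thesis
      proof cases
        case 1
        then have w: "w = u"
          using pdarts_butlast_tl[OF 1] False by (auto simp: butlast_append)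
        have "(x', a0) \<in> corner ?F w" "(b1, x') \<in> corner ?F w"
          using n1[of x' w a0] n2[of b1 w x'] 1 a0 b1 w by (auto simp: in_swap_image)
        moreover have "(w, a0) \<in> dart_set (Fs @ C # Gs)" "(w, b1) \<in> dart_set (Fs @ C # Gs)"
          using a0 Cd sym[of b1 u] setC b1 w by auto
        ultimately show ?thesis
          using oldD[of a0 b1] by (meson r_into_rtrancl rtrancl_trans)
      next
        case 2
        then have w: "w = v"
          using pdarts_butlast_tl[OF 2] False by (auto simp: butlast_append)
        have "(x', b0) \<in> corner ?F w" "(a1, x') \<in> corner ?F w"
          using n2[of x' w b0] n1[of a1 w x'] 2 b0 a1 w by (auto simp: in_swap_image)
        moreover have "(w, b0) \<in> dart_set (Fs @ C # Gs)" "(w, a1) \<in> dart_set (Fs @ C # Gs)"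
          using b0 Cd sym[of a1 v] setC a1 w by auto
        ultimately show ?thesis
          using oldD[of b0 a1] by (meson r_into_rtrancl rtrancl_trans)
      qed
    qed
    from nb[OF ear.prems(1)] nb[OF ear.prems(2)] obtain z z' where
      "(w, z) \<in> dart_set (Fs @ C # Gs)" "(x, z) \<in> (corner ?F w)\<^sup>*"
      "(w, z') \<in> dart_set (Fs @ C # Gs)" "(z', y) \<in> (corner ?F w)\<^sup>*"
      by blast
    then show ?thesis
      using oldD[of z z'] by (meson rtrancl_trans)
  qed
qed

section \<open>Adding an ear to a drawing\<close>

lemma arc_interior_eq:
  fixes c :: "real \<Rightarrow> complex"
  assumes "arc c" "pathstart c = a" "pathfinish c = b"
  shows "path_image c - {a, b} = c ` {0<..<1}"
proof -
  have inj: "inj_on c {0..1}"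
    using assms(1) by (simp add: arc_def)
  have "{0<..<1} = {0..1} - {0, 1::real}"
    by auto
  then have "c ` {0<..<1} = c ` {0..1} - c ` {0, 1}"
    using inj_on_image_set_diff[OF inj, of "{0..1}" "{0, 1}"] by simp
  then show ?thesis
    using assms(2,3) by (simp add: path_image_def pathstart_def pathfinish_def)
qed

lemma connected_arc_interior:
  fixes c :: "real \<Rightarrow> complex"
  assumes "arc c" "pathstart c = a" "pathfinish c = b"
  shows "connected (path_image c - {a, b})"
proof -
  have "continuous_on {0<..<1} c"
    using assms(1) unfolding arc_def path_def
    by (meson continuous_on_subset greaterThanLessThan_subseteq_atLeastAtMost_iff order_refl)
  then show ?thesis
    unfolding arc_interior_eq[OF assms] by (rule connected_continuous_image) simp
qed

text \<open>Locates the ends of an ear in the closure of the face that contains its inside.\<close>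

lemma arc_subset_closure_interior:
  fixes c :: "real \<Rightarrow> complex"
  assumes "arc c" "pathstart c = a" "pathfinish c = b"
  shows "path_image c \<subseteq> closure (path_image c - {a, b})"
proof -
  have cl: "closure {0<..<1} = {0..1::real}"
    by simp
  have "c ` closure {0<..<1} \<subseteq> closure (c ` {0<..<1})"
    using assms(1) unfolding arc_def path_def
    by (intro image_closure_subset[of _ _ "closure (c ` {0<..<1})"]) (simp_all add: cl closure_subset)
  then show ?thesis
    unfolding arc_interior_eq[OF assms] unfolding path_image_def cl .
qed

lemma cdarts_verts: "fst ` set (cdarts C) \<union> snd ` set (cdarts C) = set C"
proof
  show "fst ` set (cdarts C) \<union> snd ` set (cdarts C) \<subseteq> set C"
    using cdarts_in_set by fastforce
  show "set C \<subseteq> fst ` set (cdarts C) \<union> snd ` set (cdarts C)"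
  proof
    fix x assume "x \<in> set C"
    then obtain y where "(x, y) \<in> set (cdarts C)"
      using ex_cdart_from by metis
    then show "x \<in> fst ` set (cdarts C) \<union> snd ` set (cdarts C)"
      by force
  qed
qed

lemma dart_set_verts: "fst ` dart_set Fs \<union> snd ` dart_set Fs = map_verts Fs"
  unfolding dart_set_eq image_UN UN_Un_distrib[symmetric] cdarts_verts ..

lemma dart_set_in_verts: "(a, b) \<in> dart_set Fs \<Longrightarrow> a \<in> map_verts Fs \<and> b \<in> map_verts Fs"
  unfolding dart_set_eq using cdarts_in_set by fastforce

section \<open>Subdrawings of a plane drawing and the addition of an ear\<close>

locale plane_graph =
  fixes V :: "'a set" and E :: "'a set set" and pos :: "'a \<Rightarrow> complex" and \<gamma> :: "'a set \<Rightarrow> real \<Rightarrow> complex"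
  assumes simple: "simple_graph V E" and drawing: "plane_drawing V E pos \<gamma>"
begin

definition darts :: "('a \<times> 'a) set" where
  "darts = {(x, y). {x, y} \<in> E}"

definition img :: "('a \<times> 'a) set \<Rightarrow> complex set" where
  "img D = (\<Union>(x, y)\<in>D. path_image (\<gamma> {x, y}))"

lemma img_Un: "img (D \<union> D') = img D \<union> img D'"
  unfolding img_def by blast

lemma img_insert: "img (insert (x, y) D) = path_image (\<gamma> {x, y}) \<union> img D" and img_empty: "img {} = {}"
  unfolding img_def by simp_all

lemma img_mono: "D \<subseteq> D' \<Longrightarrow> img D \<subseteq> img D'"
  unfolding img_def by blast

lemma img_swap: "img (prod.swap ` D) = img D"
  unfolding img_def by (auto simp: insert_commute)

lemma darts_sym: "(x, y) \<in> darts \<Longrightarrow> (y, x) \<in> darts"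
  by (simp add: darts_def insert_commute)

lemma darts_verts:
  assumes "(x, y) \<in> darts"
  shows "x \<in> V" "y \<in> V" "x \<noteq> y"
proof -
  have "{x, y} \<subseteq> V" "card {x, y} = 2"
    using assms simple by (auto simp: darts_def simple_graph_def)
  then show "x \<in> V" "y \<in> V" "x \<noteq> y"
    by (auto simp: card_insert_if split: if_splits)
qed

lemma finite_V: "finite V"
  using simple by (simp add: simple_graph_def)

lemma finite_E: "finite E"
proof -
  have "E \<subseteq> Pow V"
    using simple by (auto simp: simple_graph_def)
  then show ?thesis
    using finite_V finite_subset by blast
qed

lemma darts_subset: "darts \<subseteq> V \<times> V"
  using darts_verts by auto

lemma finite_darts: "finite darts"
  using finite_V darts_subset by (meson finite_SigmaI finite_subset)

lemma card_darts: "card darts = 2 * card E"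
proof -
  have "darts = (\<Union>e\<in>E. {(x, y). {x, y} = e})"
    by (auto simp: darts_def)
  moreover have "card (\<Union>e\<in>E. {(x, y). {x, y} = e}) = (\<Sum>e\<in>E. card {(x, y). {x, y} = e})"
  proof (rule card_UN_disjoint)
    show "finite E" by (rule finite_E)
    show "\<forall>e\<in>E. finite {(x, y). {x, y} = e}"
    proof
      fix e assume "e \<in> E"
      then have "{(x, y). {x, y} = e} \<subseteq> darts" by (auto simp: darts_def)
      then show "finite {(x, y). {x, y} = e}"
        using finite_darts finite_subset by blast
    qed
  qed auto
  moreover have "card {(x, y). {x, y} = e} = 2" if "e \<in> E" for e
  proof -
    have "card e = 2"
      using simple that by (auto simp: simple_graph_def)
    then obtain a b where "e = {a, b}" "a \<noteq> b"
      by (auto simp: card_2_iff)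
    then have "{(x, y). {x, y} = e} = {(a, b), (b, a)}"
      by (auto simp: doubleton_eq_iff)
    then show ?thesis
      using \<open>a \<noteq> b\<close> by simp
  qed
  ultimately show ?thesis by simp
qed

lemma edge_image:
  assumes "(x, y) \<in> darts"
  shows "arc (\<gamma> {x, y})" "{pathstart (\<gamma> {x, y}), pathfinish (\<gamma> {x, y})} = {pos x, pos y}"
    "path_image (\<gamma> {x, y}) \<inter> pos ` V = {pos x, pos y}"
  using assms drawing by (auto simp: plane_drawing_def darts_def)

lemma edge_arc:
  assumes "(x, y) \<in> darts"
  obtains g where "arc g" "pathstart g = pos x" "pathfinish g = pos y" "path_image g = path_image (\<gamma> {x, y})"
proof -
  note e = edge_image[OF assms]
  then consider "pathstart (\<gamma> {x, y}) = pos x" "pathfinish (\<gamma> {x, y}) = pos y"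
    | "pathstart (\<gamma> {x, y}) = pos y" "pathfinish (\<gamma> {x, y}) = pos x"
    by (auto simp: doubleton_eq_iff)
  then show thesis
  proof cases
    case 1
    then show thesis using that e by blast
  next
    case 2
    then show thesis
      using that[of "reversepath (\<gamma> {x, y})"] e by (simp add: arc_reversepath)
  qed
qed

lemma edges_meet:
  "e \<in> E \<Longrightarrow> f \<in> E \<Longrightarrow> e \<noteq> f \<Longrightarrow> path_image (\<gamma> e) \<inter> path_image (\<gamma> f) = pos ` (e \<inter> f)"
  using drawing by (simp add: plane_drawing_def)

lemma pos_inj: "x \<in> V \<Longrightarrow> y \<in> V \<Longrightarrow> pos x = pos y \<Longrightarrow> x = y"
  using drawing by (auto simp: plane_drawing_def inj_on_def)

text \<open>Distinct edges meet only in common ends. The condition with \<open>prod.swap\<close> is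
  there because a dart and its reverse are drawn by the same arc.\<close>

lemma img_disjoint_edges:
  assumes "D \<subseteq> darts" "D' \<subseteq> darts" "D \<inter> D' = {}" "D \<inter> prod.swap ` D' = {}"
  shows "img D \<inter> img D' \<subseteq> pos ` ((fst ` D \<union> snd ` D) \<inter> (fst ` D' \<union> snd ` D'))"
proof
  fix p assume "p \<in> img D \<inter> img D'"
  then obtain x y x' y' where xy: "(x, y) \<in> D" "p \<in> path_image (\<gamma> {x, y})"
    "(x', y') \<in> D'" "p \<in> path_image (\<gamma> {x', y'})"
    unfolding img_def by blast
  have "(y', x') \<in> prod.swap ` D'"
    using xy(3) by (simp add: in_swap_image)
  then have "{x, y} \<noteq> {x', y'}"
    using assms(3,4) xy(1,3) by (auto simp: doubleton_eq_iff)
  then have "path_image (\<gamma> {x, y}) \<inter> path_image (\<gamma> {x', y'}) = pos ` ({x, y} \<inter> {x', y'})"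
    using assms(1,2) xy(1,3) by (intro edges_meet) (auto simp: darts_def)
  then have "p \<in> pos ` ({x, y} \<inter> {x', y'})"
    using xy by blast
  moreover have "{x, y} \<subseteq> fst ` D \<union> snd ` D" "{x', y'} \<subseteq> fst ` D' \<union> snd ` D'"
    using xy by force+
  ultimately show "p \<in> pos ` ((fst ` D \<union> snd ` D) \<inter> (fst ` D' \<union> snd ` D'))"
    by blast
qed

lemma pos_in_img:
  assumes "D \<subseteq> darts" "v \<in> V"
  shows "pos v \<in> img D \<longleftrightarrow> v \<in> fst ` D \<union> snd ` D"
proof
  assume "pos v \<in> img D"
  then obtain x y where xy: "(x, y) \<in> D" "pos v \<in> path_image (\<gamma> {x, y})"
    unfolding img_def by blast
  then have "pos v \<in> {pos x, pos y}"
    using edge_image(3)[of x y] assms by blast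
  then have "v = x \<or> v = y"
    using pos_inj assms darts_verts[of x y] xy by auto
  then show "v \<in> fst ` D \<union> snd ` D"
    using xy(1) by force
next
  assume "v \<in> fst ` D \<union> snd ` D"
  then obtain w where "(v, w) \<in> D \<or> (w, v) \<in> D"
    by force
  then show "pos v \<in> img D"
    using edge_image(3)[of v w] edge_image(3)[of w v] assms unfolding img_def by blast
qed

lemma pdarts_verts: "xs = x # y # zs \<Longrightarrow> fst ` set (pdarts xs) \<union> snd ` set (pdarts xs) = set xs"
proof (induction zs arbitrary: xs x y)
  case (Cons z zs)
  have "fst ` set (pdarts (y # z # zs)) \<union> snd ` set (pdarts (y # z # zs)) = set (y # z # zs)"
    by (rule Cons.IH) simp
  then show ?case using Cons.prems by auto
qed auto

lemma path_arc:
  assumes "distinct xs" "xs = x # y # zs" "set (pdarts xs) \<subseteq> darts"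
  shows "\<exists>g. arc g \<and> pathstart g = pos x \<and> pathfinish g = pos (last xs) \<and> path_image g = img (set (pdarts xs))"
  using assms
proof (induction zs arbitrary: xs x y)
  case Nil
  then have "(x, y) \<in> darts" by simp
  from edge_arc[OF this] obtain g where
    "arc g" "pathstart g = pos x" "pathfinish g = pos y" "path_image g = path_image (\<gamma> {x, y})" .
  then show ?case
    using Nil by (auto simp: img_insert img_empty)
next
  case (Cons z zs)
  let ?ys = "y # z # zs"
  have d: "distinct ?ys" "set (pdarts ?ys) \<subseteq> darts" "(x, y) \<in> darts" "x \<notin> set ?ys"
    using Cons.prems by auto
  obtain g where g: "arc g" "pathstart g = pos y" "pathfinish g = pos (last ?ys)" "path_image g = img (set (pdarts ?ys))"
    using Cons.IH[of ?ys] d by blast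
  obtain h where h: "arc h" "pathstart h = pos x" "pathfinish h = pos y" "path_image h = path_image (\<gamma> {x, y})"
    using edge_arc[OF d(3)] .
  have "img {(x, y)} \<inter> img (set (pdarts ?ys)) \<subseteq> pos ` ((fst ` {(x, y)} \<union> snd ` {(x, y)}) \<inter> (fst ` set (pdarts ?ys) \<union> snd ` set (pdarts ?ys)))"
  proof (rule img_disjoint_edges)
    show "{(x, y)} \<inter> set (pdarts ?ys) = {}" "{(x, y)} \<inter> prod.swap ` set (pdarts ?ys) = {}"
      using d(4) pdarts_in_set[of x y ?ys] pdarts_in_set[of y x ?ys] by (auto simp: in_swap_image)
  qed (use d in auto)
  also have "\<dots> = pos ` ({x, y} \<inter> set ?ys)"
    unfolding pdarts_verts[of ?ys y z zs, OF refl] by auto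
  also have "\<dots> \<subseteq> {pos y}"
    using d(4) by auto
  finally have sub: "path_image h \<inter> path_image g \<subseteq> {pathstart g}"
    using g h by (simp add: img_insert img_empty)
  have "arc (h +++ g)"
    using arc_join[OF h(1) g(1)] g h sub by simp
  moreover have "path_image (h +++ g) = img (set (pdarts xs))"
    using g h Cons.prems by (simp add: path_image_join img_insert img_empty)
  ultimately show ?case
    using g h Cons.prems by (intro exI[of _ "h +++ g"]) auto
qed

lemma path_arc':
  assumes "distinct (x # P @ [y])" "set (pdarts (x # P @ [y])) \<subseteq> darts"
  obtains g where "arc g" "pathstart g = pos x" "pathfinish g = pos y" "path_image g = img (set (pdarts (x # P @ [y])))"
proof -
  obtain z zs where "x # P @ [y] = x # z # zs"
    by (cases P) auto
  from path_arc[OF assms(1) this assms(2)] show thesis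
    using that by auto
qed

lemma pdarts_verts': "fst ` set (pdarts (x # P @ [y])) \<union> snd ` set (pdarts (x # P @ [y])) = insert x (insert y (set P))"
  using pdarts_verts[of "x # P @ [y]" x "hd (P @ [y])" "tl (P @ [y])"] by (cases P) auto

text \<open>A face of a subdrawing is one of the two sides of the Jordan curve formed by its boundary.\<close>

definition realizes :: "'a list list \<Rightarrow> complex set list \<Rightarrow> bool" where
  "realizes Fs Rs \<longleftrightarrow> list_all2 (\<lambda>C R. jordan_side (img (set (cdarts C))) R) Fs Rs
     \<and> (\<forall>R\<in>set Rs. R \<inter> img (dart_set Fs) = {}) \<and> sorted_wrt (\<lambda>R S. R \<inter> S = {}) Rs
     \<and> - img (dart_set Fs) \<subseteq> \<Union> (set Rs)"

text \<open>The invariant under which the subgraph grows until its darts are all of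
  \<open>darts\<close>.\<close>

definition plane_state :: "'a list list \<Rightarrow> bool" where
  "plane_state Fs \<longleftrightarrow> plane_map Fs \<and> dart_set Fs \<subseteq> darts \<and> (\<exists>Rs. realizes Fs Rs)"

lemma set_pdarts_rev: "set (pdarts (u # rev B @ [v])) = prod.swap ` set (pdarts (v # B @ [u]))"
  using pdarts_rev[of "v # B @ [u]"] by simp

text \<open>Two vertices cut the cycle into two paths. The second one leads from v to u and is drawn
  backwards, which gives both arcs the same start and finish as the theta lemmas require.\<close>

lemma cycle_arcs:
  assumes "distinct (u # A @ v # B)" "length (u # A @ v # B) \<ge> 3" "set (cdarts (u # A @ v # B)) \<subseteq> darts"
  obtains g h where "arc g" "arc h" "pathstart g = pos u" "pathfinish g = pos v"
    "pathstart h = pos u" "pathfinish h = pos v"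
    "path_image g = img (set (pdarts (u # A @ [v])))" "path_image h = img (set (pdarts (v # B @ [u])))"
    "path_image g \<inter> path_image h = {pos u, pos v}"
proof -
  let ?p = "set (pdarts (u # A @ [v]))" and ?q = "set (pdarts (v # B @ [u]))"
  have sub: "?p \<subseteq> darts" "?q \<subseteq> darts"
    using assms(3) by (auto simp: cdarts_split)
  have q': "set (pdarts (u # rev B @ [v])) = prod.swap ` ?q"
    by (rule set_pdarts_rev)
  have sub': "set (pdarts (u # rev B @ [v])) \<subseteq> darts"
    unfolding q' using sub(2) darts_sym by auto
  obtain g where g: "arc g" "pathstart g = pos u" "pathfinish g = pos v" "path_image g = img ?p"
    using path_arc'[of u A v] assms(1) sub by auto
  obtain h where h: "arc h" "pathstart h = pos u" "pathfinish h = pos v" "path_image h = img ?q"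
    using path_arc'[of u "rev B" v] assms(1) sub' unfolding q' img_swap by auto
  have "img ?p \<inter> img ?q \<subseteq> pos ` ((fst ` ?p \<union> snd ` ?p) \<inter> (fst ` ?q \<union> snd ` ?q))"
  proof (rule img_disjoint_edges[OF sub])
    have "distinct (cdarts (u # A @ v # B))"
      using assms(1) by (rule distinct_cdarts)
    then show "?p \<inter> ?q = {}"
      by (simp add: cdarts_split)
    show "?p \<inter> prod.swap ` ?q = {}"
    proof (rule ccontr)
      assume "?p \<inter> prod.swap ` ?q \<noteq> {}"
      then obtain x y where "(x, y) \<in> ?p" "(y, x) \<in> ?q"
        by force
      then show False
        using distinct_cycle_antisym(1)[OF assms(1,2), of x y] by (simp add: cdarts_split)
    qed
  qed
  also have "\<dots> = pos ` ((insert u (insert v (set A))) \<inter> (insert v (insert u (set B))))"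
    by (simp only: pdarts_verts')
  also have "\<dots> = {pos u, pos v}"
    using assms(1) by auto
  finally have 1: "img ?p \<inter> img ?q \<subseteq> {pos u, pos v}" .
  have V: "u \<in> V" "v \<in> V"
    using sub(1) darts_subset pdarts_verts'[of u A v] by force+
  have "{pos u, pos v} \<subseteq> img ?p \<inter> img ?q"
    using pos_in_img[OF sub(1)] pos_in_img[OF sub(2)] V by (simp only: pdarts_verts') simp
  with 1 have "path_image g \<inter> path_image h = {pos u, pos v}"
    unfolding g(4) h(4) by (rule equalityI)
  then show thesis
    by (rule that[OF g(1) h(1) g(2,3) h(2,3) g(4) h(4)])
qed

text \<open>The inside of the ear is connected and misses the drawing, so it lies in one region S.
  The ends lie in the closure of S but on the drawing, hence on the boundary cycle of S. The ear is
  thus attached to a single face, which \<open>theta_split\<close> divides just as the rule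
  \<open>ear\<close> divides the list.\<close>

lemma ear_step:
  assumes st: "plane_state Fs" and uv: "u \<in> map_verts Fs" "v \<in> map_verts Fs" "u \<noteq> v"
    and P: "distinct P" "set P \<inter> map_verts Fs = {}" "set (pdarts (u # P @ [v])) \<subseteq> darts"
      "P = [] \<Longrightarrow> (u, v) \<notin> dart_set Fs"
  obtains Gs where "plane_state Gs" "dart_set Gs = dart_set Fs \<union> set (pdarts (u # P @ [v])) \<union> prod.swap ` set (pdarts (u # P @ [v]))"
proof -
  let ?p = "set (pdarts (u # P @ [v]))" and ?D = "dart_set Fs"
  obtain Rs where pm: "plane_map Fs" and D: "?D \<subseteq> darts" and R: "realizes Fs Rs"
    using st by (auto simp: plane_state_def)
  have Dsym: "prod.swap ` ?D = ?D"
    using plane_map_dart_sym[OF pm] by (auto simp: in_swap_image)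
  have Dverts: "fst ` ?D \<union> snd ` ?D = map_verts Fs"
    by (rule dart_set_verts)
  have V: "u \<in> V" "v \<in> V"
    using P(3) darts_subset pdarts_verts'[of u P v] by force+
  have dist: "distinct (u # P @ [v])"
    using P uv by auto
  obtain c where c: "arc c" "pathstart c = pos u" "pathfinish c = pos v" "path_image c = img ?p"
    using path_arc'[OF dist P(3)] .
  have newdart: "(a, b) \<notin> ?D \<and> (b, a) \<notin> ?D" if ab: "(a, b) \<in> ?p" for a b
  proof (cases "P = []")
    case True
    then show ?thesis
      using P(4) ab plane_map_dart_sym[OF pm] by auto
  next
    case False
    have "a \<in> set P \<or> b \<in> set P"
    proof (rule ccontr)
      assume n: "\<not> ?thesis"
      then have "a = u" "b = v"
        using pdarts_butlast_tl[OF ab] False by (auto simp: butlast_append)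
      moreover obtain p Q where "P = p # Q" using False by (cases P) auto
      ultimately show False
        using pdarts_fun[OF dist ab, of p] n by auto
    qed
    then show ?thesis
      using P(2) dart_set_in_verts[of a b Fs] dart_set_in_verts[of b a Fs] by auto
  qed
  have "img ?p \<inter> img ?D \<subseteq> pos ` ((fst ` ?p \<union> snd ` ?p) \<inter> (fst ` ?D \<union> snd ` ?D))"
  proof (rule img_disjoint_edges[OF P(3) D])
    show "?p \<inter> ?D = {}" "?p \<inter> prod.swap ` ?D = {}"
      using newdart by (auto simp: in_swap_image)
  qed
  also have "\<dots> = {pos u, pos v}"
    unfolding Dverts pdarts_verts' using P(2) uv by auto
  finally have pD: "img ?p \<inter> img ?D \<subseteq> {pos u, pos v}" .
  have uvD: "pos u \<in> img ?D" "pos v \<in> img ?D"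
    using pos_in_img[OF D] V uv Dverts by auto
  have conn: "connected (path_image c - {pos u, pos v})"
    by (rule connected_arc_interior[OF c(1-3)])
  have ci_ne: "path_image c - {pos u, pos v} \<noteq> {}"
    using arc_interior_point[OF c(1-3)] .
  have ci_out: "path_image c - {pos u, pos v} \<subseteq> - img ?D"
    using pD c(4) by auto
  have cover: "- img ?D \<subseteq> \<Union> (set Rs)"
    using R by (simp add: realizes_def)
  obtain z where z: "z \<in> path_image c - {pos u, pos v}"
    using ci_ne by auto
  then have "z \<in> \<Union> (set Rs)"
    using ci_out cover by auto
  then obtain S1 S S2 where Rs: "Rs = S1 @ S # S2" and zS: "z \<in> S"
    by (meson UnionE split_list)
  have la: "list_all2 (\<lambda>C R. jordan_side (img (set (cdarts C))) R) Fs (S1 @ S # S2)"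
    using R Rs by (simp add: realizes_def)
  then obtain F1 C F2 where Fs: "Fs = F1 @ C # F2"
    and la1: "list_all2 (\<lambda>C R. jordan_side (img (set (cdarts C))) R) F1 S1"
    and la2: "list_all2 (\<lambda>C R. jordan_side (img (set (cdarts C))) R) F2 S2"
    and side: "jordan_side (img (set (cdarts C))) S"
    by (auto simp: list_all2_append2 list_all2_Cons2)
  have C: "distinct C" "length C \<ge> 3"
    using plane_map_faces[OF pm, of C] Fs by auto
  have CD: "set (cdarts C) \<subseteq> ?D"
    unfolding Fs by auto
  then have Cd: "set (cdarts C) \<subseteq> darts"
    using D by auto
  have Cverts: "fst ` set (cdarts C) \<union> snd ` set (cdarts C) = set C"
    by (rule cdarts_verts)
  have Sdisj: "S \<inter> img ?D = {}"
    using R Rs by (simp add: realizes_def)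
  \<comment> \<open>It is not known yet that u and v lie on C, so two arbitrary vertices of C
    present its drawing as a Jordan curve.\<close>
  have Sprop: "open S" "frontier S = img (set (cdarts C))"
  proof -
    obtain u' v' where uv': "u' \<in> set C" "v' \<in> set C" "u' \<noteq> v'"
      using C by (metis One_nat_def Suc_1 Suc_le_length_iff distinct_length_2_or_more list.set_intros(1) list.set_intros(2) numeral_3_eq_3)
    obtain k A' B' where r: "rotate k C = u' # A' @ v' # B'"
      using rotate_to[OF uv'] .
    have *: "distinct (u' # A' @ v' # B')" "length (u' # A' @ v' # B') \<ge> 3" "set (cdarts (u' # A' @ v' # B')) \<subseteq> darts"
      using C Cd set_cdarts_rotate[of k C] by (simp_all flip: r)
    obtain g h where gh: "arc g" "arc h" "pathstart g = pos u'" "pathfinish g = pos v'"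
      "pathstart h = pos u'" "pathfinish h = pos v'"
      "path_image g = img (set (pdarts (u' # A' @ [v'])))" "path_image h = img (set (pdarts (v' # B' @ [u'])))"
      "path_image g \<inter> path_image h = {pos u', pos v'}"
      using cycle_arcs[OF *] .
    have "set (cdarts C) = set (pdarts (u' # A' @ [v'])) \<union> set (pdarts (v' # B' @ [u']))"
      using set_cdarts_rotate[of k C] by (simp add: r cdarts_split)
    then have "img (set (cdarts C)) = path_image g \<union> path_image h"
      by (simp only: img_Un gh(7,8))
    then show "open S" "frontier S = img (set (cdarts C))"
      using Jordan_inside_outside_arcs(4-7)[OF gh(1-6,9)] side by (auto simp: jordan_side_def)
  qed
  \<comment> \<open>To leave S, the ear would have to meet its frontier, which is part of the old
    drawing.\<close>
  have cS: "path_image c - {pos u, pos v} \<subseteq> S"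
  proof (rule ccontr)
    assume "\<not> ?thesis"
    then have "(path_image c - {pos u, pos v}) \<inter> frontier S \<noteq> {}"
      using connected_Int_frontier[OF conn, of S] z zS by blast
    then show False
      using Sprop(2) img_mono[OF CD] ci_out by blast
  qed
  have cl: "path_image c \<subseteq> closure S"
    using arc_subset_closure_interior[OF c(1-3)] closure_mono[OF cS] by blast
  have "pos u \<in> path_image c" "pos v \<in> path_image c"
    using c(2,3) pathstart_in_path_image pathfinish_in_path_image by metis+
  then have "pos u \<in> frontier S" "pos v \<in> frontier S"
    using cl uvD Sdisj Sprop(1) by (auto simp: frontier_def interior_open)
  then have uvC: "u \<in> set C" "v \<in> set C"
    using Sprop(2) pos_in_img[OF Cd] V Cverts by auto
  obtain k A B where r: "rotate k C = u # A @ v # B"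
    using rotate_to[OF uvC uv(3)] .
  have *: "distinct (u # A @ v # B)" "length (u # A @ v # B) \<ge> 3" "set (cdarts (u # A @ v # B)) \<subseteq> darts"
    using C Cd set_cdarts_rotate[of k C] by (simp_all flip: r)
  obtain g h where gh: "arc g" "arc h" "pathstart g = pos u" "pathfinish g = pos v"
    "pathstart h = pos u" "pathfinish h = pos v"
    "path_image g = img (set (pdarts (u # A @ [v])))" "path_image h = img (set (pdarts (v # B @ [u])))"
    "path_image g \<inter> path_image h = {pos u, pos v}"
    using cycle_arcs[OF *] .
  have CC: "set (cdarts C) = set (pdarts (u # A @ [v])) \<union> set (pdarts (v # B @ [u]))"
    using set_cdarts_rotate[of k C] by (simp add: r cdarts_split)
  have imC: "img (set (cdarts C)) = path_image g \<union> path_image h"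
    by (simp only: CC img_Un gh(7,8))
  have ghD: "path_image g \<subseteq> img ?D" "path_image h \<subseteq> img ?D"
    using imC img_mono[OF CD] by auto
  have ends: "{pos u, pos v} \<subseteq> path_image g" "{pos u, pos v} \<subseteq> path_image h" "{pos u, pos v} \<subseteq> path_image c"
    using gh(9) \<open>pos u \<in> path_image c\<close> \<open>pos v \<in> path_image c\<close> by auto
  have gc: "path_image g \<inter> path_image c = {pos u, pos v}" "path_image h \<inter> path_image c = {pos u, pos v}"
  proof -
    have "path_image c \<inter> img ?D \<subseteq> {pos u, pos v}"
      unfolding c(4) by (rule pD)
    then show "path_image g \<inter> path_image c = {pos u, pos v}" "path_image h \<inter> path_image c = {pos u, pos v}"
      using ghD ends by auto
  qed
  obtain R1 R2 where R12: "jordan_side (path_image g \<union> path_image c) R1"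
    "jordan_side (path_image h \<union> path_image c) R2"
    "R1 \<inter> R2 = {}" "R1 \<union> R2 \<union> (path_image c - {pos u, pos v}) = S"
    using theta_split[OF gh(1,2) c(1) gh(3-6) c(2,3) gh(9) gc _ cS] side imC by metis
  let ?G = "(u # A @ v # rev P) # (v # B @ u # P) # F1 @ F2"
  have pm': "plane_map ?G"
  proof (rule plane_map.ear[OF pm[unfolded Fs] r P(1)])
    show "set P \<inter> map_verts (F1 @ C # F2) = {}"
      using P(2) unfolding Fs .
    show "(u, v) \<notin> dart_set (F1 @ C # F2) \<and> (v, u) \<notin> dart_set (F1 @ C # F2)" if "P = []"
      using P(4)[OF that] plane_map_dart_sym[OF pm, of v u] unfolding Fs by blast
  qed
  have ds: "dart_set ?G = ?D \<union> ?p \<union> prod.swap ` ?p"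
    unfolding Fs by (simp only: plane_map_ear_darts[OF r]) auto
  have im': "img (dart_set ?G) = img ?D \<union> path_image c"
    unfolding ds img_Un img_swap using c(4) by auto
  have G1: "img (set (cdarts (u # A @ v # rev P))) = path_image g \<union> path_image c"
    unfolding cdarts_face1 using pdarts_rev_ear[of v P u] gh(7) c(4) by (simp add: img_Un img_swap)
  have G2: "img (set (cdarts (v # B @ u # P))) = path_image h \<union> path_image c"
    unfolding cdarts_face2 using gh(8) c(4) by (simp add: img_Un)
  have R12D: "R1 \<inter> (img ?D \<union> path_image c) = {}" "R2 \<inter> (img ?D \<union> path_image c) = {}"
  proof -
    have sub: "R1 \<subseteq> S" "R2 \<subseteq> S"
      using R12(4) by auto
    have "R1 \<inter> path_image c = {}" "R2 \<inter> path_image c = {}"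
      using R12(1,2) inside_no_overlap[of "path_image g \<union> path_image c"] inside_no_overlap[of "path_image h \<union> path_image c"]
        outside_no_overlap[of "path_image g \<union> path_image c"] outside_no_overlap[of "path_image h \<union> path_image c"]
      unfolding jordan_side_def by blast+
    then show "R1 \<inter> (img ?D \<union> path_image c) = {}" "R2 \<inter> (img ?D \<union> path_image c) = {}"
      using sub Sdisj by auto
  qed
  have sw: "sorted_wrt (\<lambda>R S. R \<inter> S = {}) (S1 @ S # S2)"
    using R Rs by (simp add: realizes_def)
  have othS: "T \<inter> S = {}" if "T \<in> set (S1 @ S2)" for T
    using sw that by (auto simp: sorted_wrt_append)
  have "realizes ?G (R1 # R2 # S1 @ S2)"
    unfolding realizes_def
  proof (intro conjI)
    show "list_all2 (\<lambda>C R. jordan_side (img (set (cdarts C))) R) ?G (R1 # R2 # S1 @ S2)"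
      using la1 la2 R12(1,2) G1 G2 by (simp add: list_all2_appendI)
    \<comment> \<open>A region other than S misses the ear: the inside of the ear is in S, and its
      ends are on the old drawing.\<close>
    have "T \<inter> (img ?D \<union> path_image c) = {}" if T: "T \<in> set (S1 @ S2)" for T
    proof -
      have "T \<inter> img ?D = {}"
        using R Rs T by (auto simp: realizes_def)
      then show ?thesis
        using othS[OF T] cS uvD by blast
    qed
    then show "\<forall>R\<in>set (R1 # R2 # S1 @ S2). R \<inter> img (dart_set ?G) = {}"
      unfolding im' using R12D by simp
    have "T \<inter> R1 = {}" "T \<inter> R2 = {}" if T: "T \<in> set (S1 @ S2)" for T
      using othS[OF T] R12(4) by blast+
    then show "sorted_wrt (\<lambda>R S. R \<inter> S = {}) (R1 # R2 # S1 @ S2)"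
      using sw R12(3) by (auto simp: sorted_wrt_append)
    have "- img ?D \<subseteq> \<Union> (set (S1 @ S # S2))"
      using R Rs by (simp add: realizes_def)
    also have "\<dots> \<subseteq> \<Union> (set (R1 # R2 # S1 @ S2)) \<union> path_image c"
      using R12(4) by auto
    finally show "- img (dart_set ?G) \<subseteq> \<Union> (set (R1 # R2 # S1 @ S2))"
      unfolding im' by blast
  qed
  then have "plane_state ?G"
    unfolding plane_state_def using pm' ds D P(3) darts_sym by (auto simp: in_swap_image)
  then show thesis
    using that ds by blast
qed

end

section \<open>Two-connected plane graphs and Euler's inequality\<close>

lemma rtrancl_distinct_path:
  assumes "(x, y) \<in> r\<^sup>*"
  shows "\<exists>xs. xs \<noteq> [] \<and> hd xs = x \<and> last xs = y \<and> distinct xs \<and> set (pdarts xs) \<subseteq> r"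
  using assms
proof induction
  case base
  show ?case by (rule exI[of _ "[x]"]) simp
next
  case (step y z)
  then obtain xs where xs: "xs \<noteq> []" "hd xs = x" "last xs = y" "distinct xs" "set (pdarts xs) \<subseteq> r"
    by blast
  show ?case
  proof (cases "z \<in> set xs")
    case True
    then obtain as bs where s: "xs = as @ z # bs"
      by (meson split_list)
    then have "set (pdarts (as @ [z])) \<subseteq> r"
      using xs(5) pdarts_append[of as z bs] by auto
    then show ?thesis
      using xs s by (intro exI[of _ "as @ [z]"]) (auto simp: hd_append)
  next
    case False
    have "pdarts (xs @ [z]) = pdarts xs @ [(y, z)]"
      using pdarts_snoc[of "butlast xs" y z] xs(1,3) append_butlast_last_id[of xs] 
      by (metis append.assoc append_Cons append_Nil)
    then show ?thesis
      using xs step(2) False by (intro exI[of _ "xs @ [z]"]) auto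
  qed
qed

lemma rtrancl_path_ends:
  assumes "(x, y) \<in> r\<^sup>*" "x \<noteq> y"
  obtains P where "distinct (x # P @ [y])" "set (pdarts (x # P @ [y])) \<subseteq> r"
proof -
  obtain xs where xs: "xs \<noteq> []" "hd xs = x" "last xs = y" "distinct xs" "set (pdarts xs) \<subseteq> r"
    using rtrancl_distinct_path[OF assms(1)] by blast
  then obtain ys where ys: "xs = x # ys"
    by (cases xs) auto
  then have "ys \<noteq> []"
    using xs(3) assms(2) by auto
  then have "ys = butlast ys @ [y]"
    using xs(3) ys by (metis append_butlast_last_id last_ConsR)
  then show thesis
    using that[of "butlast ys"] xs ys by metis
qed

lemma rtrancl_crosses:
  assumes "(a, b) \<in> r\<^sup>*" "a \<in> S" "b \<notin> S"
  shows "\<exists>u w. (u, w) \<in> r \<and> u \<in> S \<and> w \<notin> S"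
  using assms by induction auto

lemma plane_map_nonempty: "plane_map Fs \<Longrightarrow> Fs \<noteq> []"
  by (cases rule: plane_map.cases) auto

section \<open>Ear decomposition of two-connected plane graphs\<close>

context plane_graph
begin

definition adj_avoiding :: "'a \<Rightarrow> ('a \<times> 'a) set" where
  "adj_avoiding v = {(a, b). (a, b) \<in> darts \<and> a \<noteq> v \<and> b \<noteq> v}"

lemma adj_avoiding_step:
  assumes "(x, y) \<in> (adj_avoiding v)\<^sup>*" "x \<noteq> y"
  shows "\<exists>z. (x, z) \<in> darts \<and> z \<noteq> v"
  using assms by (cases rule: converse_rtranclE) (auto simp: adj_avoiding_def)

lemma path_avoiding:
  assumes "set (pdarts (x # P @ [y])) \<subseteq> adj_avoiding z"
  shows "z \<notin> set (x # P @ [y])"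
proof
  assume "z \<in> set (x # P @ [y])"
  then have "z \<in> fst ` set (pdarts (x # P @ [y])) \<union> snd ` set (pdarts (x # P @ [y]))"
    unfolding pdarts_verts' by auto
  then obtain d where "d \<in> set (pdarts (x # P @ [y]))" "z = fst d \<or> z = snd d"
    by auto
  then show False
    using assms by (auto simp: adj_avoiding_def)
qed

text \<open>Deleting a third vertex shows that such a graph is connected as well, so a path between
  any two vertices can be taken from \<open>adj_avoiding\<close>.\<close>

definition two_connected :: bool where
  "two_connected \<longleftrightarrow> card V \<ge> 3 \<and> (\<forall>v\<in>V. \<forall>x\<in>V - {v}. \<forall>y\<in>V - {v}. (x, y) \<in> (adj_avoiding v)\<^sup>*)"

lemma cycle_state:
  assumes "distinct C" "length C \<ge> 3" "set (cdarts C) \<subseteq> darts"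
  shows "plane_state [C, rev C]"
proof -
  have ne: "C \<noteq> []" using assms(2) by auto
  obtain u v B where C: "C = u # [] @ v # B"
    using assms(2) by (cases C; cases "tl C") auto
  obtain g h where gh: "arc g" "arc h" "pathstart g = pos u" "pathfinish g = pos v"
    "pathstart h = pos u" "pathfinish h = pos v"
    "path_image g = img (set (pdarts (u # [] @ [v])))" "path_image h = img (set (pdarts (v # B @ [u])))"
    "path_image g \<inter> path_image h = {pos u, pos v}"
    using cycle_arcs[of u "[]" v B] assms unfolding C by blast
  let ?J = "img (set (cdarts C))"
  have "set (cdarts C) = set (pdarts (u # [] @ [v])) \<union> set (pdarts (v # B @ [u]))"
    unfolding C cdarts_split by simp
  then have J: "?J = path_image g \<union> path_image h"
    by (simp only: img_Un gh(7,8))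
  have rev: "set (cdarts (rev C)) = prod.swap ` set (cdarts C)"
    using mset_eq_setD[OF cdarts_rev[OF ne]] by simp
  then have imrev: "img (set (cdarts (rev C))) = ?J"
    by (simp add: img_swap)
  have imD: "img (dart_set [C, rev C]) = ?J"
    using imrev by (simp add: img_Un)
  note jio = Jordan_inside_outside_arcs(8,9)[OF gh(1-6,9)]
  \<comment> \<open>\<open>jordan_side\<close> does not record orientation, so either list may
    receive the inside.\<close>
  have "realizes [C, rev C] [inside ?J, outside ?J]"
    unfolding realizes_def imD using imrev jio inside_no_overlap[of ?J] outside_no_overlap[of ?J]
    by (simp add: jordan_side_def J)
  moreover have "dart_set [C, rev C] \<subseteq> darts"
    using rev assms(3) darts_sym by (auto simp: in_swap_image)
  ultimately show ?thesis
    unfolding plane_state_def using plane_map.cycle[OF assms(1,2)] by blast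
qed

text \<open>An edge from a to z, a second neighbour w of z, and a path from w to a that avoids z
  close up to a cycle.\<close>

lemma initial_cycle:
  assumes "two_connected"
  shows "\<exists>Fs. plane_state Fs"
proof -
  have conn: "(x, y) \<in> (adj_avoiding v)\<^sup>*" if "v \<in> V" "x \<in> V" "y \<in> V" "x \<noteq> v" "y \<noteq> v" for v x y
    using assms that by (auto simp: two_connected_def)
  have other: "\<exists>t\<in>V. t \<noteq> a \<and> t \<noteq> b" for a b
  proof (rule ccontr)
    assume "\<not> ?thesis"
    then have "V \<subseteq> {a, b}" by auto
    then have "card V \<le> card {a, b}" by (intro card_mono) auto
    also have "\<dots> \<le> 2" by (simp add: card_insert_if)
    finally show False using assms by (simp add: two_connected_def)
  qed
  obtain a where a: "a \<in> V" using other by blast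
  obtain b where b: "b \<in> V" "b \<noteq> a" using other by blast
  obtain c where c: "c \<in> V" "c \<noteq> a" "c \<noteq> b" using other by blast
  obtain z where z: "(a, z) \<in> darts"
    using adj_avoiding_step[OF conn[of c a b]] a b c by metis
  obtain t where t: "t \<in> V" "t \<noteq> a" "t \<noteq> z" using other by blast
  have zV: "z \<in> V" "z \<noteq> a"
    using darts_verts[OF z] by auto
  obtain w where w: "(z, w) \<in> darts" "w \<noteq> a"
    using adj_avoiding_step[OF conn[of a z t]] t zV a by metis
  have wV: "w \<in> V" "w \<noteq> z"
    using darts_verts[OF w(1)] by auto
  obtain P where P: "distinct (w # P @ [a])" "set (pdarts (w # P @ [a])) \<subseteq> adj_avoiding z"
    using rtrancl_path_ends[OF conn[of z w a]] zV wV a w by metis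
  have "z \<notin> set (w # P @ [a])"
    by (rule path_avoiding[OF P(2)])
  moreover have "set (pdarts (w # P @ [a])) \<subseteq> darts"
    using P(2) by (auto simp: adj_avoiding_def)
  ultimately have "plane_state [z # w # P @ [a], rev (z # w # P @ [a])]"
    using P(1) z w pdarts_snoc[of "w # P" a z] by (intro cycle_state) (auto simp: cdarts_def)
  then show ?thesis ..
qed

text \<open>If all vertices are present, a missing edge is itself an ear. Otherwise some edge leaves
  the subgraph at a vertex u; as u is no cut vertex, a path avoiding u leads from the far end back
  to the subgraph, and its part up to the first return completes an ear.\<close>

lemma grow_step:
  assumes tc: "two_connected" and st: "plane_state Fs" and ne: "dart_set Fs \<noteq> darts"
  shows "\<exists>Gs. plane_state Gs \<and> dart_set Fs \<subset> dart_set Gs"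
proof -
  have pm: "plane_map Fs" and D: "dart_set Fs \<subseteq> darts"
    using st by (auto simp: plane_state_def)
  have conn: "(x, y) \<in> (adj_avoiding v)\<^sup>*" if "v \<in> V" "x \<in> V" "y \<in> V" "x \<noteq> v" "y \<noteq> v" for v x y
    using tc that by (auto simp: two_connected_def)
  have VHV: "map_verts Fs \<subseteq> V"
    unfolding dart_set_verts[symmetric] using D darts_subset by auto
  obtain C where C: "C \<in> set Fs"
    using plane_map_nonempty[OF pm] hd_in_set by blast
  then have "distinct C" "length C \<ge> 3"
    using plane_map_faces[OF pm] by auto
  then have "card (set C) \<ge> 3"
    by (simp add: distinct_card)
  then have other: "\<exists>h\<in>map_verts Fs. h \<noteq> u" for u
  proof -
    have "\<not> set C \<subseteq> {u}"
      using \<open>card (set C) \<ge> 3\<close> card_mono[of "{u}" "set C"] by auto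
    then show ?thesis using C by auto
  qed
  show ?thesis
  proof (cases "V \<subseteq> map_verts Fs")
    case True
    obtain x y where xy: "(x, y) \<in> darts" "(x, y) \<notin> dart_set Fs"
      using ne D by auto
    have "x \<in> map_verts Fs" "y \<in> map_verts Fs" "x \<noteq> y"
      using darts_verts[OF xy(1)] True by auto
    from ear_step[OF st this, of "[]"] xy obtain Gs where
      Gs: "plane_state Gs" "dart_set Gs = dart_set Fs \<union> {(x, y)} \<union> prod.swap ` {(x, y)}"
      by auto
    then have "dart_set Fs \<subset> dart_set Gs"
      using xy(2) by auto
    then show ?thesis using Gs(1) by blast
  next
    case False
    then obtain t where t: "t \<in> V" "t \<notin> map_verts Fs" by auto
    obtain h0 where h0: "h0 \<in> map_verts Fs" using other by blast
    obtain h1 where h1: "h1 \<in> map_verts Fs" "h1 \<noteq> h0" using other by blast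
    \<comment> \<open>Any path from the subgraph to t serves; deleting \<open>h1\<close> brings it
      into the form of the definition of \<open>two_connected\<close>.\<close>
    have "(h0, t) \<in> (adj_avoiding h1)\<^sup>*"
      using conn[of h1 h0 t] VHV h0 h1 t by blast
    then obtain u w where uw: "(u, w) \<in> adj_avoiding h1" "u \<in> map_verts Fs" "w \<notin> map_verts Fs"
      using rtrancl_crosses[of h0 t _ "map_verts Fs"] h0 t by blast
    have uwd: "(u, w) \<in> darts"
      using uw by (auto simp: adj_avoiding_def)
    obtain h where h: "h \<in> map_verts Fs" "h \<noteq> u" using other by blast
    have "(w, h) \<in> (adj_avoiding u)\<^sup>*" "w \<noteq> h"
      using conn[of u w h] VHV h uw darts_verts[OF uwd] by blast+
    then obtain P where P: "distinct (w # P @ [h])" "set (pdarts (w # P @ [h])) \<subseteq> adj_avoiding u"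
      using rtrancl_path_ends by metis
    have "\<exists>z\<in>set (w # P @ [h]). z \<in> map_verts Fs"
      using h(1) by auto
    then obtain as v bs where s: "w # P @ [h] = as @ v # bs" "v \<in> map_verts Fs" "\<forall>z\<in>set as. z \<notin> map_verts Fs"
      using split_list_first_prop[of "w # P @ [h]" "\<lambda>z. z \<in> map_verts Fs"] by blast
    obtain as' where as': "as = w # as'"
      using s uw(3) by (cases as) auto
    have d: "distinct (as @ [v])"
      using P(1) unfolding s(1) by auto
    have p: "set (pdarts (as @ [v])) \<subseteq> adj_avoiding u"
      using P(2) unfolding s(1) pdarts_append[of as v bs] by auto
    have "v \<noteq> u"
      using path_avoiding[of w as' v u] p as' by auto
    have dd: "set (pdarts (u # as @ [v])) \<subseteq> darts"
      using p uwd as' by (auto simp: adj_avoiding_def)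
    obtain Gs where
      Gs: "plane_state Gs" "dart_set Gs = dart_set Fs \<union> set (pdarts (u # as @ [v])) \<union> prod.swap ` set (pdarts (u # as @ [v]))"
    proof (rule ear_step[OF st uw(2) s(2)])
      show "u \<noteq> v" "distinct as" "set as \<inter> map_verts Fs = {}"
        using \<open>v \<noteq> u\<close> d s(3) by auto
      show "set (pdarts (u # as @ [v])) \<subseteq> darts" by (rule dd)
      show "(u, v) \<notin> dart_set Fs" if "as = []"
        using that as' by simp
    qed
    have "(u, w) \<in> dart_set Gs"
      using as' Gs(2) by auto
    moreover have "(u, w) \<notin> dart_set Fs"
      using uw(3) dart_set_in_verts by metis
    ultimately have "dart_set Fs \<subset> dart_set Gs"
      using Gs(2) by auto
    then show ?thesis using Gs(1) by blast
  qed
qed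

lemma two_connected_plane_map:
  assumes "two_connected"
  obtains Fs where "plane_map Fs" "dart_set Fs = darts" "map_verts Fs = V"
proof -
  obtain Fs0 where "plane_state Fs0"
    using initial_cycle[OF assms] by blast
  then have "\<exists>Gs. plane_state Gs \<and> dart_set Gs = darts"
  proof (induction "card (darts - dart_set Fs0)" arbitrary: Fs0 rule: less_induct)
    case less
    show ?case
    proof (cases "dart_set Fs0 = darts")
      case False
      obtain Gs where Gs: "plane_state Gs" "dart_set Fs0 \<subset> dart_set Gs"
        using grow_step[OF assms less.prems False] by blast
      have "dart_set Gs \<subseteq> darts"
        using Gs(1) by (simp add: plane_state_def)
      then have "darts - dart_set Gs \<subset> darts - dart_set Fs0"
        using Gs(2) by auto
      then have "card (darts - dart_set Gs) < card (darts - dart_set Fs0)"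
        using finite_darts by (intro psubset_card_mono) auto
      then show ?thesis
        using less.hyps Gs(1) by blast
    qed (use less.prems in blast)
  qed
  then obtain Fs where Fs: "plane_map Fs" "dart_set Fs = darts"
    by (auto simp: plane_state_def)
  \<comment> \<open>No vertex is isolated, so the darts determine the vertex set.\<close>
  have "v \<in> fst ` darts" if v: "v \<in> V" for v
  proof -
    have "\<not> V \<subseteq> {v}"
      using assms card_mono[of "{v}" V] by (auto simp: two_connected_def)
    then obtain y where y: "y \<in> V" "y \<noteq> v" by auto
    have "\<not> V \<subseteq> {v, y}"
      using assms card_mono[of "{v, y}" V] y by (auto simp: two_connected_def)
    then obtain c where c: "c \<in> V" "c \<noteq> v" "c \<noteq> y" by auto
    have "(v, y) \<in> (adj_avoiding c)\<^sup>*"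
      using assms v y c by (auto simp: two_connected_def)
    then obtain z where "(v, z) \<in> darts"
      using adj_avoiding_step y(2) by metis
    then show ?thesis by force
  qed
  then have "map_verts Fs = V"
    unfolding dart_set_verts[symmetric] Fs(2) using darts_subset by auto
  then show thesis
    using that Fs by blast
qed

text \<open>S is the component of x after the deletion of v, and no edge joins S to T. Disconnected
  graphs are covered too, which spares a separate treatment of components.\<close>

lemma cut_decomposition:
  assumes "\<not> two_connected" "card V \<ge> 3"
  obtains V1 V2 v where "V1 \<union> V2 = V" "V1 \<inter> V2 = {v}" "card V1 \<ge> 2" "card V2 \<ge> 2"
    "\<And>e. e \<in> E \<Longrightarrow> e \<subseteq> V1 \<or> e \<subseteq> V2"
proof -
  obtain v x y where v: "v \<in> V" "x \<in> V" "x \<noteq> v" "y \<in> V" "y \<noteq> v" "(x, y) \<notin> (adj_avoiding v)\<^sup>*"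
    using assms by (auto simp: two_connected_def)
  define S where "S = {z \<in> V - {v}. (x, z) \<in> (adj_avoiding v)\<^sup>*}"
  define T where "T = V - {v} - S"
  have xS: "x \<in> S" and yT: "y \<in> T"
    using v by (auto simp: S_def T_def)
  have cl: "b \<in> S" if "(a, b) \<in> darts" "a \<in> S" "b \<noteq> v" for a b
  proof -
    have "(a, b) \<in> adj_avoiding v"
      using that by (auto simp: adj_avoiding_def S_def)
    moreover have "(x, a) \<in> (adj_avoiding v)\<^sup>*"
      using that by (simp add: S_def)
    ultimately show ?thesis
      using that darts_verts[OF that(1)] by (auto simp: S_def)
  qed
  have edge: "e \<subseteq> insert v S \<or> e \<subseteq> insert v T" if e: "e \<in> E" for e
  proof -
    have "card e = 2" "e \<subseteq> V"
      using e simple by (auto simp: simple_graph_def)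
    then obtain a b where ab: "e = {a, b}"
      by (auto simp: card_2_iff)
    then have "(a, b) \<in> darts" "(b, a) \<in> darts"
      using e by (auto simp: darts_def insert_commute)
    then show ?thesis
      using cl[of a b] cl[of b a] \<open>e \<subseteq> V\<close> unfolding ab T_def by blast
  qed
  have "2 \<le> card (insert v S)"
    using card_mono[of "insert v S" "{v, x}"] xS v finite_V by (auto simp: S_def)
  moreover have "2 \<le> card (insert v T)"
    using card_mono[of "insert v T" "{v, y}"] yT v finite_V by (auto simp: T_def)
  ultimately show thesis
    using that[of "insert v S" "insert v T" v] edge v by (auto simp: S_def T_def)
qed

end

section \<open>Bipartite plane graphs: even faces and the bound on the number of edges\<close>

lemma path_parity:
  assumes "\<And>x y. (x, y) \<in> set (pdarts xs) \<Longrightarrow> x \<in> X \<longleftrightarrow> y \<notin> X" "xs \<noteq> []"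
  shows "(hd xs \<in> X \<longleftrightarrow> last xs \<in> X) \<longleftrightarrow> odd (length xs)"
  using assms
proof (induction xs rule: pdarts.induct)
  case (1 x y xs)
  then have "(y \<in> X \<longleftrightarrow> last (y # xs) \<in> X) \<longleftrightarrow> odd (length (y # xs))"
    by simp
  moreover have "x \<in> X \<longleftrightarrow> y \<notin> X"
    using 1(2)[of x y] by simp
  ultimately show ?case by auto
qed auto

lemma bipartite_face_even:
  assumes "\<And>x y. (x, y) \<in> set (cdarts C) \<Longrightarrow> x \<in> X \<longleftrightarrow> y \<notin> X" "C \<noteq> []"
  shows "even (length C)"
proof -
  have "(hd (C @ [hd C]) \<in> X \<longleftrightarrow> last (C @ [hd C]) \<in> X) \<longleftrightarrow> odd (length (C @ [hd C]))"
    by (rule path_parity) (use assms in \<open>simp_all add: cdarts_def\<close>)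
  then show ?thesis
    using assms(2) by simp
qed

lemma plane_map_size: "plane_map Fs \<Longrightarrow> size (map_darts Fs) = card (dart_set Fs)"
proof -
  assume pm: "plane_map Fs"
  have "count (map_darts Fs) d = 1" if "d \<in> dart_set Fs" for d
    using plane_map_count[OF pm, of d] that count_greater_zero_iff[of "map_darts Fs" d] by linarith
  then show ?thesis
    by (simp add: size_multiset_overloaded_eq)
qed

lemma size_map_darts:
  assumes "\<And>C. C \<in> set Fs \<Longrightarrow> C \<noteq> []"
  shows "size (map_darts Fs) = (\<Sum>C\<leftarrow>Fs. length C)"
  using assms by (induction Fs) (auto simp: length_cdarts)

lemma plane_drawing_subgraph:
  assumes "plane_drawing V E pos \<gamma>" "V' \<subseteq> V" "E' \<subseteq> E" "\<And>e. e \<in> E' \<Longrightarrow> e \<subseteq> V'"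
  shows "plane_drawing V' E' pos \<gamma>"
proof -
  have D: "arc (\<gamma> e)" "{pathstart (\<gamma> e), pathfinish (\<gamma> e)} = pos ` e" "path_image (\<gamma> e) \<inter> pos ` V = pos ` e"
    if "e \<in> E" for e
    using assms(1) that by (simp_all add: plane_drawing_def)
  have M: "path_image (\<gamma> e) \<inter> path_image (\<gamma> f) = pos ` (e \<inter> f)" if "e \<in> E" "f \<in> E" "e \<noteq> f" for e f
    using assms(1) that by (simp add: plane_drawing_def)
  have "inj_on pos V'"
    using assms(1,2) inj_on_subset by (auto simp: plane_drawing_def)
  moreover have "path_image (\<gamma> e) \<inter> pos ` V' = pos ` e" if "e \<in> E'" for e
    using D(3)[of e] that assms(2,3) assms(4)[OF that] by blast
  ultimately show ?thesis
    unfolding plane_drawing_def using D(1,2) M assms(3) by (simp add: subset_iff)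
qed

text \<open>Unlike \<open>bipartition\<close> this fixes one class only, so the same X serves for
  all subgraphs.\<close>

definition bip :: "'a set \<Rightarrow> 'a set set \<Rightarrow> bool" where
  "bip X E \<longleftrightarrow> (\<forall>x y. {x, y} \<in> E \<longrightarrow> (x \<in> X \<longleftrightarrow> y \<notin> X))"

lemma plane_bipartite_faces:
  assumes "plane_graph V E pos \<gamma>" "plane_graph.two_connected V E" "bip X E"
  obtains Fs where "plane_map Fs" "dart_set Fs = {(x, y). {x, y} \<in> E}" "map_verts Fs = V"
    "\<forall>C\<in>set Fs. even (length C) \<and> length C \<ge> 4"
    "length Fs + card V = card E + 2" "(\<Sum>C\<leftarrow>Fs. length C) = 2 * card E"
proof -
  interpret plane_graph V E pos \<gamma> by fact
  obtain Fs where Fs: "plane_map Fs" "dart_set Fs = darts" "map_verts Fs = V"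
    using two_connected_plane_map[OF assms(2)] .
  have face: "even (length C) \<and> length C \<ge> 4" if C: "C \<in> set Fs" for C
  proof -
    have C3: "length C \<ge> 3"
      using plane_map_faces[OF Fs(1) C] by simp
    have "set (cdarts C) \<subseteq> darts"
      using Fs(2) C unfolding dart_set_eq by auto
    then have "even (length C)"
      using assms(3) C3 by (intro bipartite_face_even[of C X]) (auto simp: bip_def darts_def)
    then show ?thesis
      using C3 by presburger
  qed
  have sz: "size (map_darts Fs) = 2 * card E"
    using plane_map_size[OF Fs(1)] Fs(2) card_darts by simp
  moreover have "size (map_darts Fs) = (\<Sum>C\<leftarrow>Fs. length C)"
    using face by (intro size_map_darts) fastforce
  ultimately show thesis
    using that[OF Fs(1) _ Fs(3)] face plane_map_euler[OF Fs(1)] Fs(2,3) by (simp add: darts_def)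
qed

lemma sum_list_ge: "(\<And>x. x \<in> set xs \<Longrightarrow> f x \<ge> (k::nat)) \<Longrightarrow> k * length xs \<le> (\<Sum>x\<leftarrow>xs. f x)"
  by (induction xs) (auto simp: add_mono)

lemma card_edges_two_vertices:
  assumes "simple_graph V E" "card V = 2"
  shows "card E \<le> 1"
proof -
  have "E \<subseteq> {V}"
  proof
    fix e assume "e \<in> E"
    then have "e \<subseteq> V" "card e = 2" "finite V"
      using assms by (auto simp: simple_graph_def)
    then show "e \<in> {V}"
      using assms(2) card_subset_eq[of V e] by simp
  qed
  then show ?thesis
    using card_mono[of "{V}" E] by simp
qed

lemma cut_subgraph:
  assumes "plane_graph V E pos \<gamma>" "V' \<subseteq> V"
  shows "plane_graph V' {e \<in> E. e \<subseteq> V'} pos \<gamma>"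
proof -
  interpret plane_graph V E pos \<gamma> by fact
  show ?thesis
  proof
    show "simple_graph V' {e \<in> E. e \<subseteq> V'}"
      using simple assms(2) by (auto simp: simple_graph_def intro: finite_subset)
    show "plane_drawing V' {e \<in> E. e \<subseteq> V'} pos \<gamma>"
      by (rule plane_drawing_subgraph[OF drawing assms(2)]) auto
  qed
qed

text \<open>In the two-connected case faces of length at least 4 give 4F <= 2m, and Euler's formula
  finishes. Otherwise the two pieces have n + 1 vertices together, and a piece on two vertices has
  at most one edge, one more than the bound would allow. Two such pieces mean n = 3 and m <= 2; in
  all other cases the sum is at most 2n - 5.\<close>

lemma plane_bipartite_edges:
  assumes "plane_graph V E pos \<gamma>" "bip X E" "card V \<ge> 3"
  shows "card E + 4 \<le> 2 * card V"
  using assms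
proof (induction "card V" arbitrary: V E rule: less_induct)
  case less
  interpret plane_graph V E pos \<gamma> by fact
  show ?case
  proof (cases two_connected)
    case True
    obtain Fs where "plane_map Fs" "dart_set Fs = {(x, y). {x, y} \<in> E}" "map_verts Fs = V"
      and Fs: "\<forall>C\<in>set Fs. even (length C) \<and> length C \<ge> 4"
      "length Fs + card V = card E + 2" "(\<Sum>C\<leftarrow>Fs. length C) = 2 * card E"
      using plane_bipartite_faces[OF less.prems(1) True less.prems(2)] .
    have "4 * length Fs \<le> 2 * card E"
      using sum_list_ge[of Fs 4 length] Fs(1,3) by simp
    then show ?thesis using Fs(2) by linarith
  next
    case False
    obtain V1 V2 v where d: "V1 \<union> V2 = V" "V1 \<inter> V2 = {v}" "card V1 \<ge> 2" "card V2 \<ge> 2"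
      "\<And>e. e \<in> E \<Longrightarrow> e \<subseteq> V1 \<or> e \<subseteq> V2"
      using cut_decomposition[OF False less.prems(3)] by blast
    have fin: "finite V1" "finite V2"
      using finite_V d(1) by auto
    have cV: "card V1 + card V2 = card V + 1"
      using card_Un_Int[OF fin] d(1,2) by simp
    let ?E = "\<lambda>W. {e \<in> E. e \<subseteq> W}"
    have bound: "card (?E W) + 4 \<le> 2 * card W \<or> card W = 2 \<and> card (?E W) \<le> 1"
      if W: "W = V1 \<or> W = V2" for W
    proof -
      have WV: "W \<subseteq> V" "card W \<ge> 2" "card W < card V"
        using W d cV by auto
      have pg: "plane_graph W (?E W) pos \<gamma>"
        by (rule cut_subgraph[OF less.prems(1) WV(1)])
      show ?thesis
      proof (cases "card W = 2")
        case True
        then show ?thesis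
          using card_edges_two_vertices pg plane_graph.simple by blast
      next
        case False
        then have "card (?E W) + 4 \<le> 2 * card W"
          using less.hyps[OF WV(3) pg] less.prems(2) WV(2) by (auto simp: bip_def)
        then show ?thesis ..
      qed
    qed
    have "E = ?E V1 \<union> ?E V2"
      using d(5) by auto
    then have "card E \<le> card (?E V1) + card (?E V2)"
      by (metis card_Un_le)
    then show ?thesis
      using bound[of V1] bound[of V2] cV d(3,4) less.prems(3) by auto
  qed
qed

section \<open>Maps with a single hexagonal face\<close>

text \<open>
  The edges of a bipartite map in which one colour class is cubic and the other one has degree d:
  a and b rotate an edge about its cubic end and about its other end, respectively, so that
  a after b moves an edge two steps forward along the boundary of a face. All faces are
  quadrilaterals except for one hexagon, three of whose edges form H.
\<close>

locale hexagon_map =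
  fixes E :: "('v \<times> 'v) set" and a b :: "'v \<times> 'v \<Rightarrow> 'v \<times> 'v" and d :: nat and H :: "('v \<times> 'v) set"
  assumes a_in: "e \<in> E \<Longrightarrow> a e \<in> E" and b_in: "e \<in> E \<Longrightarrow> b e \<in> E"
    and fst_a: "e \<in> E \<Longrightarrow> fst (a e) = fst e" and snd_b: "e \<in> E \<Longrightarrow> snd (b e) = snd e"
    and a_order: "e \<in> E \<Longrightarrow> a (a (a e)) = e" and a_ne: "e \<in> E \<Longrightarrow> a e \<noteq> e"
    and b_cycle: "e \<in> E \<Longrightarrow> (b ^^ d) e = e"
    and b_ne: "e \<in> E \<Longrightarrow> 0 < j \<Longrightarrow> j < d \<Longrightarrow> (b ^^ j) e \<noteq> e"
    and quad: "e \<in> E \<Longrightarrow> e \<notin> H \<Longrightarrow> a (b (a (b e))) = e"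
    and no_K33: "card S = 3 \<Longrightarrow> card T = 3 \<Longrightarrow> \<not> S \<times> T \<subseteq> E"
begin

definition hex :: "'v \<times> 'v \<Rightarrow> 'v \<times> 'v \<Rightarrow> 'v \<times> 'v \<Rightarrow> bool" where
  "hex h0 h1 h2 \<longleftrightarrow> H = {h0, h1, h2} \<and> H \<subseteq> E \<and> a (b h0) = h1 \<and> a (b h1) = h2 \<and> a (b h2) = h0"

text \<open>The situation is invariant under turning the hexagon: \<open>x1\<close> and
  \<open>x2\<close> transfer every fact about h0 to h1 and h2.\<close>

lemma
  assumes "hex h0 h1 h2"
  shows m0: "h0 \<in> E" and m1: "h1 \<in> E" and m2: "h2 \<in> E"
    and k0: "a (b h0) = h1" and k1: "a (b h1) = h2" and k2: "a (b h2) = h0"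
    and x1: "hex h1 h2 h0" and x2: "hex h2 h0 h1"
  using assms unfolding hex_def by auto

lemma nonhex:
  assumes "hex h0 h1 h2" "e \<in> E" "e \<noteq> h0" "e \<noteq> h1" "e \<noteq> h2"
  shows "a (b (a (b e))) = e"
  using assms quad by (auto simp: hex_def)

lemma b_pow_in: "e \<in> E \<Longrightarrow> (b ^^ j) e \<in> E \<and> snd ((b ^^ j) e) = snd e"
  by (induction j) (auto simp: b_in snd_b)

lemma a_pow_in: "e \<in> E \<Longrightarrow> (a ^^ i) e \<in> E \<and> fst ((a ^^ i) e) = fst e"
  by (induction i) (auto simp: a_in fst_a)

text \<open>A power of a keeps the first end of an edge and a power of b the second, so a common
  value would have both ends of e and be e itself; but a nontrivial power in this range moves e. The
  word computations below end in violations of this rule.\<close>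

lemma clash:
  assumes "e \<in> E" "i < 3" "j < d" "i \<noteq> 0 \<or> j \<noteq> 0"
  shows "(a ^^ i) e \<noteq> (b ^^ j) e"
proof
  assume eq: "(a ^^ i) e = (b ^^ j) e"
  then have b: "(b ^^ j) e = e"
    using a_pow_in[OF assms(1)] b_pow_in[OF assms(1)] by (metis prod_eqI)
  then have "j = 0"
    using b_ne assms by blast
  moreover have "(a ^^ i) e \<noteq> e" if "i \<noteq> 0"
  proof -
    have "i = 1 \<or> i = 2"
      using that assms(2) by auto
    then show ?thesis
    proof
      assume "i = 2"
      moreover have "a (a e) \<noteq> e"
        using a_order[OF assms(1)] a_ne[OF assms(1)] by metis
      ultimately show ?thesis by (simp add: numeral_2_eq_2)
    qed (use a_ne[OF assms(1)] in simp)
  qed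
  ultimately show False
    using eq b assms(4) by auto
qed

text \<open>The equations say that the other two edges at each cubic vertex of the hexagon lead to
  the remaining two vertices of the second class on the hexagon. Together with the hexagon edges
  this is K_{3,3}.\<close>

lemma hex_no_K33:
  assumes x0: "hex h0 h1 h2"
    and "snd (a h0) = snd h1" "snd (a (a h0)) = snd h2" "snd (a h1) = snd h2"
    "snd (a (a h1)) = snd h0" "snd (a h2) = snd h0" "snd (a (a h2)) = snd h1"
    and d: "1 < d"
  shows False
proof -
  \<comment> \<open>Between consecutive edges of H, b changes the first end and a the second,
    because there are no parallel edges.\<close>
  have dist: "fst u \<noteq> fst v \<and> snd u \<noteq> snd v" if "hex u v w" for u v w
  proof -
    note m0 = m0[OF that] and m1 = m1[OF that] and m2 = m2[OF that] and k0 = k0[OF that] and k1 = k1[OF that] and k2 = k2[OF that]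
    and x1 = x1[OF that] and x2 = x2[OF that]
    have "b u \<noteq> u"
      using b_ne[OF m0, of 1] d by simp
    moreover have "a (b u) \<noteq> b u"
      using a_ne[OF b_in[OF m0]] .
    ultimately show ?thesis
      using fst_a[OF b_in[OF m0]] snd_b[OF m0] k0 by (metis prod_eqI)
  qed
  note m0 = m0[OF x0] and m1 = m1[OF x0] and m2 = m2[OF x0] and x1 = x1[OF x0] and x2 = x2[OF x0]
  have c: "card {fst h0, fst h1, fst h2} = 3" "card {snd h0, snd h1, snd h2} = 3"
    using dist[OF x0] dist[OF x1] dist[OF x2] by auto
  have e: "(fst h, snd h) \<in> E" "(fst h, snd (a h)) \<in> E" "(fst h, snd (a (a h))) \<in> E" if "h \<in> E" for h
    using that a_in[OF that] a_in[OF a_in[OF that]] fst_a[OF that] fst_a[OF a_in[OF that]]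
    by (metis prod.collapse)+
  have "{fst h0, fst h1, fst h2} \<times> {snd h0, snd h1, snd h2} \<subseteq> E"
    using e[OF m0] e[OF m1] e[OF m2] assms(2-7) by auto
  then show False
    using no_K33 c by blast
qed

end

section \<open>No hexagon for degrees 3 and 3\<close>

text \<open>
  The lemmas quad_w below show that the face following the edge w(h0) is a quadrilateral, where w is a
  word in a and b that is read from left to right. They explore the map outwards from the hexagon;
  the words and the instances of the axioms were found by a search in the style of coset enumeration.
\<close>

locale hexagon_map3 = hexagon_map +
  assumes d: "d = 3"
begin

lemma b_order: "e \<in> E \<Longrightarrow> b (b (b e)) = e"
  using b_cycle[of e] by (simp add: d numeral_eq_Suc)

text \<open>The names of this and the following lemmas record the exponents in \<open>clash\<close>;
  the powers are written out so that they match the words in the instances below.\<close>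

lemma a0_ne_b1: "e \<in> E \<Longrightarrow> e \<noteq> b e"
  using clash[of e 0 1] by (simp add: d numeral_eq_Suc)

lemma a1_ne_b0: "e \<in> E \<Longrightarrow> a e \<noteq> e"
  using clash[of e 1 0] by (simp add: d numeral_eq_Suc)

lemma a1_ne_b1: "e \<in> E \<Longrightarrow> a e \<noteq> b e"
  using clash[of e 1 1] by (simp add: d numeral_eq_Suc)

lemma a2_ne_b1: "e \<in> E \<Longrightarrow> a (a e) \<noteq> b e"
  using clash[of e 2 1] by (simp add: d numeral_eq_Suc)

lemma a2_ne_b2: "e \<in> E \<Longrightarrow> a (a e) \<noteq> b (b e)"
  using clash[of e 2 2] by (simp add: d numeral_eq_Suc)

lemma quad_b:
  assumes x0: "hex h0 h1 h2"
  shows "a (b (a (b (b h0)))) = b h0"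
proof (rule nonhex[OF x0])
  note m0 = m0[OF x0] and k0 = k0[OF x0] and k2 = k2[OF x0]
  show "b h0 \<in> E"
    by (rule b_in[OF m0])
  \<comment> \<open>Each of the three possible coincidences with a hexagon edge is carried along
    known faces until two edges agree that \<open>clash\<close> keeps apart.\<close>
  show "b h0 \<noteq> h0"
  proof
    assume e: "b h0 = h0"
    show False
      using e a0_ne_b1[OF b_in[OF m0]] by argo
  qed
  show "b h0 \<noteq> h1"
  proof
    assume e: "b h0 = h1"
    show False
      using e k0 a1_ne_b0[OF b_in[OF m0]] by argo
  qed
  show "b h0 \<noteq> h2"
  proof
    assume e: "b h0 = h2"
    show False
      using e k2 b_order[OF m0] a1_ne_b1[OF b_in[OF b_in[OF m0]]] by argo
  qed
qed

lemma quad_a: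
  assumes x0: "hex h0 h1 h2"
  shows "a (b (a (b (a h0)))) = a h0"
proof (rule nonhex[OF x0])
  note m0 = m0[OF x0] and k0 = k0[OF x0] and k2 = k2[OF x0]
  show "a h0 \<in> E"
    by (rule a_in[OF m0])
  show "a h0 \<noteq> h0"
  proof
    assume e: "a h0 = h0"
    show False
      using e a1_ne_b0[OF a_in[OF m0]] by argo
  qed
  show "a h0 \<noteq> h1"
  proof
    assume e: "a h0 = h1"
    show False
      using e k0 a_order[OF m0] a_order[OF b_in[OF m0]] a0_ne_b1[OF a_in[OF a_in[OF a_in[OF m0]]]] by argo
  qed
  show "a h0 \<noteq> h2"
  proof
    assume e: "a h0 = h2"
    show False
      using e k2 b_order[OF a_in[OF m0]] a2_ne_b2[OF b_in[OF a_in[OF m0]]] by argo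
  qed
qed

lemma quad_ab:
  assumes x0: "hex h0 h1 h2"
  shows "a (b (a (b (b (a h0))))) = b (a h0)"
proof (rule nonhex[OF x0])
  note m0 = m0[OF x0] and k1 = k1[OF x0] and k2 = k2[OF x0] and x1 = x1[OF x0]
  show "b (a h0) \<in> E"
    by (rule b_in[OF a_in[OF m0]])
  show "b (a h0) \<noteq> h0"
  proof
    assume e: "b (a h0) = h0"
    show False
      using e a_order[OF m0] a2_ne_b1[OF a_in[OF m0]] by argo
  qed
  show "b (a h0) \<noteq> h1"
  proof
    assume e: "b (a h0) = h1"
    show False
      using e k1 quad_b[OF x1] k2 b_order[OF a_in[OF m0]] b_order[OF a_in[OF b_in[OF b_in[OF a_in[OF m0]]]]]
         a_order[OF b_in[OF a_in[OF b_in[OF b_in[OF a_in[OF m0]]]]]] a2_ne_b1[OF b_in[OF b_in[OF a_in[OF b_in[OF b_in[OF a_in[OF m0]]]]]]] by argo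
  qed
  show "b (a h0) \<noteq> h2"
  proof
    assume e: "b (a h0) = h2"
    show False
      using e k2 b_order[OF a_in[OF m0]] a2_ne_b1[OF b_in[OF b_in[OF a_in[OF m0]]]] by argo
  qed
qed

text \<open>The quadrilaterals around h0 and h1 force \<open>a (a e) = b e\<close> for the edge e =
  \<open>a (b h1)\<close>, which is h2, against \<open>a2_ne_b1\<close>.\<close>

lemma no_hexagon_33: "\<not> hex h0 h1 h2"
proof
  assume x0: "hex h0 h1 h2"
  note m0 = m0[OF x0] and m1 = m1[OF x0] and k0 = k0[OF x0] and k1 = k1[OF x0] and k2 = k2[OF x0] and x1 = x1[OF x0]
  show False
    using k0 quad_b[OF x0] quad_a[OF x0] quad_ab[OF x0] k1 quad_b[OF x1] quad_a[OF x1] quad_ab[OF x1] k2 a_order[OF m0]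
       b_order[OF a_in[OF m0]] b_order[OF a_in[OF b_in[OF b_in[OF m0]]]] a_order[OF b_in[OF b_in[OF a_in[OF m0]]]]
       b_order[OF a_in[OF b_in[OF a_in[OF m0]]]] a_order[OF b_in[OF a_in[OF b_in[OF a_in[OF m0]]]]]
       a_order[OF b_in[OF a_in[OF b_in[OF b_in[OF m0]]]]] a_order[OF b_in[OF a_in[OF b_in[OF b_in[OF a_in[OF m0]]]]]]
       b_order[OF a_in[OF b_in[OF a_in[OF m1]]]] a_order[OF b_in[OF a_in[OF b_in[OF a_in[OF m1]]]]] a2_ne_b1[OF a_in[OF b_in[OF m1]]] by argo
qed

end

section \<open>No hexagon for degrees 3 and 5\<close>

locale hexagon_map5 = hexagon_map +
  assumes d: "d = 5"
begin

lemma b_order: "e \<in> E \<Longrightarrow> b (b (b (b (b e)))) = e"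
  using b_cycle[of e] by (simp add: d numeral_eq_Suc)

lemma a0_ne_b1: "e \<in> E \<Longrightarrow> e \<noteq> b e"
  using clash[of e 0 1] by (simp add: d numeral_eq_Suc)

lemma a0_ne_b2: "e \<in> E \<Longrightarrow> e \<noteq> b (b e)"
  using clash[of e 0 2] by (simp add: d numeral_eq_Suc)

lemma a0_ne_b3: "e \<in> E \<Longrightarrow> e \<noteq> b (b (b e))"
  using clash[of e 0 3] by (simp add: d numeral_eq_Suc)

lemma a1_ne_b0: "e \<in> E \<Longrightarrow> a e \<noteq> e"
  using clash[of e 1 0] by (simp add: d numeral_eq_Suc)

lemma a1_ne_b1: "e \<in> E \<Longrightarrow> a e \<noteq> b e"
  using clash[of e 1 1] by (simp add: d numeral_eq_Suc)

lemma a1_ne_b2: "e \<in> E \<Longrightarrow> a e \<noteq> b (b e)"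
  using clash[of e 1 2] by (simp add: d numeral_eq_Suc)

lemma a1_ne_b3: "e \<in> E \<Longrightarrow> a e \<noteq> b (b (b e))"
  using clash[of e 1 3] by (simp add: d numeral_eq_Suc)

lemma a1_ne_b4: "e \<in> E \<Longrightarrow> a e \<noteq> b (b (b (b e)))"
  using clash[of e 1 4] by (simp add: d numeral_eq_Suc)

lemma a2_ne_b1: "e \<in> E \<Longrightarrow> a (a e) \<noteq> b e"
  using clash[of e 2 1] by (simp add: d numeral_eq_Suc)

lemma a2_ne_b2: "e \<in> E \<Longrightarrow> a (a e) \<noteq> b (b e)"
  using clash[of e 2 2] by (simp add: d numeral_eq_Suc)

lemma a2_ne_b3: "e \<in> E \<Longrightarrow> a (a e) \<noteq> b (b (b e))"
  using clash[of e 2 3] by (simp add: d numeral_eq_Suc)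

lemma a2_ne_b4: "e \<in> E \<Longrightarrow> a (a e) \<noteq> b (b (b (b e)))"
  using clash[of e 2 4] by (simp add: d numeral_eq_Suc)

lemma quad_b:
  assumes x0: "hex h0 h1 h2"
  shows "a (b (a (b (b h0)))) = b h0"
proof (rule nonhex[OF x0])
  note m0 = m0[OF x0] and k0 = k0[OF x0] and k2 = k2[OF x0]
  show "b h0 \<in> E"
    by (rule b_in[OF m0])
  show "b h0 \<noteq> h0"
  proof
    assume e: "b h0 = h0"
    show False
      using e a0_ne_b1[OF b_in[OF m0]] by argo
  qed
  show "b h0 \<noteq> h1"
  proof
    assume e: "b h0 = h1"
    show False
      using e k0 a1_ne_b0[OF b_in[OF m0]] by argo
  qed
  show "b h0 \<noteq> h2"
  proof
    assume e: "b h0 = h2"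
    show False
      using e k2 b_order[OF m0] a1_ne_b3[OF b_in[OF b_in[OF m0]]] by argo
  qed
qed

lemma quad_a:
  assumes x0: "hex h0 h1 h2"
  shows "a (b (a (b (a h0)))) = a h0"
proof (rule nonhex[OF x0])
  note m0 = m0[OF x0] and k0 = k0[OF x0] and k2 = k2[OF x0]
  show "a h0 \<in> E"
    by (rule a_in[OF m0])
  show "a h0 \<noteq> h0"
  proof
    assume e: "a h0 = h0"
    show False
      using e a1_ne_b0[OF a_in[OF m0]] by argo
  qed
  show "a h0 \<noteq> h1"
  proof
    assume e: "a h0 = h1"
    show False
      using e k0 a_order[OF m0] a_order[OF b_in[OF m0]] a0_ne_b1[OF a_in[OF a_in[OF a_in[OF m0]]]] by argo
  qed
  show "a h0 \<noteq> h2"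
  proof
    assume e: "a h0 = h2"
    show False
      using e k2 b_order[OF a_in[OF m0]] a2_ne_b4[OF b_in[OF a_in[OF m0]]] by argo
  qed
qed

lemma quad_bb:
  assumes x0: "hex h0 h1 h2"
  shows "a (b (a (b (b (b h0))))) = b (b h0)"
proof (rule nonhex[OF x0])
  note m0 = m0[OF x0] and k0 = k0[OF x0] and k2 = k2[OF x0]
  show "b (b h0) \<in> E"
    by (rule b_in[OF b_in[OF m0]])
  show "b (b h0) \<noteq> h0"
  proof
    assume e: "b (b h0) = h0"
    show False
      using e a0_ne_b2[OF b_in[OF b_in[OF m0]]] by argo
  qed
  show "b (b h0) \<noteq> h1"
  proof
    assume e: "b (b h0) = h1"
    show False
      using e k0 a1_ne_b1[OF b_in[OF m0]] by argo
  qed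
  show "b (b h0) \<noteq> h2"
  proof
    assume e: "b (b h0) = h2"
    show False
      using e k2 b_order[OF m0] a1_ne_b2[OF b_in[OF b_in[OF b_in[OF m0]]]] by argo
  qed
qed

lemma quad_abbb:
  assumes x0: "hex h0 h1 h2"
  shows "a (b (a (b (b (b (b (a h0))))))) = b (b (b (a h0)))"
proof (rule nonhex[OF x0])
  note m0 = m0[OF x0] and k1 = k1[OF x0] and k2 = k2[OF x0] and x1 = x1[OF x0]
  show "b (b (b (a h0))) \<in> E"
    by (rule b_in[OF b_in[OF b_in[OF a_in[OF m0]]]])
  show "b (b (b (a h0))) \<noteq> h0"
  proof
    assume e: "b (b (b (a h0))) = h0"
    show False
      using e a_order[OF m0] a2_ne_b3[OF a_in[OF m0]] by argo
  qed
  show "b (b (b (a h0))) \<noteq> h1"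
  proof
    assume e: "b (b (b (a h0))) = h1"
    show False
      using e k1 quad_b[OF x1] k2 b_order[OF a_in[OF m0]] b_order[OF a_in[OF b_in[OF b_in[OF b_in[OF b_in[OF a_in[OF m0]]]]]]]
         a_order[OF b_in[OF a_in[OF b_in[OF b_in[OF b_in[OF b_in[OF a_in[OF m0]]]]]]]]
         a2_ne_b3[OF b_in[OF b_in[OF a_in[OF b_in[OF b_in[OF b_in[OF b_in[OF a_in[OF m0]]]]]]]]] by argo
  qed
  show "b (b (b (a h0))) \<noteq> h2"
  proof
    assume e: "b (b (b (a h0))) = h2"
    show False
      using e k2 b_order[OF a_in[OF m0]] a2_ne_b1[OF b_in[OF b_in[OF b_in[OF b_in[OF a_in[OF m0]]]]]] by argo
  qed
qed

lemma quad_bbb: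
  assumes x0: "hex h0 h1 h2"
  shows "a (b (a (b (b (b (b h0)))))) = b (b (b h0))"
proof (rule nonhex[OF x0])
  note m0 = m0[OF x0] and k0 = k0[OF x0] and k2 = k2[OF x0]
  show "b (b (b h0)) \<in> E"
    by (rule b_in[OF b_in[OF b_in[OF m0]]])
  show "b (b (b h0)) \<noteq> h0"
  proof
    assume e: "b (b (b h0)) = h0"
    show False
      using e a0_ne_b3[OF b_in[OF b_in[OF b_in[OF m0]]]] by argo
  qed
  show "b (b (b h0)) \<noteq> h1"
  proof
    assume e: "b (b (b h0)) = h1"
    show False
      using e k0 a1_ne_b2[OF b_in[OF m0]] by argo
  qed
  show "b (b (b h0)) \<noteq> h2"
  proof
    assume e: "b (b (b h0)) = h2"
    show False
      using e k2 b_order[OF m0] a1_ne_b1[OF b_in[OF b_in[OF b_in[OF b_in[OF m0]]]]] by argo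
  qed
qed

lemma quad_ab:
  assumes x0: "hex h0 h1 h2"
  shows "a (b (a (b (b (a h0))))) = b (a h0)"
proof (rule nonhex[OF x0])
  note m0 = m0[OF x0] and k0 = k0[OF x0] and k2 = k2[OF x0]
  show "b (a h0) \<in> E"
    by (rule b_in[OF a_in[OF m0]])
  show "b (a h0) \<noteq> h0"
  proof
    assume e: "b (a h0) = h0"
    show False
      using e a_order[OF m0] a2_ne_b1[OF a_in[OF m0]] by argo
  qed
  show "b (a h0) \<noteq> h1"
  proof
    assume e: "b (a h0) = h1"
    show False
      using e k0 quad_a[OF x0] a_order[OF m0] a_order[OF b_in[OF m0]] a_order[OF b_in[OF a_in[OF b_in[OF a_in[OF m0]]]]]
         a1_ne_b2[OF a_in[OF b_in[OF a_in[OF m0]]]] by argo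
  qed
  show "b (a h0) \<noteq> h2"
  proof
    assume e: "b (a h0) = h2"
    show False
      using e k2 b_order[OF a_in[OF m0]] a2_ne_b3[OF b_in[OF b_in[OF a_in[OF m0]]]] by argo
  qed
qed

lemma quad_bbbaa:
  assumes x0: "hex h0 h1 h2"
  shows "a (b (a (b (a (a (b (b (b h0)))))))) = a (a (b (b (b h0))))"
proof (rule nonhex[OF x0])
  note m0 = m0[OF x0] and m1 = m1[OF x0] and m2 = m2[OF x0] and k0 = k0[OF x0] and k1 = k1[OF x0] and k2 = k2[OF x0] and x1 = x1[OF x0] and x2 = x2[OF x0]
  show "a (a (b (b (b h0)))) \<in> E"
    by (rule a_in[OF a_in[OF b_in[OF b_in[OF b_in[OF m0]]]]])
  show "a (a (b (b (b h0)))) \<noteq> h0"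
  proof
    assume e: "a (a (b (b (b h0)))) = h0"
    show False
      using e b_order[OF m0] a2_ne_b2[OF b_in[OF b_in[OF b_in[OF m0]]]] by argo
  qed
  show "a (a (b (b (b h0)))) \<noteq> h1"
  proof
    assume e: "a (a (b (b (b h0)))) = h1"
    show False
      using e k0 a_order[OF b_in[OF b_in[OF b_in[OF m0]]]] a2_ne_b2[OF b_in[OF m0]] by argo
  qed
  show "a (a (b (b (b h0)))) \<noteq> h2"
  proof
    assume e: "a (a (b (b (b h0)))) = h2"
    \<comment> \<open>The face at \<open>b (b (a h1))\<close> is the one of \<open>quad_abb\<close>,
      whose proof relies on the present lemma; under the assumption \<open>e\<close> it can be
      established here already.\<close>
    have n0: "b (b (a h1)) \<noteq> h0"
    proof
      assume e2: "b (b (a h1)) = h0"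
      show False
        using e e2 k1 a_order[OF a_in[OF m1]] b_order[OF a_in[OF m1]] a_order[OF b_in[OF m1]] a2_ne_b1[OF m1] by argo
    qed
    have n1: "b (b (a h1)) \<noteq> h1"
    proof
      assume e2: "b (b (a h1)) = h1"
      show False
        using e e2 quad_ab[OF x1] a1_ne_b0[OF b_in[OF a_in[OF b_in[OF b_in[OF a_in[OF m1]]]]]] by argo
    qed
    \<comment> \<open>Under \<open>e\<close> and \<open>e2\<close> every further edge at a cubic
      vertex of the hexagon turns out to be a power of b applied to a hexagon edge, as
      \<open>g0\<close> to \<open>g5\<close> record. This gives K_{3,3}, and it is the place where
      \<open>no_K33\<close> enters.\<close>
    have n2: "b (b (a h1)) \<noteq> h2"
    proof
      assume e2: "b (b (a h1)) = h2"
      have g0: "a h0 = b (b (b h1))"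
        using e e2 quad_ab[OF x1] quad_bbb[OF x2] quad_ab[OF x2] b_order[OF m0] b_order[OF a_in[OF m0]] a_order[OF b_in[OF a_in[OF m0]]]
           a_order[OF b_in[OF b_in[OF b_in[OF m0]]]] a_order[OF b_in[OF b_in[OF a_in[OF m0]]]] a_order[OF m1] b_order[OF a_in[OF m1]] by argo
      have g1: "a (a h0) = b h2"
        using e e2 k2 a_order[OF b_in[OF a_in[OF a_in[OF b_in[OF b_in[OF b_in[OF m0]]]]]]] by argo
      have g2: "a (a h1) = b h0"
        using e e2 k0 a_order[OF b_in[OF m0]] by argo
      have g3: "a h1 = b (b (b h2))"
        using e e2 quad_a[OF x1] quad_ab[OF x1] quad_bbb[OF x2] a_order[OF b_in[OF b_in[OF b_in[OF m0]]]]
           b_order[OF a_in[OF b_in[OF b_in[OF b_in[OF b_in[OF m0]]]]]] by argo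
      have g4: "a h2 = b (b (b h0))"
        using e e2 a_order[OF b_in[OF b_in[OF b_in[OF m0]]]] by argo
      have g5: "a (a h2) = b h1"
        using e e2 k1 a_order[OF b_in[OF m1]] by argo
      have "snd (a h0) = snd h1" "snd (a (a h0)) = snd h2" "snd (a h1) = snd h2"
        by (subst g0 g1 g3; simp add: snd_b b_in m0 m1 m2)+
      moreover have "snd (a (a h1)) = snd h0" "snd (a h2) = snd h0" "snd (a (a h2)) = snd h1"
        by (subst g2 g4 g5; simp add: snd_b b_in m0 m1 m2)+
      ultimately show False
        using hex_no_K33[OF x0] d by simp
    qed
    have q: "a (b (a (b (b (b (a h1)))))) = b (b (a h1))"
      by (rule nonhex[OF x0 b_in[OF b_in[OF a_in[OF m1]]] n0 n1 n2])
    show False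
      using e k0 quad_b[OF x0] quad_bb[OF x0] k1 quad_a[OF x1] quad_abbb[OF x1] quad_bbb[OF x1] quad_ab[OF x1]
         b_order[OF a_in[OF b_in[OF b_in[OF m0]]]] a_order[OF b_in[OF b_in[OF b_in[OF m0]]]] a_order[OF b_in[OF m1]] a_order[OF b_in[OF b_in[OF m1]]]
         b_order[OF a_in[OF b_in[OF a_in[OF m1]]]] b_order[OF a_in[OF b_in[OF b_in[OF m1]]]] a_order[OF b_in[OF a_in[OF b_in[OF a_in[OF m1]]]]]
         a_order[OF b_in[OF a_in[OF b_in[OF b_in[OF a_in[OF m1]]]]]] a_order[OF b_in[OF a_in[OF b_in[OF b_in[OF b_in[OF b_in[OF m1]]]]]]]
         a_order[OF b_in[OF a_in[OF a_in[OF b_in[OF b_in[OF b_in[OF m1]]]]]]]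
         a_order[OF b_in[OF a_in[OF b_in[OF b_in[OF b_in[OF b_in[OF a_in[OF m2]]]]]]]] q a1_ne_b3[OF a_in[OF b_in[OF b_in[OF a_in[OF m1]]]]] by argo
  qed
qed

text \<open>The coincidence with h1 is settled by \<open>quad_bbbaa\<close>, turned by one hexagon
  edge, which is why that longer word comes first.\<close>

lemma quad_abb:
  assumes x0: "hex h0 h1 h2"
  shows "a (b (a (b (b (b (a h0)))))) = b (b (a h0))"
proof (rule nonhex[OF x0])
  note m0 = m0[OF x0] and k0 = k0[OF x0] and k2 = k2[OF x0] and x1 = x1[OF x0]
  show "b (b (a h0)) \<in> E"
    by (rule b_in[OF b_in[OF a_in[OF m0]]])
  show "b (b (a h0)) \<noteq> h0"
  proof
    assume e: "b (b (a h0)) = h0"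
    show False
      using e quad_ab[OF x0] a1_ne_b0[OF b_in[OF a_in[OF b_in[OF b_in[OF a_in[OF m0]]]]]] by argo
  qed
  show "b (b (a h0)) \<noteq> h1"
  proof
    assume e: "b (b (a h0)) = h1"
    show False
      using e k0 quad_bbbaa[OF x1] a_order[OF m0] b_order[OF a_in[OF m0]] a2_ne_b2[OF b_in[OF b_in[OF b_in[OF a_in[OF m0]]]]] by argo
  qed
  show "b (b (a h0)) \<noteq> h2"
  proof
    assume e: "b (b (a h0)) = h2"
    show False
      using e k2 b_order[OF a_in[OF m0]] a2_ne_b2[OF b_in[OF b_in[OF b_in[OF a_in[OF m0]]]]] by argo
  qed
qed

lemma quad_bbaab:
  assumes x0: "hex h0 h1 h2"
  shows "a (b (a (b (b (a (a (b (b h0)))))))) = b (a (a (b (b h0))))"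
proof (rule nonhex[OF x0])
  note m0 = m0[OF x0] and m1 = m1[OF x0] and k0 = k0[OF x0] and k1 = k1[OF x0] and x1 = x1[OF x0]
  show "b (a (a (b (b h0)))) \<in> E"
    by (rule b_in[OF a_in[OF a_in[OF b_in[OF b_in[OF m0]]]]])
  show "b (a (a (b (b h0)))) \<noteq> h0"
  proof
    assume e: "b (a (a (b (b h0)))) = h0"
    show False
      using e a_order[OF b_in[OF b_in[OF m0]]] a1_ne_b3[OF a_in[OF a_in[OF b_in[OF b_in[OF m0]]]]] by argo
  qed
  show "b (a (a (b (b h0)))) \<noteq> h1"
  proof
    assume e: "b (a (a (b (b h0)))) = h1"
    show False
      using e k0 quad_b[OF x0] quad_abbb[OF x1] b_order[OF a_in[OF b_in[OF b_in[OF m0]]]] a_order[OF b_in[OF a_in[OF b_in[OF b_in[OF m0]]]]]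
         a1_ne_b1[OF a_in[OF b_in[OF b_in[OF b_in[OF b_in[OF a_in[OF m1]]]]]]] by argo
  qed
  show "b (a (a (b (b h0)))) \<noteq> h2"
  proof
    assume e: "b (a (a (b (b h0)))) = h2"
    show False
      using e k0 quad_b[OF x0] k1 quad_b[OF x1] quad_a[OF x1] quad_bb[OF x1] quad_abbb[OF x1] quad_bbb[OF x1] quad_ab[OF x1]
         quad_abb[OF x1] b_order[OF a_in[OF b_in[OF b_in[OF m0]]]] a_order[OF b_in[OF a_in[OF b_in[OF b_in[OF m0]]]]]
         b_order[OF a_in[OF b_in[OF a_in[OF m1]]]] a_order[OF b_in[OF a_in[OF b_in[OF a_in[OF m1]]]]]
         a_order[OF b_in[OF a_in[OF b_in[OF b_in[OF m1]]]]] b_order[OF a_in[OF b_in[OF b_in[OF b_in[OF m1]]]]]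
         a_order[OF b_in[OF a_in[OF b_in[OF b_in[OF b_in[OF m1]]]]]] a_order[OF b_in[OF a_in[OF a_in[OF b_in[OF b_in[OF m1]]]]]]
         a2_ne_b2[OF b_in[OF a_in[OF b_in[OF b_in[OF b_in[OF b_in[OF m1]]]]]]] by argo
  qed
qed

lemma quad_abbaa:
  assumes x0: "hex h0 h1 h2"
  shows "a (b (a (b (a (a (b (b (a h0)))))))) = a (a (b (b (a h0))))"
proof (rule nonhex[OF x0])
  note m0 = m0[OF x0] and m1 = m1[OF x0] and k0 = k0[OF x0] and k1 = k1[OF x0] and x1 = x1[OF x0]
  show "a (a (b (b (a h0)))) \<in> E"
    by (rule a_in[OF a_in[OF b_in[OF b_in[OF a_in[OF m0]]]]])
  show "a (a (b (b (a h0)))) \<noteq> h0"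
  proof
    assume e: "a (a (b (b (a h0)))) = h0"
    show False
      using e a_order[OF b_in[OF b_in[OF a_in[OF m0]]]] a0_ne_b2[OF a_in[OF a_in[OF a_in[OF b_in[OF b_in[OF a_in[OF m0]]]]]]] by argo
  qed
  show "a (a (b (b (a h0)))) \<noteq> h1"
  proof
    assume e: "a (a (b (b (a h0)))) = h1"
    show False
      using e k0 quad_a[OF x0] quad_ab[OF x0] a_order[OF m0] a_order[OF b_in[OF m0]] a_order[OF b_in[OF b_in[OF m0]]]
         a_order[OF b_in[OF b_in[OF a_in[OF m0]]]] a_order[OF b_in[OF a_in[OF b_in[OF a_in[OF m0]]]]] a1_ne_b3[OF a_in[OF b_in[OF a_in[OF m0]]]] by argo
  qed
  show "a (a (b (b (a h0)))) \<noteq> h2"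
  proof
    assume e: "a (a (b (b (a h0)))) = h2"
    show False
      using e k0 quad_a[OF x0] quad_ab[OF x0] k1 quad_bbaab[OF x1] a_order[OF m0] a_order[OF b_in[OF b_in[OF a_in[OF m0]]]]
         a_order[OF b_in[OF a_in[OF b_in[OF a_in[OF m0]]]]] a_order[OF b_in[OF m1]]
         a0_ne_b2[OF a_in[OF b_in[OF a_in[OF b_in[OF b_in[OF a_in[OF m0]]]]]]] by argo
  qed
qed

lemma quad_bbbaab:
  assumes x0: "hex h0 h1 h2"
  shows "a (b (a (b (b (a (a (b (b (b h0))))))))) = b (a (a (b (b (b h0)))))"
proof (rule nonhex[OF x0])
  note m0 = m0[OF x0] and k0 = k0[OF x0] and k2 = k2[OF x0] and x2 = x2[OF x0]
  show "b (a (a (b (b (b h0))))) \<in> E"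
    by (rule b_in[OF a_in[OF a_in[OF b_in[OF b_in[OF b_in[OF m0]]]]]])
  show "b (a (a (b (b (b h0))))) \<noteq> h0"
  proof
    assume e: "b (a (a (b (b (b h0))))) = h0"
    show False
      using e a_order[OF b_in[OF b_in[OF b_in[OF m0]]]] a1_ne_b4[OF a_in[OF a_in[OF b_in[OF b_in[OF b_in[OF m0]]]]]] by argo
  qed
  show "b (a (a (b (b (b h0))))) \<noteq> h1"
  proof
    assume e: "b (a (a (b (b (b h0))))) = h1"
    show False
      using e k0 quad_b[OF x0] quad_bb[OF x0] quad_bbbaa[OF x0] b_order[OF a_in[OF b_in[OF b_in[OF m0]]]]
         a_order[OF b_in[OF b_in[OF b_in[OF m0]]]] a_order[OF b_in[OF a_in[OF b_in[OF b_in[OF m0]]]]]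
         a_order[OF b_in[OF a_in[OF b_in[OF a_in[OF a_in[OF b_in[OF b_in[OF b_in[OF m0]]]]]]]]]
         a2_ne_b2[OF b_in[OF a_in[OF b_in[OF b_in[OF b_in[OF m0]]]]]] by argo
  qed
  show "b (a (a (b (b (b h0))))) \<noteq> h2"
  proof
    assume e: "b (a (a (b (b (b h0))))) = h2"
    show False
      using e quad_bbb[OF x0] quad_ab[OF x0] k2 quad_b[OF x2] quad_bb[OF x2] quad_bbb[OF x2] quad_bbbaa[OF x2] b_order[OF m0]
         a_order[OF b_in[OF b_in[OF a_in[OF m0]]]] a_order[OF b_in[OF b_in[OF b_in[OF b_in[OF m0]]]]]
         a_order[OF a_in[OF b_in[OF a_in[OF b_in[OF b_in[OF a_in[OF m0]]]]]]]
         a_order[OF b_in[OF a_in[OF b_in[OF b_in[OF b_in[OF b_in[OF m0]]]]]]]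
         b_order[OF b_in[OF a_in[OF b_in[OF b_in[OF b_in[OF b_in[OF m0]]]]]]]
         a_order[OF b_in[OF a_in[OF a_in[OF b_in[OF b_in[OF a_in[OF m0]]]]]]] a1_ne_b3[OF a_in[OF a_in[OF b_in[OF b_in[OF a_in[OF m0]]]]]] by argo
  qed
qed

lemma quad_bbaabb:
  assumes x0: "hex h0 h1 h2"
  shows "a (b (a (b (b (b (a (a (b (b h0))))))))) = b (b (a (a (b (b h0)))))"
proof (rule nonhex[OF x0])
  note m0 = m0[OF x0] and k0 = k0[OF x0] and k2 = k2[OF x0] and x1 = x1[OF x0] and x2 = x2[OF x0]
  show "b (b (a (a (b (b h0))))) \<in> E"
    by (rule b_in[OF b_in[OF a_in[OF a_in[OF b_in[OF b_in[OF m0]]]]]])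
  show "b (b (a (a (b (b h0))))) \<noteq> h0"
  proof
    assume e: "b (b (a (a (b (b h0))))) = h0"
    show False
      using e a_order[OF b_in[OF b_in[OF m0]]] a1_ne_b4[OF a_in[OF a_in[OF b_in[OF b_in[OF m0]]]]] by argo
  qed
  show "b (b (a (a (b (b h0))))) \<noteq> h1"
  proof
    assume e: "b (b (a (a (b (b h0))))) = h1"
    show False
      using e k0 quad_b[OF x0] quad_bbaab[OF x0] quad_abbb[OF x1] b_order[OF a_in[OF b_in[OF b_in[OF m0]]]]
         a_order[OF b_in[OF a_in[OF b_in[OF b_in[OF m0]]]]]
         a2_ne_b2[OF b_in[OF a_in[OF b_in[OF b_in[OF a_in[OF a_in[OF b_in[OF b_in[OF m0]]]]]]]]] by argo
  qed
  show "b (b (a (a (b (b h0))))) \<noteq> h2"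
  proof
    assume e: "b (b (a (a (b (b h0))))) = h2"
    show False
      using e quad_bb[OF x0] quad_bbb[OF x0] k2 quad_b[OF x2] quad_bbaab[OF x2] b_order[OF m0]
         b_order[OF a_in[OF b_in[OF b_in[OF b_in[OF m0]]]]] b_order[OF a_in[OF b_in[OF b_in[OF b_in[OF b_in[OF m0]]]]]]
         a_order[OF b_in[OF a_in[OF b_in[OF b_in[OF b_in[OF m0]]]]]] a_order[OF b_in[OF a_in[OF b_in[OF b_in[OF b_in[OF b_in[OF m0]]]]]]]
         a_order[OF b_in[OF a_in[OF a_in[OF b_in[OF b_in[OF b_in[OF m0]]]]]]]
         a2_ne_b2[OF b_in[OF b_in[OF b_in[OF a_in[OF b_in[OF b_in[OF b_in[OF b_in[OF m0]]]]]]]]] by argo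
  qed
qed

lemma quad_abbaab:
  assumes x0: "hex h0 h1 h2"
  shows "a (b (a (b (b (a (a (b (b (a h0))))))))) = b (a (a (b (b (a h0)))))"
proof (rule nonhex[OF x0])
  note m0 = m0[OF x0] and m2 = m2[OF x0] and k0 = k0[OF x0] and k2 = k2[OF x0] and x1 = x1[OF x0] and x2 = x2[OF x0]
  show "b (a (a (b (b (a h0))))) \<in> E"
    by (rule b_in[OF a_in[OF a_in[OF b_in[OF b_in[OF a_in[OF m0]]]]]])
  show "b (a (a (b (b (a h0))))) \<noteq> h0"
  proof
    assume e: "b (a (a (b (b (a h0))))) = h0"
    show False
      using e quad_abbaa[OF x0] a_order[OF b_in[OF b_in[OF a_in[OF m0]]]]
         a2_ne_b1[OF b_in[OF a_in[OF b_in[OF a_in[OF a_in[OF b_in[OF b_in[OF a_in[OF m0]]]]]]]]] by argo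
  qed
  show "b (a (a (b (b (a h0))))) \<noteq> h1"
  proof
    assume e: "b (a (a (b (b (a h0))))) = h1"
    show False
      using e k0 quad_b[OF x0] quad_a[OF x0] quad_bb[OF x0] quad_bbb[OF x0] quad_ab[OF x0] quad_abbaa[OF x0] quad_abbb[OF x1]
         a_order[OF m0] b_order[OF a_in[OF b_in[OF a_in[OF m0]]]] b_order[OF a_in[OF b_in[OF b_in[OF m0]]]] a_order[OF b_in[OF b_in[OF a_in[OF m0]]]]
         a_order[OF b_in[OF a_in[OF b_in[OF a_in[OF m0]]]]] a_order[OF b_in[OF a_in[OF b_in[OF b_in[OF m0]]]]]
         a_order[OF b_in[OF a_in[OF b_in[OF b_in[OF b_in[OF m0]]]]]] a_order[OF b_in[OF a_in[OF a_in[OF b_in[OF b_in[OF m0]]]]]]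
         a_order[OF b_in[OF a_in[OF b_in[OF b_in[OF a_in[OF m0]]]]]]
         a_order[OF b_in[OF a_in[OF b_in[OF a_in[OF a_in[OF b_in[OF b_in[OF a_in[OF m0]]]]]]]]]
         a0_ne_b2[OF a_in[OF b_in[OF b_in[OF b_in[OF m0]]]]] by argo
  qed
  show "b (a (a (b (b (a h0))))) \<noteq> h2"
  proof
    assume e: "b (a (a (b (b (a h0))))) = h2"
    show False
      using e quad_abb[OF x0] k2 quad_b[OF x2] quad_bb[OF x2] quad_bbb[OF x2] quad_bbbaa[OF x2] quad_bbbaab[OF x2]
         b_order[OF a_in[OF m0]] a_order[OF b_in[OF b_in[OF b_in[OF a_in[OF m0]]]]]
         a_order[OF b_in[OF a_in[OF b_in[OF b_in[OF b_in[OF a_in[OF m0]]]]]]]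
         b_order[OF b_in[OF a_in[OF b_in[OF b_in[OF b_in[OF a_in[OF m0]]]]]]] a_order[OF b_in[OF a_in[OF b_in[OF b_in[OF m2]]]]]
         a_order[OF b_in[OF a_in[OF b_in[OF b_in[OF b_in[OF m2]]]]]] a_order[OF b_in[OF a_in[OF a_in[OF b_in[OF b_in[OF m2]]]]]]
         a0_ne_b2[OF a_in[OF a_in[OF a_in[OF b_in[OF a_in[OF b_in[OF b_in[OF b_in[OF m2]]]]]]]]] by argo
  qed
qed

lemma quad_abbaabb:
  assumes x0: "hex h0 h1 h2"
  shows "a (b (a (b (b (b (a (a (b (b (a h0)))))))))) = b (b (a (a (b (b (a h0))))))"
proof (rule nonhex[OF x0])
  note m0 = m0[OF x0] and m1 = m1[OF x0] and k0 = k0[OF x0] and k2 = k2[OF x0] and x1 = x1[OF x0] and x2 = x2[OF x0]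
  show "b (b (a (a (b (b (a h0)))))) \<in> E"
    by (rule b_in[OF b_in[OF a_in[OF a_in[OF b_in[OF b_in[OF a_in[OF m0]]]]]]])
  show "b (b (a (a (b (b (a h0)))))) \<noteq> h0"
  proof
    assume e: "b (b (a (a (b (b (a h0)))))) = h0"
    show False
      using e quad_bbb[OF x0] quad_ab[OF x0] quad_abb[OF x0] quad_abbaab[OF x0]
         b_order[OF a_in[OF a_in[OF b_in[OF b_in[OF a_in[OF m0]]]]]] a_order[OF b_in[OF a_in[OF b_in[OF b_in[OF a_in[OF m0]]]]]]
         a_order[OF b_in[OF a_in[OF b_in[OF b_in[OF b_in[OF a_in[OF m0]]]]]]]
         a_order[OF b_in[OF a_in[OF b_in[OF b_in[OF b_in[OF b_in[OF m0]]]]]]] a0_ne_b2[OF a_in[OF b_in[OF b_in[OF b_in[OF b_in[OF m0]]]]]] by argo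
  qed
  show "b (b (a (a (b (b (a h0)))))) \<noteq> h1"
  proof
    assume e: "b (b (a (a (b (b (a h0)))))) = h1"
    show False
      using e k0 quad_b[OF x0] quad_a[OF x0] quad_bb[OF x0] quad_bbb[OF x0] quad_ab[OF x0] quad_bbbaa[OF x0] quad_abbaa[OF x0]
         quad_bbbaab[OF x0] quad_bbaabb[OF x0] quad_abbaab[OF x0] quad_abbb[OF x1] a_order[OF m0] b_order[OF a_in[OF b_in[OF a_in[OF m0]]]]
         b_order[OF a_in[OF b_in[OF b_in[OF m0]]]] a_order[OF b_in[OF b_in[OF a_in[OF m0]]]] a_order[OF b_in[OF a_in[OF b_in[OF a_in[OF m0]]]]]
         a_order[OF b_in[OF a_in[OF b_in[OF b_in[OF m0]]]]] a_order[OF b_in[OF a_in[OF b_in[OF b_in[OF b_in[OF m0]]]]]]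
         a_order[OF b_in[OF a_in[OF b_in[OF b_in[OF a_in[OF m0]]]]]] a_order[OF b_in[OF a_in[OF b_in[OF b_in[OF b_in[OF b_in[OF m0]]]]]]]
         b_order[OF a_in[OF b_in[OF a_in[OF a_in[OF b_in[OF b_in[OF b_in[OF m0]]]]]]]]
         b_order[OF a_in[OF b_in[OF a_in[OF a_in[OF b_in[OF b_in[OF a_in[OF m0]]]]]]]]
         a_order[OF b_in[OF a_in[OF b_in[OF a_in[OF a_in[OF b_in[OF b_in[OF a_in[OF m0]]]]]]]]]
         a_order[OF b_in[OF a_in[OF b_in[OF a_in[OF a_in[OF b_in[OF b_in[OF b_in[OF m0]]]]]]]]]
         a_order[OF b_in[OF a_in[OF b_in[OF b_in[OF a_in[OF a_in[OF b_in[OF b_in[OF a_in[OF m0]]]]]]]]]]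
         a_order[OF b_in[OF a_in[OF b_in[OF b_in[OF a_in[OF a_in[OF b_in[OF b_in[OF b_in[OF m0]]]]]]]]]]
         a2_ne_b1[OF b_in[OF a_in[OF b_in[OF b_in[OF b_in[OF b_in[OF a_in[OF m1]]]]]]]] by argo
  qed
  show "b (b (a (a (b (b (a h0)))))) \<noteq> h2"
  proof
    assume e: "b (b (a (a (b (b (a h0)))))) = h2"
    show False
      using e quad_abbb[OF x0] quad_abb[OF x0] quad_abbaa[OF x0] k2 quad_bb[OF x2] quad_bbb[OF x2] quad_bbaab[OF x2]
         b_order[OF a_in[OF m0]] b_order[OF b_in[OF a_in[OF a_in[OF b_in[OF b_in[OF a_in[OF m0]]]]]]]
         a_order[OF a_in[OF b_in[OF a_in[OF b_in[OF b_in[OF b_in[OF a_in[OF m0]]]]]]]]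
         a_order[OF b_in[OF a_in[OF b_in[OF b_in[OF b_in[OF b_in[OF a_in[OF m0]]]]]]]]
         a_order[OF b_in[OF b_in[OF b_in[OF a_in[OF a_in[OF b_in[OF b_in[OF a_in[OF m0]]]]]]]]]
         a2_ne_b1[OF a_in[OF b_in[OF a_in[OF b_in[OF b_in[OF b_in[OF b_in[OF a_in[OF m0]]]]]]]]] by argo
  qed
qed

text \<open>The longest word of the exploration; its face, turned by one hexagon edge, is the one at
  which the final contradiction occurs.\<close>

lemma quad_bbaabbaab:
  assumes x0: "hex h0 h1 h2"
  shows "a (b (a (b (b (a (a (b (b (a (a (b (b h0)))))))))))) = b (a (a (b (b (a (a (b (b h0))))))))"
proof (rule nonhex[OF x0])
  note m0 = m0[OF x0] and m1 = m1[OF x0] and k0 = k0[OF x0] and k2 = k2[OF x0] and x1 = x1[OF x0] and x2 = x2[OF x0]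
  show "b (a (a (b (b (a (a (b (b h0)))))))) \<in> E"
    by (rule b_in[OF a_in[OF a_in[OF b_in[OF b_in[OF a_in[OF a_in[OF b_in[OF b_in[OF m0]]]]]]]]])
  show "b (a (a (b (b (a (a (b (b h0)))))))) \<noteq> h0"
  proof
    assume e: "b (a (a (b (b (a (a (b (b h0)))))))) = h0"
    show False
      using e quad_bb[OF x0] quad_bbaabb[OF x0] b_order[OF a_in[OF b_in[OF b_in[OF b_in[OF m0]]]]]
         a_order[OF b_in[OF a_in[OF b_in[OF b_in[OF b_in[OF m0]]]]]]
         b_order[OF a_in[OF b_in[OF b_in[OF b_in[OF a_in[OF a_in[OF b_in[OF b_in[OF m0]]]]]]]]]
         a_order[OF b_in[OF a_in[OF b_in[OF b_in[OF b_in[OF a_in[OF a_in[OF b_in[OF b_in[OF m0]]]]]]]]]]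
         a2_ne_b1[OF b_in[OF b_in[OF b_in[OF a_in[OF a_in[OF b_in[OF b_in[OF m0]]]]]]]] by argo
  qed
  show "b (a (a (b (b (a (a (b (b h0)))))))) \<noteq> h1"
  proof
    assume e: "b (a (a (b (b (a (a (b (b h0)))))))) = h1"
    show False
      using e k0 quad_b[OF x0] quad_bbaab[OF x0] quad_bbaabb[OF x0] quad_a[OF x1] quad_abbb[OF x1]
         b_order[OF a_in[OF b_in[OF b_in[OF m0]]]] a_order[OF b_in[OF a_in[OF b_in[OF b_in[OF m0]]]]]
         a_order[OF b_in[OF a_in[OF b_in[OF b_in[OF b_in[OF a_in[OF a_in[OF b_in[OF b_in[OF m0]]]]]]]]]]
         b_order[OF b_in[OF a_in[OF b_in[OF b_in[OF b_in[OF a_in[OF a_in[OF b_in[OF b_in[OF m0]]]]]]]]]] a_order[OF b_in[OF a_in[OF m1]]]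
         b_order[OF a_in[OF b_in[OF a_in[OF m1]]]] a_order[OF b_in[OF a_in[OF b_in[OF a_in[OF m1]]]]]
         a2_ne_b1[OF b_in[OF a_in[OF b_in[OF b_in[OF a_in[OF a_in[OF b_in[OF b_in[OF m0]]]]]]]]] by argo
  qed
  show "b (a (a (b (b (a (a (b (b h0)))))))) \<noteq> h2"
  proof
    assume e: "b (a (a (b (b (a (a (b (b h0)))))))) = h2"
    show False
      using e quad_a[OF x0] quad_abbb[OF x0] quad_abbaa[OF x0] quad_bbbaab[OF x0] quad_bbaabb[OF x0] quad_abbaab[OF x0]
         quad_abbaabb[OF x0] k2 quad_b[OF x2] quad_bb[OF x2] quad_bbb[OF x2] quad_bbbaa[OF x2] quad_bbaab[OF x2] quad_bbbaab[OF x2]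
         quad_bbaabb[OF x2] a_order[OF m0] a_order[OF b_in[OF a_in[OF m0]]] a_order[OF b_in[OF b_in[OF m0]]]
         b_order[OF a_in[OF b_in[OF a_in[OF m0]]]] a_order[OF b_in[OF b_in[OF b_in[OF m0]]]] a_order[OF b_in[OF a_in[OF b_in[OF a_in[OF m0]]]]]
         b_order[OF a_in[OF a_in[OF b_in[OF b_in[OF m0]]]]] a_order[OF a_in[OF b_in[OF b_in[OF a_in[OF m0]]]]]
         a_order[OF b_in[OF b_in[OF a_in[OF a_in[OF b_in[OF b_in[OF b_in[OF m0]]]]]]]]
         a_order[OF b_in[OF b_in[OF b_in[OF a_in[OF a_in[OF b_in[OF b_in[OF m0]]]]]]]]
         b_order[OF a_in[OF b_in[OF a_in[OF a_in[OF b_in[OF b_in[OF a_in[OF m0]]]]]]]]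
         a_order[OF b_in[OF a_in[OF b_in[OF a_in[OF a_in[OF b_in[OF b_in[OF a_in[OF m0]]]]]]]]]
         b_order[OF a_in[OF a_in[OF b_in[OF b_in[OF a_in[OF a_in[OF b_in[OF b_in[OF m0]]]]]]]]]
         b_order[OF a_in[OF b_in[OF a_in[OF b_in[OF a_in[OF a_in[OF b_in[OF b_in[OF b_in[OF m0]]]]]]]]]]
         a_order[OF b_in[OF a_in[OF b_in[OF b_in[OF b_in[OF a_in[OF a_in[OF b_in[OF b_in[OF m0]]]]]]]]]]
         a_order[OF b_in[OF a_in[OF b_in[OF b_in[OF a_in[OF a_in[OF b_in[OF b_in[OF b_in[OF m0]]]]]]]]]]
         a_order[OF a_in[OF b_in[OF a_in[OF b_in[OF b_in[OF a_in[OF a_in[OF b_in[OF b_in[OF a_in[OF m0]]]]]]]]]]]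
         b_order[OF a_in[OF b_in[OF a_in[OF b_in[OF b_in[OF a_in[OF a_in[OF b_in[OF b_in[OF a_in[OF m0]]]]]]]]]]]
         a_order[OF b_in[OF a_in[OF b_in[OF b_in[OF b_in[OF a_in[OF a_in[OF b_in[OF b_in[OF a_in[OF m0]]]]]]]]]]]
         a2_ne_b1[OF b_in[OF b_in[OF b_in[OF a_in[OF b_in[OF a_in[OF b_in[OF b_in[OF a_in[OF a_in[OF b_in[OF b_in[OF a_in[OF m0]]]]]]]]]]]]]] by argo
  qed
qed

text \<open>The quadrilaterals around h0, h1 and h2 force \<open>a (a e) = b e\<close> for the edge
  e on both sides of \<open>quad_bbaabbaab\<close> taken at h1, against
  \<open>a2_ne_b1\<close>.\<close>

lemma no_hexagon_35: "\<not> hex h0 h1 h2"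
proof
  assume x0: "hex h0 h1 h2"
  note m0 = m0[OF x0] and m1 = m1[OF x0] and k0 = k0[OF x0] and k1 = k1[OF x0] and k2 = k2[OF x0] and x1 = x1[OF x0] and x2 = x2[OF x0]
  show False
    using k0 quad_b[OF x0] quad_a[OF x0] quad_bb[OF x0] quad_bbb[OF x0] quad_ab[OF x0] quad_bbbaa[OF x0] quad_bbaab[OF x0]
       quad_abbaa[OF x0] quad_bbbaab[OF x0] quad_bbaabb[OF x0] quad_abbaab[OF x0] quad_abbaabb[OF x0] k1 quad_b[OF x1] quad_a[OF x1]
       quad_bb[OF x1] quad_abbb[OF x1] quad_bbb[OF x1] quad_ab[OF x1] quad_bbbaa[OF x1] quad_abb[OF x1] quad_bbaab[OF x1]
       quad_abbaa[OF x1] quad_bbbaab[OF x1] quad_bbaabb[OF x1] quad_abbaab[OF x1] quad_abbaabb[OF x1] quad_bbaabbaab[OF x1] k2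
       quad_a[OF x2] quad_abbb[OF x2] quad_ab[OF x2] quad_abb[OF x2] a_order[OF m0] b_order[OF a_in[OF b_in[OF a_in[OF m0]]]]
       b_order[OF a_in[OF b_in[OF b_in[OF m0]]]] a_order[OF b_in[OF b_in[OF a_in[OF m0]]]] a_order[OF b_in[OF a_in[OF b_in[OF a_in[OF m0]]]]]
       a_order[OF b_in[OF a_in[OF b_in[OF b_in[OF m0]]]]] a_order[OF b_in[OF a_in[OF b_in[OF b_in[OF b_in[OF m0]]]]]]
       b_order[OF a_in[OF a_in[OF b_in[OF b_in[OF a_in[OF m0]]]]]] a_order[OF b_in[OF a_in[OF b_in[OF b_in[OF a_in[OF m0]]]]]]
       a_order[OF b_in[OF a_in[OF b_in[OF b_in[OF b_in[OF b_in[OF m0]]]]]]]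
       b_order[OF a_in[OF b_in[OF b_in[OF a_in[OF a_in[OF b_in[OF b_in[OF m0]]]]]]]]
       b_order[OF a_in[OF b_in[OF a_in[OF a_in[OF b_in[OF b_in[OF b_in[OF m0]]]]]]]]
       b_order[OF a_in[OF b_in[OF a_in[OF a_in[OF b_in[OF b_in[OF a_in[OF m0]]]]]]]]
       b_order[OF a_in[OF b_in[OF b_in[OF a_in[OF a_in[OF b_in[OF b_in[OF a_in[OF m0]]]]]]]]]
       a_order[OF b_in[OF a_in[OF b_in[OF a_in[OF a_in[OF b_in[OF b_in[OF a_in[OF m0]]]]]]]]]
       a_order[OF b_in[OF a_in[OF b_in[OF b_in[OF a_in[OF a_in[OF b_in[OF b_in[OF m0]]]]]]]]]
       a_order[OF b_in[OF b_in[OF b_in[OF a_in[OF a_in[OF b_in[OF b_in[OF a_in[OF m0]]]]]]]]]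
       a_order[OF b_in[OF a_in[OF b_in[OF a_in[OF a_in[OF b_in[OF b_in[OF b_in[OF m0]]]]]]]]]
       a_order[OF b_in[OF a_in[OF b_in[OF b_in[OF b_in[OF a_in[OF a_in[OF b_in[OF b_in[OF m0]]]]]]]]]]
       a_order[OF b_in[OF a_in[OF b_in[OF b_in[OF a_in[OF a_in[OF b_in[OF b_in[OF a_in[OF m0]]]]]]]]]]
       a_order[OF b_in[OF a_in[OF b_in[OF b_in[OF a_in[OF a_in[OF b_in[OF b_in[OF b_in[OF m0]]]]]]]]]]
       b_order[OF a_in[OF b_in[OF b_in[OF b_in[OF a_in[OF a_in[OF b_in[OF b_in[OF a_in[OF m0]]]]]]]]]]
       a_order[OF b_in[OF a_in[OF a_in[OF b_in[OF b_in[OF a_in[OF a_in[OF b_in[OF b_in[OF m0]]]]]]]]]]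
       a_order[OF b_in[OF a_in[OF b_in[OF b_in[OF b_in[OF a_in[OF a_in[OF b_in[OF b_in[OF a_in[OF m0]]]]]]]]]]]
       b_order[OF a_in[OF b_in[OF a_in[OF m1]]]] b_order[OF a_in[OF b_in[OF b_in[OF m1]]]] a_order[OF b_in[OF a_in[OF b_in[OF a_in[OF m1]]]]]
       a_order[OF b_in[OF a_in[OF b_in[OF b_in[OF m1]]]]] a_order[OF b_in[OF a_in[OF b_in[OF b_in[OF b_in[OF m1]]]]]]
       a_order[OF b_in[OF a_in[OF b_in[OF b_in[OF a_in[OF m1]]]]]] a_order[OF b_in[OF a_in[OF b_in[OF b_in[OF b_in[OF a_in[OF m1]]]]]]]
       a_order[OF b_in[OF a_in[OF b_in[OF b_in[OF b_in[OF b_in[OF m1]]]]]]]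
       b_order[OF a_in[OF b_in[OF a_in[OF a_in[OF b_in[OF b_in[OF b_in[OF m1]]]]]]]]
       b_order[OF a_in[OF b_in[OF a_in[OF a_in[OF b_in[OF b_in[OF a_in[OF m1]]]]]]]]
       b_order[OF a_in[OF b_in[OF b_in[OF a_in[OF a_in[OF b_in[OF b_in[OF a_in[OF m1]]]]]]]]]
       a_order[OF b_in[OF a_in[OF b_in[OF a_in[OF a_in[OF b_in[OF b_in[OF a_in[OF m1]]]]]]]]]
       a_order[OF b_in[OF a_in[OF b_in[OF b_in[OF a_in[OF a_in[OF b_in[OF b_in[OF m1]]]]]]]]]
       a_order[OF b_in[OF a_in[OF b_in[OF a_in[OF a_in[OF b_in[OF b_in[OF b_in[OF m1]]]]]]]]]
       a_order[OF b_in[OF a_in[OF b_in[OF b_in[OF b_in[OF a_in[OF a_in[OF b_in[OF b_in[OF m1]]]]]]]]]]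
       a_order[OF b_in[OF a_in[OF b_in[OF b_in[OF a_in[OF a_in[OF b_in[OF b_in[OF a_in[OF m1]]]]]]]]]]
       a_order[OF b_in[OF a_in[OF b_in[OF b_in[OF a_in[OF a_in[OF b_in[OF b_in[OF b_in[OF m1]]]]]]]]]]
       a2_ne_b1[OF a_in[OF b_in[OF a_in[OF b_in[OF b_in[OF a_in[OF a_in[OF b_in[OF b_in[OF a_in[OF a_in[OF b_in[OF b_in[OF m1]]]]]]]]]]]]]] by argo
qed

end

section \<open>The two exceptional pairs\<close>

text \<open>By transitivity the orbit of x is all of N. If x returns after n > 0 steps, the orbit
  has at most n points, so n >= d; by the pigeonhole principle and injectivity x does return after
  at most d steps.\<close>

lemma cyclic_permutation:
  assumes "finite N" "card N = d" "\<And>x. x \<in> N \<Longrightarrow> f x \<in> N" "inj_on f N"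
    and trans: "\<And>x y. x \<in> N \<Longrightarrow> y \<in> N \<Longrightarrow> \<exists>k. y = (f ^^ k) x" and x: "x \<in> N"
  shows "(f ^^ d) x = x" "0 < j \<Longrightarrow> j < d \<Longrightarrow> (f ^^ j) x \<noteq> x"
proof -
  have inN: "(f ^^ k) y \<in> N" if "y \<in> N" for k y
    using that assms(3) by (induction k) auto
  have inj: "u = v" if "(f ^^ k) u = (f ^^ k) v" "u \<in> N" "v \<in> N" for k u v
    using that
  proof (induction k arbitrary: u v)
    case (Suc k)
    then have "(f ^^ k) (f u) = (f ^^ k) (f v)"
      by (simp add: funpow_swap1)
    then have "f u = f v"
      using Suc assms(3) by blast
    then show ?case
      using Suc.prems assms(4) by (auto dest: inj_onD)
  qed simp
  have lower: "d \<le> n" if "0 < n" "(f ^^ n) x = x" for n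
  proof -
    have "N \<subseteq> (\<lambda>k. (f ^^ k) x) ` {..<n}"
    proof
      fix y assume "y \<in> N"
      then obtain k where k: "y = (f ^^ k) x"
        using trans x by blast
      also have "\<dots> = (f ^^ (k mod n)) x"
        using that(2) by (simp add: funpow_mod_eq)
      finally show "y \<in> (\<lambda>k. (f ^^ k) x) ` {..<n}"
        using that(1) by auto
    qed
    then have "card N \<le> card {..<n}"
      by (intro surj_card_le) auto
    then show ?thesis using assms(2) by simp
  qed
  show "(f ^^ j) x \<noteq> x" if "0 < j" "j < d"
    using lower[of j] that by auto
  have "\<not> inj_on (\<lambda>k. (f ^^ k) x) {..d}"
  proof
    assume "inj_on (\<lambda>k. (f ^^ k) x) {..d}"
    then have "card {..d} \<le> card N"
      using inN[OF x] assms(1) by (intro card_inj_on_le[of "\<lambda>k. (f ^^ k) x"]) auto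
    then show False using assms(2) by simp
  qed
  then obtain i j where "i < j" "j \<le> d" "(f ^^ i) x = (f ^^ j) x"
    unfolding inj_on_def by (metis atMost_iff nat_neq_iff)
  then have ij: "(f ^^ i) x = (f ^^ i) ((f ^^ (j - i)) x)"
    by (metis add_diff_inverse_nat comp_apply funpow_add less_imp_not_less)
  have "x = (f ^^ (j - i)) x"
    by (rule inj[OF ij x inN[OF x]])
  then have "d \<le> j - i" "(f ^^ (j - i)) x = x"
    using lower[of "j - i"] \<open>i < j\<close> by auto
  moreover have "j - i \<le> d" using \<open>j \<le> d\<close> by simp
  ultimately show "(f ^^ d) x = x"
    by (metis le_antisym)
qed

lemma sum_list_all_eq:
  assumes "\<And>x. x \<in> set xs \<Longrightarrow> f x \<ge> (k::nat)" "(\<Sum>x\<leftarrow>xs. f x) = k * length xs" "x \<in> set xs"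
  shows "f x = k"
  using assms
proof (induction xs)
  case (Cons y ys)
  have "f y \<ge> k" "(\<Sum>x\<leftarrow>ys. f x) \<ge> k * length ys"
    using Cons.prems(1) sum_list_ge[of ys k f] by auto
  then have "f y = k" "(\<Sum>x\<leftarrow>ys. f x) = k * length ys"
    using Cons.prems(2) by auto
  then show ?case
    using Cons by auto
qed simp

text \<open>The lengths are even and at least 4, so the total surplus of 2 cannot be shared and
  falls to one face.\<close>

lemma one_hexagon:
  assumes "\<forall>C\<in>set Fs. even (length C) \<and> length C \<ge> 4" "(\<Sum>C\<leftarrow>Fs. length C) = 4 * length Fs + 2"
  shows "\<exists>C\<in>set Fs. length C = 6 \<and> (\<forall>D\<in>set Fs. D = C \<or> length D = 4)"
  using assms
proof (induction Fs)
  case (Cons D Fs)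
  show ?case
  proof (cases "length D = 4")
    case True
    then show ?thesis using Cons by auto
  next
    case False
    then have "length D \<ge> 6"
      using Cons.prems(1) by (auto elim!: evenE)
    moreover have "(\<Sum>C\<leftarrow>Fs. length C) \<ge> 4 * length Fs"
      using sum_list_ge[of Fs 4 length] Cons.prems(1) by auto
    ultimately have "length D = 6" "(\<Sum>C\<leftarrow>Fs. length C) = 4 * length Fs"
      using Cons.prems(2) by auto
    moreover from this(2) have "length x = 4" if "x \<in> set Fs" for x
      using sum_list_all_eq[of Fs 4 length x] Cons.prems(1) that by simp
    ultimately show ?thesis by auto
  qed
qed simp

text \<open>Two different faces with a common dart would give it multiplicity two, against
  \<open>plane_map_count\<close>.\<close>

lemma dart_face_unique:
  assumes "plane_map Fs" "C \<in> set Fs" "D \<in> set Fs" "d \<in> set (cdarts C)" "d \<in> set (cdarts D)"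
  shows "C = D"
proof (rule ccontr)
  assume ne: "C \<noteq> D"
  obtain F1 F2 where Fs: "Fs = F1 @ C # F2"
    using assms(2) by (meson split_list)
  then have "D \<in> set (F1 @ F2)"
    using assms(3) ne by auto
  then have "d \<in># map_darts (F1 @ F2)"
    using assms(5) unfolding dart_set_eq by blast
  then have 1: "count (map_darts F1 + map_darts F2) d \<ge> 1"
    by (metis Suc_leI One_nat_def count_greater_zero_iff map_darts_simps(3))
  have 2: "count (mset (cdarts C)) d \<ge> 1"
    using assms(4) by (metis Suc_leI One_nat_def count_greater_zero_iff set_mset_mset)
  have "count (map_darts Fs) d = count (map_darts F1 + map_darts F2) d + count (mset (cdarts C)) d"
    unfolding Fs by simp
  with 1 2 have "count (map_darts Fs) d \<ge> 2"
    by linarith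
  then show False
    using plane_map_count[OF assms(1), of d] by simp
qed

section \<open>The rotation system of a plane map\<close>

locale plane_rotation =
  fixes Fs :: "'a list list"
  assumes pm: "plane_map Fs"
begin

lemma dart_in_face: "(x, v) \<in> dart_set Fs \<Longrightarrow> \<exists>C\<in>set Fs. (x, v) \<in> set (cdarts C)"
  unfolding dart_set_eq by blast

lemma face_dart: "C \<in> set Fs \<Longrightarrow> d \<in> set (cdarts C) \<Longrightarrow> d \<in> dart_set Fs"
  unfolding dart_set_eq by blast

lemma ex1_corner:
  assumes "(v, x) \<in> dart_set Fs"
  shows "\<exists>!y. (x, y) \<in> corner Fs v"
proof -
  have "(x, v) \<in> dart_set Fs"
    by (rule plane_map_dart_sym[OF pm assms])
  then obtain C where C: "C \<in> set Fs" "(x, v) \<in> set (cdarts C)"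
    using dart_in_face by blast
  then obtain y where y: "(v, y) \<in> set (cdarts C)"
    using cdarts_in_set[of x v C] ex_cdart_from[of v C] by blast
  show ?thesis
  proof
    show "(x, y) \<in> corner Fs v"
      using C y by (auto simp: corner_def)
    fix z assume "(x, z) \<in> corner Fs v"
    then obtain D where D: "D \<in> set Fs" "(x, v) \<in> set (cdarts D)" "(v, z) \<in> set (cdarts D)"
      by (auto simp: corner_def)
    then have "D = C"
      using dart_face_unique[OF pm D(1) C(1) D(2) C(2)] by simp
    then show "z = y"
      using D(3) y cdarts_from_unique plane_map_faces[OF pm C(1)] by metis
  qed
qed

definition rot :: "'a \<Rightarrow> 'a \<Rightarrow> 'a" where
  "rot v x = (THE y. (x, y) \<in> corner Fs v)"

lemma rot_corner: "(v, x) \<in> dart_set Fs \<Longrightarrow> (x, rot v x) \<in> corner Fs v"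
  unfolding rot_def by (rule theI'[OF ex1_corner])

lemma corner_darts:
  assumes "(x, y) \<in> corner Fs v"
  shows "(v, x) \<in> dart_set Fs" "(v, y) \<in> dart_set Fs" "x \<noteq> y" "rot v x = y"
proof -
  obtain C where C: "C \<in> set Fs" "(x, v) \<in> set (cdarts C)" "(v, y) \<in> set (cdarts C)"
    using assms by (auto simp: corner_def)
  show 1: "(v, x) \<in> dart_set Fs" "(v, y) \<in> dart_set Fs"
    using face_dart C plane_map_dart_sym[OF pm] by blast+
  show "x \<noteq> y"
    using distinct_cycle_antisym(1)[of C x v] plane_map_faces[OF pm C(1)] C by auto
  show "rot v x = y"
    using ex1_corner[OF 1(1)] rot_corner[OF 1(1)] assms by blast
qed

lemma rot_dart: "(v, x) \<in> dart_set Fs \<Longrightarrow> (v, rot v x) \<in> dart_set Fs"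
  by (rule corner_darts(2)[OF rot_corner])

lemma rot_ne: "(v, x) \<in> dart_set Fs \<Longrightarrow> rot v x \<noteq> x"
  using corner_darts(3)[OF rot_corner[of v x]] by auto

lemma rot_inj:
  assumes "(v, x) \<in> dart_set Fs" "(v, y) \<in> dart_set Fs" "rot v x = rot v y"
  shows "x = y"
proof -
  obtain C where C: "C \<in> set Fs" "(x, v) \<in> set (cdarts C)" "(v, rot v x) \<in> set (cdarts C)"
    using rot_corner[OF assms(1)] by (auto simp: corner_def)
  obtain D where D: "D \<in> set Fs" "(y, v) \<in> set (cdarts D)" "(v, rot v y) \<in> set (cdarts D)"
    using rot_corner[OF assms(2)] by (auto simp: corner_def)
  have "C = D"
    using dart_face_unique[OF pm C(1) D(1) C(3)] D(3) assms(3) by simp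
  then show ?thesis
    using C(2) D(2) cdarts_to_unique plane_map_faces[OF pm C(1)] by metis
qed

lemma rot_trans:
  assumes "(v, x) \<in> dart_set Fs" "(v, y) \<in> dart_set Fs"
  shows "\<exists>k. y = (rot v ^^ k) x"
  using plane_map_corner_trans[OF pm assms]
proof induction
  case base
  show ?case by (rule exI[of _ 0]) simp
next
  case (step y z)
  then obtain k where "y = (rot v ^^ k) x" by blast
  then have "z = (rot v ^^ Suc k) x"
    using corner_darts(4)[OF step(2)] by simp
  then show ?case by blast
qed

lemma rot_cycle:
  assumes "finite {x. (v, x) \<in> dart_set Fs}" "card {x. (v, x) \<in> dart_set Fs} = d" "(v, x) \<in> dart_set Fs"
  shows "(rot v ^^ d) x = x" "0 < j \<Longrightarrow> j < d \<Longrightarrow> (rot v ^^ j) x \<noteq> x"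
proof -
  let ?N = "{x. (v, x) \<in> dart_set Fs}"
  have N: "\<And>x. x \<in> ?N \<Longrightarrow> rot v x \<in> ?N" "inj_on (rot v) ?N"
    "\<And>x y. x \<in> ?N \<Longrightarrow> y \<in> ?N \<Longrightarrow> \<exists>k. y = (rot v ^^ k) x" "x \<in> ?N"
    using rot_dart rot_inj rot_trans assms(3) by (auto simp: inj_on_def)
  show "(rot v ^^ d) x = x" "0 < j \<Longrightarrow> j < d \<Longrightarrow> (rot v ^^ j) x \<noteq> x"
    using cyclic_permutation(1)[OF assms(1,2) N] cyclic_permutation(2)[OF assms(1,2) N] by blast+
qed

text \<open>Two steps along a face amount to a rotation about y followed by one about x'; this is
  the composite of \<open>b\<close> and \<open>a\<close> in \<open>hexagon_map\<close>.\<close>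

lemma face_step:
  assumes "C \<in> set Fs" "(x, y) \<in> set (cdarts C)" "(y, x') \<in> set (cdarts C)" "(x', y') \<in> set (cdarts C)"
  shows "rot y x = x'" "rot x' y = y'"
proof -
  have "(x, x') \<in> corner Fs y" "(y, y') \<in> corner Fs x'"
    using assms by (auto simp: corner_def)
  then show "rot y x = x'" "rot x' y = y'"
    using corner_darts(4) by blast+
qed

end

section \<open>Excluding the two exceptional pairs\<close>

lemma card_neighbours:
  assumes "simple_graph V E"
  shows "card {w. {v, w} \<in> E} = vertex_degree E v"
proof -
  have "bij_betw (\<lambda>w. {v, w}) {w. {v, w} \<in> E} {e \<in> E. v \<in> e}"
  proof (rule bij_betwI')
    fix x y
    show "({v, x} = {v, y}) = (x = y)"
      by (auto simp: doubleton_eq_iff)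
  next
    fix e assume e: "e \<in> {e \<in> E. v \<in> e}"
    then have "card e = 2"
      using assms by (auto simp: simple_graph_def)
    then obtain w where "e = {v, w}"
      using e by (auto simp: card_2_iff insert_commute)
    then show "\<exists>w\<in>{w. {v, w} \<in> E}. e = {v, w}"
      using e by auto
  qed auto
  then show ?thesis
    unfolding vertex_degree_def by (rule bij_betw_same_card)
qed

text \<open>In a piece on two vertices the one other than v would have degree at most one. So both
  pieces obey the full bound, and m <= 2 (n + 1) - 8.\<close>

lemma not_two_connected_edges:
  assumes "plane_graph V E pos \<gamma>" "bip X E" "\<And>v. v \<in> V \<Longrightarrow> vertex_degree E v \<ge> 2"
    and "card V \<ge> 3" "\<not> plane_graph.two_connected V E"
  shows "card E + 6 \<le> 2 * card V"
proof -
  interpret plane_graph V E pos \<gamma> by fact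
  obtain V1 V2 v where d: "V1 \<union> V2 = V" "V1 \<inter> V2 = {v}" "card V1 \<ge> 2" "card V2 \<ge> 2"
    "\<And>e. e \<in> E \<Longrightarrow> e \<subseteq> V1 \<or> e \<subseteq> V2"
    using cut_decomposition[OF assms(5,4)] by blast
  have fin: "finite V1" "finite V2"
    using finite_V d(1) by auto
  have cV: "card V1 + card V2 = card V + 1"
    using card_Un_Int[OF fin] d(1,2) by simp
  let ?E = "\<lambda>W. {e \<in> E. e \<subseteq> W}"
  have three: "card W \<noteq> 2" if W: "W = V1 \<and> W' = V2 \<or> W = V2 \<and> W' = V1" for W W'
  proof
    assume "card W = 2"
    moreover have "W \<subseteq> V" "W \<inter> W' = {v}"
      using W d(1,2) by auto
    moreover from this have "v \<in> W" by auto
    moreover obtain p q where "W = {p, q}" "p \<noteq> q"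
      using \<open>card W = 2\<close> by (auto simp: card_2_iff)
    ultimately have "\<exists>s. W = {v, s} \<and> s \<noteq> v"
      by (cases "v = p") (auto intro: exI[of _ q] exI[of _ p])
    with \<open>W \<subseteq> V\<close> \<open>W \<inter> W' = {v}\<close> obtain s where s: "W = {v, s}" "s \<noteq> v" "s \<notin> W'" "s \<in> V"
      by auto
    have sub: "{e \<in> E. s \<in> e} \<subseteq> {{v, s}}"
    proof
      fix e assume e: "e \<in> {e \<in> E. s \<in> e}"
      then have "e \<subseteq> W" "card e = 2"
        using d(5) s(3) W simple by (auto simp: simple_graph_def)
      then show "e \<in> {{v, s}}"
        using \<open>card W = 2\<close> card_subset_eq[of W e] s(1) by simp
    qed
    have "vertex_degree E s \<le> 1"
      using card_mono[OF _ sub] unfolding vertex_degree_def by simp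
    then show False
      using assms(3)[OF s(4)] by simp
  qed
  have bound: "card (?E W) + 4 \<le> 2 * card W" if W: "W = V1 \<or> W = V2" for W
  proof (rule plane_bipartite_edges)
    show "plane_graph W (?E W) pos \<gamma>"
      using W d(1) by (intro cut_subgraph[OF assms(1)]) auto
    show "bip X (?E W)"
      using assms(2) by (auto simp: bip_def)
    show "3 \<le> card W"
      using three d(3,4) W by (metis Suc_leI eval_nat_numeral(3) le_neq_implies_less)
  qed
  have "E = ?E V1 \<union> ?E V2"
    using d(5) by auto
  then have "card E \<le> card (?E V1) + card (?E V2)"
    by (metis card_Un_le)
  then show ?thesis
    using bound[of V1] bound[of V2] cV by auto
qed

lemma bip_subset: "bip X E \<Longrightarrow> F \<subseteq> E \<Longrightarrow> bip X F"
  by (auto simp: bip_def)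

lemma bipartition_bip:
  assumes "bipartition X Y E"
  shows "bip X E"
proof -
  have "x \<in> X \<longleftrightarrow> y \<notin> X" if "{x, y} \<in> E" for x y
  proof -
    have "X \<inter> Y = {}" "\<forall>e\<in>E. \<exists>x\<in>X. \<exists>y\<in>Y. e = {x, y}"
      using assms by (simp_all add: bipartition_def)
    moreover from this(2) that obtain x' y' where "x' \<in> X" "y' \<in> Y" "{x, y} = {x', y'}"
      by meson
    ultimately show ?thesis
      by (auto simp: doubleton_eq_iff)
  qed
  then show ?thesis by (simp add: bip_def)
qed

text \<open>Nine edges on six vertices exceed the bound 2 * 6 - 4 = 8.\<close>

lemma plane_no_K33:
  assumes "plane_graph V E pos \<gamma>" "bip X E" "S \<subseteq> X" "T \<inter> X = {}" "card S = 3" "card T = 3"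
    "\<And>s t. s \<in> S \<Longrightarrow> t \<in> T \<Longrightarrow> {s, t} \<in> E"
  shows False
proof -
  interpret plane_graph V E pos \<gamma> by fact
  let ?E = "(\<lambda>(s, t). {s, t}) ` (S \<times> T)"
  have fin: "finite S" "finite T"
    using assms(5,6) by (auto intro: card_ge_0_finite)
  have disj: "S \<inter> T = {}"
    using assms(3,4) by auto
  have sub: "?E \<subseteq> E"
    using assms(7) by auto
  have "S \<noteq> {}" "T \<noteq> {}"
    using assms(5,6) by auto
  then have SV: "S \<union> T \<subseteq> V"
    using assms(7) simple unfolding simple_graph_def by blast
  have "plane_graph (S \<union> T) ?E pos \<gamma>"
  proof
    show "simple_graph (S \<union> T) ?E"
      using sub simple fin by (auto simp: simple_graph_def)
    show "plane_drawing (S \<union> T) ?E pos \<gamma>"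
      by (rule plane_drawing_subgraph[OF drawing SV sub]) auto
  qed
  moreover have "bip X ?E"
    by (rule bip_subset[OF assms(2) sub])
  moreover have "card (S \<union> T) = 6"
    using assms(5,6) disj fin by (simp add: card_Un_disjoint)
  ultimately have "card ?E + 4 \<le> 12"
    using plane_bipartite_edges[of "S \<union> T" ?E pos \<gamma> X] by simp
  moreover have "card ?E = 9"
  proof -
    have "inj_on (\<lambda>(s, t). {s, t}) (S \<times> T)"
      using disj by (auto simp: inj_on_def doubleton_eq_iff)
    then show ?thesis
      using assms(5,6) by (simp add: card_image card_cartesian_product)
  qed
  ultimately show False by simp
qed

text \<open>With m = 2n - 5, Euler's formula becomes 2m = 4F + 2, which leaves one hexagon among
  quadrilaterals. The rotations about the vertices of X and of Y then form a
  \<open>hexagon_map\<close>.\<close>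

lemma exceptional_not_planar:
  assumes pg: "plane_graph (X \<union> Y) E pos \<gamma>" and bp: "bipartition X Y E"
    and degX: "\<And>x. x \<in> X \<Longrightarrow> vertex_degree E x = 3" and degY: "\<And>y. y \<in> Y \<Longrightarrow> vertex_degree E y = d"
    and d: "d = 3 \<or> d = 5" and count: "card E + 5 = 2 * card (X \<union> Y)" and n3: "card (X \<union> Y) \<ge> 3"
  shows False
proof -
  interpret plane_graph "X \<union> Y" E pos \<gamma> by fact
  have bip: "bip X E"
    by (rule bipartition_bip[OF bp])
  have XY: "X \<inter> Y = {}"
    using bp by (simp add: bipartition_def)
  have tc: two_connected
  proof (rule ccontr)
    assume "\<not> two_connected"
    then have "card E + 6 \<le> 2 * card (X \<union> Y)"
      using degX degY d n3 by (intro not_two_connected_edges[OF pg bip]) auto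
    then show False using count by simp
  qed
  obtain Fs where pm: "plane_map Fs" and ds: "dart_set Fs = {(x, y). {x, y} \<in> E}"
    and "map_verts Fs = X \<union> Y"
    and Fs: "\<forall>C\<in>set Fs. even (length C) \<and> length C \<ge> 4"
      "length Fs + card (X \<union> Y) = card E + 2" "(\<Sum>C\<leftarrow>Fs. length C) = 2 * card E"
    using plane_bipartite_faces[OF pg tc bip] .
  interpret plane_rotation Fs
    by (rule plane_rotation.intro[OF pm])
  have dsd: "dart_set Fs = darts"
    using ds by (simp add: darts_def)
  have "(\<Sum>C\<leftarrow>Fs. length C) = 4 * length Fs + 2"
    using Fs(2,3) count by linarith
  then obtain C where C: "C \<in> set Fs" "length C = 6" "\<And>D. D \<in> set Fs \<Longrightarrow> D \<noteq> C \<Longrightarrow> length D = 4"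
    using one_hexagon[OF Fs(1)] by blast
  have parity: "x \<in> X \<longleftrightarrow> y \<notin> X" if "(x, y) \<in> darts" for x y
    using bip that by (simp add: bip_def darts_def)
  have inXY: "x \<in> X \<union> Y" "y \<in> X \<union> Y" if "(x, y) \<in> darts" for x y
    using darts_verts[OF that] by auto
  have nb: "{w. (v, w) \<in> dart_set Fs} = {w. {v, w} \<in> E}" for v
    unfolding ds by simp
  have fin: "finite {w. (v, w) \<in> dart_set Fs}" for v
  proof (rule finite_subset)
    show "{w. (v, w) \<in> dart_set Fs} \<subseteq> X \<union> Y"
      using inXY unfolding dsd by blast
  qed (rule finite_V)
  have degX': "card {w. (x, w) \<in> dart_set Fs} = 3" if "x \<in> X" for x
    unfolding nb card_neighbours[OF simple] using degX[OF that] .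
  have degY': "card {w. (y, w) \<in> dart_set Fs} = d" if "y \<in> Y" for y
    unfolding nb card_neighbours[OF simple] using degY[OF that] .
  define EE where "EE = {(x, y). (x, y) \<in> darts \<and> x \<in> X}"
  define a where "a = (\<lambda>(x, y). (x, rot x y))"
  define b where "b = (\<lambda>(x, y). (rot y x, y))"
  \<comment> \<open>Every other edge of the hexagon, namely those that the face traverses from X to
    Y.\<close>
  define H where "H = {e \<in> set (cdarts C). fst e \<in> X}"
  have EED: "(x, y) \<in> dart_set Fs \<and> (y, x) \<in> dart_set Fs \<and> x \<in> X \<and> y \<in> Y" if "(x, y) \<in> EE" for x y
    using that parity[of x y] inXY[of x y] darts_sym[of x y] by (auto simp: EE_def dsd)
  have a_pow: "(a ^^ i) (x, y) = (x, (rot x ^^ i) y)" for i x y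
    by (induction i) (auto simp: a_def)
  have b_pow: "(b ^^ i) (x, y) = ((rot y ^^ i) x, y)" for i x y
    by (induction i) (auto simp: b_def)
  have step: "a (b (x, y)) = (x', y')"
    if "D \<in> set Fs" "(x, y) \<in> set (cdarts D)" "(y, x') \<in> set (cdarts D)" "(x', y') \<in> set (cdarts D)" for D x y x' y'
    using face_step[OF that] by (simp add: a_def b_def)
  have dart_EE: "(x, y) \<in> EE" if "D \<in> set Fs" "(x, y) \<in> set (cdarts D)" "x \<in> X" for D x y
    using that face_dart[OF that(1,2)] dsd by (simp add: EE_def)
  have hm: "hexagon_map EE a b d H"
  proof
    fix e assume e: "e \<in> EE"
    obtain x y where xy: "e = (x, y)" by force
    note D = EED[OF e[unfolded xy]]
    show "a e \<in> EE"
      using D rot_dart[of x y] by (simp add: xy a_def EE_def dsd)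
    have "(rot y x, y) \<in> darts"
      using D rot_dart[of y x] darts_sym by (simp add: dsd)
    moreover have "y \<notin> X" using D XY by auto
    ultimately show "b e \<in> EE"
      using parity[of "rot y x" y] by (simp add: xy b_def EE_def)
    show "fst (a e) = fst e" "snd (b e) = snd e"
      by (simp_all add: xy a_def b_def)
    have "(rot x ^^ 3) y = y"
      using rot_cycle(1)[OF fin degX'] D by blast
    then show "a (a (a e)) = e"
      by (simp add: xy a_def numeral_3_eq_3)
    show "a e \<noteq> e"
      using D rot_ne[of x y] by (simp add: xy a_def)
    show "(b ^^ d) e = e"
      using rot_cycle(1)[OF fin degY'] D by (simp add: xy b_pow)
    show "(b ^^ j) e \<noteq> e" if "0 < j" "j < d" for j
      using rot_cycle(2)[OF fin degY' _ that] D by (simp add: xy b_pow)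
    show "a (b (a (b e))) = e" if "e \<notin> H"
    proof -
      obtain F where F: "F \<in> set Fs" "(x, y) \<in> set (cdarts F)"
        using D dart_in_face by blast
      \<comment> \<open>Since x is in X, the edge would belong to H if the face were the
        hexagon.\<close>
      have "F \<noteq> C"
        using that F(2) D by (auto simp: H_def xy)
      then have "length F = 4"
        using C(3) F(1) by blast
      then obtain c0 c1 c2 c3 where F4: "F = [c0, c1, c2, c3]"
        by (auto simp: length_Suc_conv eval_nat_numeral)
      have cd: "set (cdarts F) = {(c0, c1), (c1, c2), (c2, c3), (c3, c0)}"
        by (auto simp: F4 cdarts_def)
      have s: "a (b (c0, c1)) = (c2, c3)" "a (b (c1, c2)) = (c3, c0)" "a (b (c2, c3)) = (c0, c1)" "a (b (c3, c0)) = (c1, c2)"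
        by (rule step[OF F(1)]; simp add: cd)+
      show ?thesis
        using F(2) unfolding cd xy by (auto simp: s)
    qed
  next
    fix S T :: "'a set" assume S: "card S = 3" and T: "card T = 3"
    show "\<not> S \<times> T \<subseteq> EE"
    proof
      assume sub: "S \<times> T \<subseteq> EE"
      have "S \<noteq> {}" "T \<noteq> {}" using S T by auto
      then have "S \<subseteq> X" "T \<subseteq> Y"
        using sub EED by blast+
      moreover have "{s, t} \<in> E" if "s \<in> S" "t \<in> T" for s t
        using sub that by (auto simp: EE_def darts_def)
      ultimately show False
        using plane_no_K33[OF pg bip, of S T] S T XY by blast
    qed
  qed
  interpret hexagon_map EE a b d H by (rule hm)
  obtain c0 c1 c2 c3 c4 c5 where C6: "C = [c0, c1, c2, c3, c4, c5]"
    using C(2) by (auto simp: length_Suc_conv eval_nat_numeral)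
  have cd: "set (cdarts C) = {(c0, c1), (c1, c2), (c2, c3), (c3, c4), (c4, c5), (c5, c0)}"
    by (auto simp: C6 cdarts_def)
  have s: "a (b (c0, c1)) = (c2, c3)" "a (b (c1, c2)) = (c3, c4)" "a (b (c2, c3)) = (c4, c5)"
    "a (b (c3, c4)) = (c5, c0)" "a (b (c4, c5)) = (c0, c1)" "a (b (c5, c0)) = (c1, c2)"
    by (rule step[OF C(1)]; simp add: cd)+
  have par: "c0 \<in> X \<longleftrightarrow> c1 \<notin> X" "c1 \<in> X \<longleftrightarrow> c2 \<notin> X" "c2 \<in> X \<longleftrightarrow> c3 \<notin> X" "c3 \<in> X \<longleftrightarrow> c4 \<notin> X" "c4 \<in> X \<longleftrightarrow> c5 \<notin> X"
    using parity face_dart[OF C(1)] unfolding dsd cd by blast+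
  have HE: "H \<subseteq> EE"
    unfolding H_def using dart_EE[OF C(1)] by auto
  \<comment> \<open>The class of \<open>c0\<close> decides which three alternate darts of C start in
    X.\<close>
  have "\<exists>h0 h1 h2. hex h0 h1 h2"
  proof (cases "c0 \<in> X")
    case True
    then have "H = {(c0, c1), (c2, c3), (c4, c5)}"
      unfolding H_def cd using par by auto
    then have "hex (c0, c1) (c2, c3) (c4, c5)"
      unfolding hex_def using HE s by simp
    then show ?thesis by blast
  next
    case False
    then have "H = {(c1, c2), (c3, c4), (c5, c0)}"
      unfolding H_def cd using par by auto
    then have "hex (c1, c2) (c3, c4) (c5, c0)"
      unfolding hex_def using HE s by simp
    then show ?thesis by blast
  qed
  then obtain h0 h1 h2 where hex: "hex h0 h1 h2" by blast
  from d show False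
  proof
    assume "d = 3"
    then interpret hexagon_map3 EE a b d H by unfold_locales
    show False using no_hexagon_33 hex by blast
  next
    assume "d = 5"
    then interpret hexagon_map5 EE a b d H by unfold_locales
    show False using no_hexagon_35 hex by blast
  qed
qed

section \<open>Straight-line drawings\<close>

definition noncrossing :: "(complex \<times> complex) set \<Rightarrow> bool" where
  "noncrossing E \<longleftrightarrow> (\<forall>(x, y)\<in>E. \<forall>(x', y')\<in>E. (x, y) \<noteq> (x', y') \<longrightarrow>
     closed_segment x y \<inter> closed_segment x' y' \<subseteq> {x, y} \<inter> {x', y'})"

text \<open>The vertices are the points of the drawing themselves;
  \<open>straight_planar_graphic\<close> turns them into natural numbers.\<close>

definition straight_biregular :: "nat \<Rightarrow> nat \<Rightarrow> nat \<Rightarrow> nat \<Rightarrow> bool" where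
  "straight_biregular a p b q \<longleftrightarrow> (\<exists>X Y E. finite X \<and> finite Y \<and> X \<inter> Y = {} \<and> E \<subseteq> X \<times> Y \<and>
     card X = p \<and> card Y = q \<and> (\<forall>x\<in>X. card {y. (x, y) \<in> E} = a) \<and> (\<forall>y\<in>Y. card {x. (x, y) \<in> E} = b) \<and>
     noncrossing E)"

lemma straight_biregularE:
  assumes "straight_biregular a p b q"
  obtains X Y E where "finite X" "finite Y" "X \<inter> Y = {}" "E \<subseteq> X \<times> Y" "card X = p" "card Y = q"
    "\<forall>x\<in>X. card {y. (x, y) \<in> E} = a" "\<forall>y\<in>Y. card {x. (x, y) \<in> E} = b" "noncrossing E"
  using assms unfolding straight_biregular_def by (elim exE conjE) (rule that; assumption)

lemma noncrossingD:
  assumes "noncrossing E" "(x, y) \<in> E" "(x', y') \<in> E" "(x, y) \<noteq> (x', y')"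
  shows "closed_segment x y \<inter> closed_segment x' y' \<subseteq> {x, y} \<inter> {x', y'}"
  using assms unfolding noncrossing_def by fastforce

section \<open>Separating segments by lines\<close>

lemma affine_on_segment:
  assumes "z \<in> closed_segment x y"
  obtains u where "0 \<le> u" "u \<le> 1" "z = (1 - u) *\<^sub>R x + u *\<^sub>R y"
    "\<And>\<alpha> \<beta>. \<alpha> * Re z + \<beta> * Im z = (1 - u) * (\<alpha> * Re x + \<beta> * Im x) + u * (\<alpha> * Re y + \<beta> * Im y)"
proof -
  obtain u where u: "0 \<le> u" "u \<le> 1" "z = (1 - u) *\<^sub>R x + u *\<^sub>R y"
    using assms by (auto simp: closed_segment_def)
  show thesis
    by (rule that[OF u]) (simp add: u(3) algebra_simps)
qed

text \<open>The value at z is a weighted mean of the values at the ends. If it attains the bound c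
  although one end stays below, all the weight is on the other end.\<close>

lemma segment_below:
  fixes x y z :: complex and \<alpha> \<beta> c :: real
  defines "g \<equiv> \<lambda>z. \<alpha> * Re z + \<beta> * Im z"
  assumes "z \<in> closed_segment x y" "g x \<le> c" "g y \<le> c"
  shows "g z \<le> c" "\<not> (g x = c \<and> g y = c) \<Longrightarrow> g z = c \<Longrightarrow> z \<in> {x, y}"
proof -
  obtain u where u: "0 \<le> u" "u \<le> 1" "z = (1 - u) *\<^sub>R x + u *\<^sub>R y" "g z = (1 - u) * g x + u * g y"
    using affine_on_segment[OF assms(2)] unfolding g_def by metis
  have 1: "(1 - u) * g x \<le> (1 - u) * c" "u * g y \<le> u * c"
    using u assms(3,4) by (auto intro: mult_left_mono)
  then show "g z \<le> c"
    using u(4) by (simp add: algebra_simps)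
  assume ne: "\<not> (g x = c \<and> g y = c)" and eq: "g z = c"
  moreover have "c = (1 - u) * c + u * c"
    by (simp add: algebra_simps)
  ultimately have "(1 - u) * g x = (1 - u) * c" "u * g y = u * c"
    using 1 u(4) by linarith+
  then have "1 - u = 0 \<or> g x = c" "u = 0 \<or> g y = c"
    using mult_cancel_left by blast+
  then have "u = 1 \<or> u = 0"
    using ne by linarith
  then show "z \<in> {x, y}"
    using u(3) by auto
qed

text \<open>A common point must lie on the line g = c, which each segment meets at most in one of
  its ends. Touching the line is permitted so that segments with a common end are covered.\<close>

lemma segments_separated:
  fixes x y x' y' :: complex and \<alpha> \<beta> c :: real
  defines "g \<equiv> \<lambda>z. \<alpha> * Re z + \<beta> * Im z"
  assumes "g x \<le> c" "g y \<le> c" "g x < c \<or> g y < c" "c \<le> g x'" "c \<le> g y'" "c < g x' \<or> c < g y'"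
  shows "closed_segment x y \<inter> closed_segment x' y' \<subseteq> {x, y} \<inter> {x', y'}"
proof
  fix z assume z: "z \<in> closed_segment x y \<inter> closed_segment x' y'"
  have "g z \<le> c"
    using segment_below(1)[of z x y \<alpha> \<beta> c] z assms unfolding g_def by auto
  moreover have "- g z \<le> - c"
    using segment_below(1)[of z x' y' "- \<alpha>" "- \<beta>" "- c"] z assms unfolding g_def by auto
  ultimately have "g z = c" by simp
  then have "z \<in> {x, y}" "z \<in> {x', y'}"
    using segment_below(2)[of z x y \<alpha> \<beta> c] segment_below(2)[of z x' y' "- \<alpha>" "- \<beta>" "- c"] z assms
    unfolding g_def by auto
  then show "z \<in> {x, y} \<inter> {x', y'}" ..
qed

lemma segments_disjoint:
  fixes x y x' y' :: complex and \<alpha> \<beta> c :: real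
  defines "g \<equiv> \<lambda>z. \<alpha> * Re z + \<beta> * Im z"
  assumes "g x \<le> c" "g y \<le> c" "c < g x'" "c < g y'"
  shows "closed_segment x y \<inter> closed_segment x' y' = {}"
proof -
  have False if z: "z \<in> closed_segment x y" "z \<in> closed_segment x' y'" for z
  proof -
    have "g z \<le> c"
      using segment_below(1)[of z x y \<alpha> \<beta> c] z assms unfolding g_def by auto
    moreover have "- g z \<le> - min (g x') (g y')"
      using segment_below(1)[of z x' y' "- \<alpha>" "- \<beta>" "- min (g x') (g y')"] z unfolding g_def by auto
    ultimately show False
      using assms by auto
  qed
  then show ?thesis by auto
qed

text \<open>Twice the signed area of the triangle p q r; the sign tells on which side of the line
  through p and q the point r lies.\<close>

definition orient :: "complex \<Rightarrow> complex \<Rightarrow> complex \<Rightarrow> real" where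
  "orient p q r = (Re q - Re p) * (Im r - Im p) - (Im q - Im p) * (Re r - Re p)"

lemma orient_functional:
  "orient p q r = (Im p - Im q) * Re r + (Re q - Re p) * Im r - ((Im p - Im q) * Re p + (Re q - Re p) * Im p)"
  "(Im p - Im q) * Re q + (Re q - Re p) * Im q = (Im p - Im q) * Re p + (Re q - Re p) * Im p"
  by (simp_all add: orient_def algebra_simps)

lemma segments_same_side:
  assumes "0 < orient x y x' \<and> 0 < orient x y y' \<or> orient x y x' < 0 \<and> orient x y y' < 0"
  shows "closed_segment x y \<inter> closed_segment x' y' = {}"
  using assms
proof
  assume "0 < orient x y x' \<and> 0 < orient x y y'"
  then show ?thesis
    using segments_disjoint[of "Im x - Im y" x "Re y - Re x" "(Im x - Im y) * Re x + (Re y - Re x) * Im x" y x' y']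
    by (simp add: orient_functional)
next
  assume "orient x y x' < 0 \<and> orient x y y' < 0"
  then show ?thesis
    using segments_disjoint[of "- (Im x - Im y)" x "- (Re y - Re x)" "- ((Im x - Im y) * Re x + (Re y - Re x) * Im x)" y x' y']
      orient_functional(2)[of x y]
    by (simp add: orient_functional(1) algebra_simps)
qed

text \<open>The affine function that vanishes on the line through x and y is not constant on the
  second segment, which therefore leaves this line right after x.\<close>

lemma segments_common_end:
  assumes "orient x y y' \<noteq> 0"
  shows "closed_segment x y \<inter> closed_segment x y' \<subseteq> {x}"
proof
  fix z assume z: "z \<in> closed_segment x y \<inter> closed_segment x y'"
  let ?g = "\<lambda>z. (Im x - Im y) * Re z + (Re y - Re x) * Im z"
  obtain u where u: "?g z = (1 - u) * ?g x + u * ?g y"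
    using affine_on_segment[of z x y] z by (metis IntD1)
  obtain v where v: "z = (1 - v) *\<^sub>R x + v *\<^sub>R y'" "?g z = (1 - v) * ?g x + v * ?g y'"
    using affine_on_segment[of z x y'] z by (metis IntD2)
  have "?g z = ?g x"
    using u orient_functional(2)[of x y] by (simp add: algebra_simps)
  then have "v * (?g y' - ?g x) = 0"
    using v(2) by (simp add: algebra_simps)
  moreover have "?g y' - ?g x \<noteq> 0"
    using assms orient_functional(1)[of x y y'] by simp
  ultimately have "v = 0" by simp
  then show "z \<in> {x}"
    using v(1) by simp
qed

text \<open>Points are renamed by an injection f into the natural numbers, whose inverse serves as
  the position map. Positive degrees guarantee that every vertex is an end of an edge.\<close>

lemma straight_planar_graphic:
  assumes "straight_biregular a p b q" "1 \<le> a" "1 \<le> b"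
  shows "planar_graphic a p b q"
proof -
  obtain X Y E where fin: "finite X" "finite Y" and XY: "X \<inter> Y = {}" and E: "E \<subseteq> X \<times> Y"
    and card: "card X = p" "card Y = q" and degX: "\<forall>x\<in>X. card {y. (x, y) \<in> E} = a"
    and degY: "\<forall>y\<in>Y. card {x. (x, y) \<in> E} = b" and nc: "noncrossing E"
    using straight_biregularE[OF assms(1)] .
  define V where "V = X \<union> Y"
  obtain f :: "complex \<Rightarrow> nat" where f: "inj_on f V"
    using finite_imp_inj_to_nat_seg[of V] fin by (auto simp: V_def)
  define g where "g = inv_into V f"
  have gf: "g (f v) = v" if "v \<in> V" for v
    using that f by (simp add: g_def)
  define ed where "ed = (\<lambda>(x, y). {f x, f y})"
  have EV: "x \<in> V" "y \<in> V" "x \<in> X" "y \<in> Y" "x \<noteq> y" if "(x, y) \<in> E" for x y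
    using that E XY by (auto simp: V_def)
  have f_eq: "f u = f v \<longleftrightarrow> u = v" if "u \<in> V" "v \<in> V" for u v
    using that f by (auto dest: inj_onD)
  have inj_ed: "inj_on ed E"
  proof (rule inj_onI)
    fix d d' assume d: "d \<in> E" "d' \<in> E" "ed d = ed d'"
    obtain x y x' y' where xy: "d = (x, y)" "d' = (x', y')" by force
    have "{f x, f y} = {f x', f y'}"
      using d(3) by (simp add: ed_def xy)
    then have "{x, y} = {x', y'}"
      using EV[of x y] EV[of x' y'] d xy by (auto simp: doubleton_eq_iff f_eq)
    then show "d = d'"
      using EV[of x y] EV[of x' y'] d xy XY by (auto simp: doubleton_eq_iff)
  qed
  define \<gamma> where "\<gamma> = (\<lambda>e. case inv_into E ed e of (x, y) \<Rightarrow> linepath x y)"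
  have \<gamma>: "\<gamma> (ed (x, y)) = linepath x y" if "(x, y) \<in> E" for x y
    using that inj_ed by (simp add: \<gamma>_def)
  have covered: "\<exists>x y. (x, y) \<in> E \<and> (v = x \<or> v = y)" if "v \<in> V" for v
  proof (cases "v \<in> X")
    case True
    then have "{y. (v, y) \<in> E} \<noteq> {}"
      using degX assms(2) by fastforce
    then show ?thesis by auto
  next
    case False
    then have "{x. (x, v) \<in> E} \<noteq> {}"
      using degY assms(3) that by (fastforce simp: V_def)
    then show ?thesis by auto
  qed
  \<comment> \<open>\<open>noncrossing\<close> speaks of edges only, but a vertex on a segment is
    also an end of some edge, so it is a common point of two edges or an end of the given
    one.\<close>
  have seg_V: "closed_segment x y \<inter> V = {x, y}" if xy: "(x, y) \<in> E" for x y
  proof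
    show "{x, y} \<subseteq> closed_segment x y \<inter> V"
      using EV[OF xy] by auto
    show "closed_segment x y \<inter> V \<subseteq> {x, y}"
    proof
      fix v assume v: "v \<in> closed_segment x y \<inter> V"
      then obtain x' y' where x'y': "(x', y') \<in> E" "v = x' \<or> v = y'"
        using covered by blast
      then have "v \<in> closed_segment x' y'" by auto
      then show "v \<in> {x, y}"
        using noncrossingD[OF nc xy x'y'(1)] v x'y'(2) by blast
    qed
  qed
  have gV: "g ` f ` V = V"
    using gf by (auto simp: image_image)
  have ged: "g ` ed (x, y) = {x, y}" if "(x, y) \<in> E" for x y
    using EV[OF that] gf by (simp add: ed_def)
  have "plane_drawing (f ` V) (ed ` E) g \<gamma>"
    unfolding plane_drawing_def
  proof (intro conjI ballI impI)
    show "inj_on g (f ` V)"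
      unfolding g_def by (rule inj_on_inv_into) simp
  next
    fix e assume "e \<in> ed ` E"
    then obtain x y where xy: "(x, y) \<in> E" "e = ed (x, y)" by auto
    show "arc (\<gamma> e)"
      using EV[OF xy(1)] by (simp add: xy \<gamma>[OF xy(1)] arc_linepath)
    show "{pathstart (\<gamma> e), pathfinish (\<gamma> e)} = g ` e"
      by (simp add: xy \<gamma>[OF xy(1)] ged[OF xy(1)])
    show "path_image (\<gamma> e) \<inter> g ` f ` V = g ` e"
      by (simp add: xy \<gamma>[OF xy(1)] ged[OF xy(1)] gV seg_V)
  next
    fix e e' assume "e \<in> ed ` E" "e' \<in> ed ` E" and ne: "e \<noteq> e'"
    then obtain x y x' y' where xy: "(x, y) \<in> E" "e = ed (x, y)" "(x', y') \<in> E" "e' = ed (x', y')" by auto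
    have "e \<subseteq> f ` V" "e' \<subseteq> f ` V"
      using EV[OF xy(1)] EV[OF xy(3)] by (auto simp: xy ed_def)
    moreover have "inj_on g (f ` V)"
      unfolding g_def by (rule inj_on_inv_into) simp
    ultimately have "g ` (e \<inter> e') = g ` e \<inter> g ` e'"
      by (rule inj_on_image_Int[rotated])
    also have "\<dots> = {x, y} \<inter> {x', y'}"
      using ged[OF xy(1)] ged[OF xy(3)] by (simp add: xy)
    also have "\<dots> = closed_segment x y \<inter> closed_segment x' y'"
    proof
      show "{x, y} \<inter> {x', y'} \<subseteq> closed_segment x y \<inter> closed_segment x' y'" by auto
      have "(x, y) \<noteq> (x', y')"
        using ne xy by auto
      then show "closed_segment x y \<inter> closed_segment x' y' \<subseteq> {x, y} \<inter> {x', y'}"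
        by (rule noncrossingD[OF nc xy(1,3)])
    qed
    finally show "path_image (\<gamma> e) \<inter> path_image (\<gamma> e') = g ` (e \<inter> e')"
      by (simp add: xy \<gamma>[OF xy(1)] \<gamma>[OF xy(3)])
  qed
  moreover have "simple_graph (f ` V) (ed ` E)"
    unfolding simple_graph_def
  proof (intro conjI ballI)
    show "finite (f ` V)"
      using fin by (simp add: V_def)
    fix e assume "e \<in> ed ` E"
    then obtain x y where xy: "(x, y) \<in> E" "e = ed (x, y)" by auto
    then have "f x \<noteq> f y"
      using EV[OF xy(1)] f_eq by auto
    then show "e \<subseteq> f ` V" "card e = 2"
      using EV[OF xy(1)] by (auto simp: xy ed_def)
  qed
  ultimately have "planar_graph (f ` X \<union> f ` Y) (ed ` E)"
    unfolding planar_graph_def V_def image_Un by blast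
  moreover have "bipartition (f ` X) (f ` Y) (ed ` E)"
    unfolding bipartition_def
  proof (intro conjI ballI)
    show "f ` X \<inter> f ` Y = {}"
      using f_eq XY by (auto simp: V_def)
    fix e assume "e \<in> ed ` E"
    then show "\<exists>x\<in>f ` X. \<exists>y\<in>f ` Y. e = {x, y}"
      using E by (auto simp: ed_def)
  qed
  moreover have "card (f ` X) = p" "card (f ` Y) = q"
    using card f by (auto simp: card_image V_def inj_on_Un)
  moreover have "vertex_degree (ed ` E) (f x) = a" if x: "x \<in> X" for x
  proof -
    have "{e \<in> ed ` E. f x \<in> e} = ed ` (Pair x ` {y. (x, y) \<in> E})"
    proof
      show "{e \<in> ed ` E. f x \<in> e} \<subseteq> ed ` (Pair x ` {y. (x, y) \<in> E})"
      proof
        fix e assume "e \<in> {e \<in> ed ` E. f x \<in> e}"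
        then obtain u v where uv: "(u, v) \<in> E" "e = ed (u, v)" "f x = f u \<or> f x = f v"
          by (auto simp: ed_def)
        then have "u = x"
          using EV[OF uv(1)] x XY f_eq[of x u] f_eq[of x v] by (auto simp: V_def)
        then show "e \<in> ed ` (Pair x ` {y. (x, y) \<in> E})"
          using uv by auto
      qed
    qed (auto simp: ed_def)
    moreover have "inj_on ed (Pair x ` {y. (x, y) \<in> E})"
      by (rule inj_on_subset[OF inj_ed]) auto
    ultimately show ?thesis
      using bspec[OF degX x] by (simp add: vertex_degree_def card_image inj_on_def)
  qed
  moreover have "vertex_degree (ed ` E) (f y) = b" if y: "y \<in> Y" for y
  proof -
    have "{e \<in> ed ` E. f y \<in> e} = ed ` ((\<lambda>x. (x, y)) ` {x. (x, y) \<in> E})"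
    proof
      show "{e \<in> ed ` E. f y \<in> e} \<subseteq> ed ` ((\<lambda>x. (x, y)) ` {x. (x, y) \<in> E})"
      proof
        fix e assume "e \<in> {e \<in> ed ` E. f y \<in> e}"
        then obtain u v where uv: "(u, v) \<in> E" "e = ed (u, v)" "f y = f u \<or> f y = f v"
          by (auto simp: ed_def)
        then have "v = y"
          using EV[OF uv(1)] y XY f_eq[of y u] f_eq[of y v] by (auto simp: V_def)
        then show "e \<in> ed ` ((\<lambda>x. (x, y)) ` {x. (x, y) \<in> E})"
          using uv by auto
      qed
    qed (auto simp: ed_def)
    moreover have "inj_on ed ((\<lambda>x. (x, y)) ` {x. (x, y) \<in> E})"
      by (rule inj_on_subset[OF inj_ed]) auto
    ultimately show ?thesis
      using bspec[OF degY y] by (simp add: vertex_degree_def card_image inj_on_def)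
  qed
  ultimately show ?thesis
    unfolding planar_graphic_def by (intro exI[of _ "f ` X"] exI[of _ "f ` Y"] exI[of _ "ed ` E"]) auto
qed

lemma straight_biregular_union:
  assumes "straight_biregular a p b q" "straight_biregular a p' b q'"
  shows "straight_biregular a (p + p') b (q + q')"
proof -
  obtain X Y E where 1: "finite X" "finite Y" "X \<inter> Y = {}" "E \<subseteq> X \<times> Y" "card X = p" "card Y = q"
    "\<forall>x\<in>X. card {y. (x, y) \<in> E} = a" "\<forall>y\<in>Y. card {x. (x, y) \<in> E} = b" "noncrossing E"
    using straight_biregularE[OF assms(1)] .
  obtain X' Y' E' where 2: "finite X'" "finite Y'" "X' \<inter> Y' = {}" "E' \<subseteq> X' \<times> Y'" "card X' = p'" "card Y' = q'"
    "\<forall>x\<in>X'. card {y. (x, y) \<in> E'} = a" "\<forall>y\<in>Y'. card {x. (x, y) \<in> E'} = b" "noncrossing E'"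
    using straight_biregularE[OF assms(2)] .
  have "bounded (X \<union> Y \<union> X' \<union> Y')"
    using 1 2 by (intro finite_imp_bounded) auto
  then obtain M where M: "\<And>z. z \<in> X \<union> Y \<union> X' \<union> Y' \<Longrightarrow> norm z \<le> M"
    by (auto simp: bounded_iff)
  \<comment> \<open>The first drawing has real parts at most M, the second one at least -M; a shift
    by 2M + 1 puts the line Re z = M between them.\<close>
  define t where "t = complex_of_real (2 * M + 1)"
  define s where "s = (\<lambda>z. t + z)"
  have left: "Re z \<le> M" if "z \<in> X \<union> Y" for z
    using M[of z] that complex_Re_le_cmod[of z] by fastforce
  have right: "M < Re (s z)" if "z \<in> X' \<union> Y'" for z
    using M[of z] that abs_Re_le_cmod[of z] by (fastforce simp: s_def t_def)
  have inj: "inj_on s A" "s u = s v \<longleftrightarrow> u = v" for A u v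
    by (auto simp: s_def inj_on_def)
  define F where "F = E \<union> map_prod s s ` E'"
  have disj: "(X \<union> Y) \<inter> (s ` X' \<union> s ` Y') = {}"
    using left right by fastforce
  have disjD: "s u \<notin> X" "s u \<notin> Y" if "u \<in> X' \<or> u \<in> Y'" for u
    using disj that by blast+
  have E'D: "u \<in> X' \<and> v \<in> Y'" if "(u, v) \<in> E'" for u v
    using 2(4) that by blast
  have ED: "u \<in> X \<and> v \<in> Y" if "(u, v) \<in> E" for u v
    using 1(4) that by blast
  have seg: "closed_segment (s u) (s v) = s ` closed_segment u v" for u v
    unfolding s_def by (rule closed_segment_translation)
  have Fl: "(x, y) \<in> F \<longleftrightarrow> (x, y) \<in> E" if "x \<in> X \<or> y \<in> Y" for x y
  proof -
    have "(x, y) \<notin> map_prod s s ` E'"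
      using that disjD E'D by (auto 0 3)
    then show ?thesis by (simp add: F_def)
  qed
  have Fr: "(s x, y) \<in> F \<longleftrightarrow> (\<exists>v. y = s v \<and> (x, v) \<in> E')" if "x \<in> X'" for x y
  proof -
    have "(s x, y) \<notin> E"
      using that disjD(1)[of x] ED by blast
    then show ?thesis by (auto simp: F_def inj(2))
  qed
  have Fr': "(x, s y) \<in> F \<longleftrightarrow> (\<exists>v. x = s v \<and> (v, y) \<in> E')" if "y \<in> Y'" for x y
  proof -
    have "(x, s y) \<notin> E"
      using that disjD(2)[of y] ED by blast
    then show ?thesis by (auto simp: F_def inj(2))
  qed
  have sep: "closed_segment x y \<inter> closed_segment (s x') (s y') = {}" if "(x, y) \<in> E" "(x', y') \<in> E'" for x y x' y'
    using segments_disjoint[of 1 x 0 M y "s x'" "s y'"] that 1(4) 2(4) left right by auto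
  show ?thesis
    unfolding straight_biregular_def
  proof (intro exI conjI ballI)
    show "finite (X \<union> s ` X')" "finite (Y \<union> s ` Y')"
      using 1 2 by auto
    show "(X \<union> s ` X') \<inter> (Y \<union> s ` Y') = {}"
      using 1(3) 2(3) disj inj by auto
    show "F \<subseteq> (X \<union> s ` X') \<times> (Y \<union> s ` Y')"
      using 1(4) 2(4) by (auto simp: F_def)
    show "card (X \<union> s ` X') = p + p'" "card (Y \<union> s ` Y') = q + q'"
      using 1(1,2,5,6) 2(1,2,5,6) disj inj(1) by (subst card_Un_disjoint; auto simp: card_image)+
    show "card {y. (x, y) \<in> F} = a" if x: "x \<in> X \<union> s ` X'" for x
    proof (cases "x \<in> X")
      case True
      then show ?thesis using 1(7) Fl by simp
    next
      case False
      then obtain u where u: "u \<in> X'" "x = s u" using x by auto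
      have "{y. (x, y) \<in> F} = s ` {v. (u, v) \<in> E'}"
        using Fr[OF u(1)] u(2) by auto
      then show ?thesis
        using bspec[OF 2(7) u(1)] inj(1) by (simp add: card_image)
    qed
    show "card {x. (x, y) \<in> F} = b" if y: "y \<in> Y \<union> s ` Y'" for y
    proof (cases "y \<in> Y")
      case True
      then show ?thesis using 1(8) Fl by simp
    next
      case False
      then obtain u where u: "u \<in> Y'" "y = s u" using y by auto
      have "{x. (x, y) \<in> F} = s ` {v. (v, u) \<in> E'}"
        using Fr'[OF u(1)] u(2) by auto
      then show ?thesis
        using bspec[OF 2(8) u(1)] inj(1) by (simp add: card_image)
    qed
    have "closed_segment x y \<inter> closed_segment x' y' \<subseteq> {x, y} \<inter> {x', y'}"
      if F: "(x, y) \<in> F" "(x', y') \<in> F" and ne: "(x, y) \<noteq> (x', y')" for x y x' y'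
    proof -
      consider "(x, y) \<in> E" "(x', y') \<in> E" | "(x, y) \<in> E" "(x', y') \<in> map_prod s s ` E'"
        | "(x, y) \<in> map_prod s s ` E'" "(x', y') \<in> E" | "(x, y) \<in> map_prod s s ` E'" "(x', y') \<in> map_prod s s ` E'"
        using F by (auto simp: F_def)
      then show ?thesis
      proof cases
        case 1
        then show ?thesis using noncrossingD[OF \<open>noncrossing E\<close>] ne by blast
      next
        case 2
        then obtain u' v' where uv: "(u', v') \<in> E'" "x' = s u'" "y' = s v'" by auto
        show ?thesis using sep[OF 2(1) uv(1)] by (simp add: uv)
      next
        case 3
        then obtain u v where uv: "(u, v) \<in> E'" "x = s u" "y = s v" by auto
        show ?thesis using sep[OF 3(2) uv(1)] by (simp add: uv Int_commute)
      next
        case 4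
        then obtain u v u' v' where uv: "(u, v) \<in> E'" "(u', v') \<in> E'" "x = s u" "y = s v" "x' = s u'" "y' = s v'"
          by auto
        then have "closed_segment u v \<inter> closed_segment u' v' \<subseteq> {u, v} \<inter> {u', v'}"
          using noncrossingD[OF \<open>noncrossing E'\<close> uv(1,2)] ne by auto
        then have "s ` (closed_segment u v \<inter> closed_segment u' v') \<subseteq> s ` ({u, v} \<inter> {u', v'})"
          by (rule image_mono)
        then show ?thesis
          using inj(1)[of UNIV] by (simp add: uv seg image_Int)
      qed
    qed
    then show "noncrossing F"
      unfolding noncrossing_def by blast
  qed
qed

lemma straight_biregular_copies:
  assumes "straight_biregular a p b q" "1 \<le> r"
  shows "straight_biregular a (p * r) b (q * r)"
  using assms(2)
proof (induction r rule: dec_induct)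
  case base
  then show ?case using assms(1) by simp
next
  case (step n)
  then show ?case
    using straight_biregular_union[OF assms(1) step.IH] by simp
qed

section \<open>Drawings of the basic graphs\<close>

definition compatible :: "complex \<times> complex \<Rightarrow> complex \<times> complex \<Rightarrow> bool" where
  "compatible e f \<longleftrightarrow>
     closed_segment (fst e) (snd e) \<inter> closed_segment (fst f) (snd f) \<subseteq> {fst e, snd e} \<inter> {fst f, snd f}"

lemma compatible_sym: "compatible e f \<Longrightarrow> compatible f e"
  unfolding compatible_def by blast

lemma noncrossingI:
  assumes "\<And>e f. e \<in> E \<Longrightarrow> f \<in> E \<Longrightarrow> e \<noteq> f \<Longrightarrow> compatible e f"
  shows "noncrossing E"
  using assms unfolding noncrossing_def compatible_def by fastforce

lemma noncrossing_compatible: "noncrossing E \<Longrightarrow> e \<in> E \<Longrightarrow> f \<in> E \<Longrightarrow> e \<noteq> f \<Longrightarrow> compatible e f"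
  unfolding compatible_def using noncrossingD[of E "fst e" "snd e" "fst f" "snd f"] by simp

lemma noncrossing_Un:
  assumes "noncrossing S" "noncrossing T" "\<And>e f. e \<in> S \<Longrightarrow> f \<in> T \<Longrightarrow> compatible e f"
  shows "noncrossing (S \<union> T)"
  using assms noncrossing_compatible by (intro noncrossingI) (auto intro: compatible_sym)

lemma compatible_separated:
  fixes \<alpha> \<beta> c :: real
  assumes "\<alpha> * Re x + \<beta> * Im x \<le> c" "\<alpha> * Re y + \<beta> * Im y \<le> c"
    "\<alpha> * Re x + \<beta> * Im x < c \<or> \<alpha> * Re y + \<beta> * Im y < c"
    "c \<le> \<alpha> * Re x' + \<beta> * Im x'" "c \<le> \<alpha> * Re y' + \<beta> * Im y'"
    "c < \<alpha> * Re x' + \<beta> * Im x' \<or> c < \<alpha> * Re y' + \<beta> * Im y'"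
  shows "compatible (x, y) (x', y')"
  using segments_separated[OF assms] by (simp add: compatible_def)

lemma compatible_common_snd:
  assumes "orient y x x' \<noteq> 0"
  shows "compatible (x, y) (x', y)"
  using segments_common_end[OF assms] unfolding compatible_def by (simp add: closed_segment_commute) blast

lemma compatible_common_fst:
  assumes "orient x y y' \<noteq> 0"
  shows "compatible (x, y) (x, y')"
  using segments_common_end[OF assms] unfolding compatible_def by auto

lemma noncrossing_fan:
  assumes "\<And>i j. i \<in> I \<Longrightarrow> j \<in> I \<Longrightarrow> i \<noteq> j \<Longrightarrow> orient y (f i) (f j) \<noteq> 0"
  shows "noncrossing ((\<lambda>i. (f i, y)) ` I)"
proof (rule noncrossingI)
  fix d e assume "d \<in> (\<lambda>i. (f i, y)) ` I" "e \<in> (\<lambda>i. (f i, y)) ` I" "d \<noteq> e"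
  then obtain i j where "i \<in> I" "j \<in> I" "d = (f i, y)" "e = (f j, y)" "i \<noteq> j"
    by auto
  then show "compatible d e"
    using assms compatible_common_snd by simp
qed

section \<open>The infinite families\<close>

lemma straight_star: "straight_biregular 1 b b 1"
proof -
  let ?f = "\<lambda>i. Complex (real i) 0" and ?I = "{1..b}"
  have nc: "noncrossing ((\<lambda>i. (?f i, \<i>)) ` ?I)"
    by (rule noncrossing_fan) (simp add: orient_def)
  have inj: "inj_on ?f ?I"
    by (auto simp: inj_on_def)
  show ?thesis
    unfolding straight_biregular_def
  proof (intro exI conjI ballI)
    show "finite (?f ` ?I)" "finite {\<i>}" "?f ` ?I \<inter> {\<i>} = {}" "(\<lambda>i. (?f i, \<i>)) ` ?I \<subseteq> ?f ` ?I \<times> {\<i>}"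
      by (auto simp: complex_eq_iff)
    show "card (?f ` ?I) = b" "card {\<i>} = 1"
      using inj by (auto simp: card_image)
    show "card {y. (x, y) \<in> (\<lambda>i. (?f i, \<i>)) ` ?I} = 1" if "x \<in> ?f ` ?I" for x
    proof -
      have "{y. (x, y) \<in> (\<lambda>i. (?f i, \<i>)) ` ?I} = {\<i>}"
        using that by auto
      then show ?thesis by simp
    qed
    show "card {x. (x, y) \<in> (\<lambda>i. (?f i, \<i>)) ` ?I} = b" if "y \<in> {\<i>}" for y
    proof -
      have "{x. (x, y) \<in> (\<lambda>i. (?f i, \<i>)) ` ?I} = ?f ` ?I"
        using that by auto
      then show ?thesis using inj by (simp add: card_image)
    qed
  qed (rule nc)
qed

lemma straight_two_poles: "straight_biregular 2 b b 2"
proof -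
  let ?f = "\<lambda>i. Complex (real i) 0" and ?I = "{1..b}"
  let ?E = "(\<lambda>i. (?f i, \<i>)) ` ?I \<union> (\<lambda>i. (?f i, - \<i>)) ` ?I"
  have nc: "noncrossing ?E"
  proof (rule noncrossing_Un)
    show "noncrossing ((\<lambda>i. (?f i, \<i>)) ` ?I)" "noncrossing ((\<lambda>i. (?f i, - \<i>)) ` ?I)"
      by (rule noncrossing_fan; simp add: orient_def)+
    fix d e assume d: "d \<in> (\<lambda>i. (?f i, \<i>)) ` ?I" and e: "e \<in> (\<lambda>i. (?f i, - \<i>)) ` ?I"
    \<comment> \<open>The real axis separates the two fans; it meets each edge only in its middle
      vertex.\<close>
    then show "compatible d e"
      by (auto intro!: compatible_separated[where \<alpha> = 0 and \<beta> = "- 1" and c = 0])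
  qed
  have inj: "inj_on ?f ?I"
    by (auto simp: inj_on_def)
  have ne: "\<i> \<noteq> - \<i>"
    by (simp add: complex_eq_iff)
  show ?thesis
    unfolding straight_biregular_def
  proof (intro exI conjI ballI)
    show "finite (?f ` ?I)" "finite {\<i>, - \<i>}" "?f ` ?I \<inter> {\<i>, - \<i>} = {}" "?E \<subseteq> ?f ` ?I \<times> {\<i>, - \<i>}"
      by (auto simp: complex_eq_iff)
    show "card (?f ` ?I) = b" "card {\<i>, - \<i>} = 2"
      using inj ne by (auto simp: card_image)
    show "card {y. (x, y) \<in> ?E} = 2" if "x \<in> ?f ` ?I" for x
    proof -
      have "{y. (x, y) \<in> ?E} = {\<i>, - \<i>}"
        using that by auto
      then show ?thesis using ne by simp
    qed
    show "card {x. (x, y) \<in> ?E} = b" if "y \<in> {\<i>, - \<i>}" for y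
    proof -
      have "{x. (x, y) \<in> ?E} = ?f ` ?I"
        using that ne by auto
      then show ?thesis using inj by (simp add: card_image)
    qed
  qed (rule nc)
qed

text \<open>
  A triangle each of whose edges is replaced by r paths of length two; the poles are i, -i and 1,
  and the middle vertices lie on the rays of direction -1, 1 + i and 1 - i.
\<close>

lemma straight_fat_triangle: "straight_biregular 2 (3 * r) (2 * r) 3"
proof -
  let ?I = "{1..r}"
  let ?l = "\<lambda>i. Complex (- real i) 0" and ?u = "\<lambda>i. Complex (real i) (real i)" and ?d = "\<lambda>i. Complex (real i) (- real i)"
  define LA where "LA = (\<lambda>i. (?l i, \<i>)) ` ?I"
  define LB where "LB = (\<lambda>i. (?l i, - \<i>)) ` ?I"
  define UA where "UA = (\<lambda>i. (?u i, \<i>)) ` ?I"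
  define UC where "UC = (\<lambda>i. (?u i, 1 :: complex)) ` ?I"
  define DB where "DB = (\<lambda>i. (?d i, - \<i>)) ` ?I"
  define DC where "DC = (\<lambda>i. (?d i, 1 :: complex)) ` ?I"
  note defs = LA_def LB_def UA_def UC_def DB_def DC_def
  have fans: "noncrossing LA" "noncrossing LB" "noncrossing UA" "noncrossing UC" "noncrossing DB" "noncrossing DC"
    unfolding defs by (rule noncrossing_fan; simp add: orient_def algebra_simps)+
  \<comment> \<open>The separating lines are the two axes and the two diagonals that carry the
    middle vertices on the right; each meets the edges in question at most in one end.\<close>
  have L: "compatible e f" if "e \<in> LA \<union> LB" "f \<in> UA \<union> UC \<union> DB \<union> DC" for e f
    using that unfolding defs by (auto intro!: compatible_separated[where \<alpha> = 1 and \<beta> = 0 and c = 0])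
  have LL: "compatible e f" if "e \<in> LA" "f \<in> LB" for e f
    using that unfolding defs by (auto intro!: compatible_separated[where \<alpha> = 0 and \<beta> = "- 1" and c = 0])
  have UD: "compatible e f" if "e \<in> UA \<union> UC" "f \<in> DB \<union> DC" for e f
    using that unfolding defs by (auto intro!: compatible_separated[where \<alpha> = 0 and \<beta> = "- 1" and c = 0])
  have UU: "compatible e f" if "e \<in> UA" "f \<in> UC" for e f
    using that unfolding defs by (auto intro!: compatible_separated[where \<alpha> = 1 and \<beta> = "- 1" and c = 0])
  have DD: "compatible e f" if "e \<in> DB" "f \<in> DC" for e f
    using that unfolding defs by (auto intro!: compatible_separated[where \<alpha> = 1 and \<beta> = 1 and c = 0])
  let ?E = "(LA \<union> LB) \<union> ((UA \<union> UC) \<union> (DB \<union> DC))"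
  have nc: "noncrossing ?E"
    using fans L LL UD UU DD by (intro noncrossing_Un) auto
  let ?X = "?l ` ?I \<union> ?u ` ?I \<union> ?d ` ?I" and ?Y = "{\<i>, - \<i>, 1} :: complex set"
  have inj: "inj_on ?l ?I" "inj_on ?u ?I" "inj_on ?d ?I"
    by (auto simp: inj_on_def)
  have disj: "?l ` ?I \<inter> ?u ` ?I = {}" "(?l ` ?I \<union> ?u ` ?I) \<inter> ?d ` ?I = {}" "?l ` ?I \<inter> ?d ` ?I = {}" "?u ` ?I \<inter> ?d ` ?I = {}"
    by auto
  have ne: "\<i> \<noteq> - \<i>" "\<i> \<noteq> 1" "- \<i> \<noteq> 1"
    by (simp_all add: complex_eq_iff)
  show ?thesis
    unfolding straight_biregular_def
  proof (intro exI conjI ballI)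
    show "finite ?X" "finite ?Y" "?X \<inter> ?Y = {}" "?E \<subseteq> ?X \<times> ?Y"
      by (auto simp: complex_eq_iff defs)
    show "card ?X = 3 * r"
      using inj disj by (simp add: card_Un_disjoint card_image)
    show "card ?Y = 3"
      using ne by simp
    show "card {y. (x, y) \<in> ?E} = 2" if x: "x \<in> ?X" for x
    proof -
      from x consider "x \<in> ?l ` ?I" | "x \<in> ?u ` ?I" | "x \<in> ?d ` ?I" by blast
      then show ?thesis
      proof cases
        case 1
        then have "{y. (x, y) \<in> ?E} = {\<i>, - \<i>}"
          by (auto simp: defs)
        then show ?thesis using ne by simp
      next
        case 2
        then have "{y. (x, y) \<in> ?E} = {\<i>, 1}"
          by (auto simp: defs)
        then show ?thesis using ne by simp
      next
        case 3
        then have "{y. (x, y) \<in> ?E} = {- \<i>, 1}"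
          by (auto simp: defs)
        then show ?thesis using ne by simp
      qed
    qed
    show "card {x. (x, y) \<in> ?E} = 2 * r" if y: "y \<in> ?Y" for y
    proof -
      have "y = \<i> \<Longrightarrow> {x. (x, y) \<in> ?E} = ?l ` ?I \<union> ?u ` ?I" "y = - \<i> \<Longrightarrow> {x. (x, y) \<in> ?E} = ?l ` ?I \<union> ?d ` ?I"
        "y = 1 \<Longrightarrow> {x. (x, y) \<in> ?E} = ?u ` ?I \<union> ?d ` ?I"
        using ne by (auto simp: defs)
      then show ?thesis
        using y inj disj by (auto simp: card_Un_disjoint card_image)
    qed
  qed (rule nc)
qed

section \<open>Certificates with integer coordinates\<close>

type_synonym ipoint = "int \<times> int"

definition iorient :: "ipoint \<Rightarrow> ipoint \<Rightarrow> ipoint \<Rightarrow> int" where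
  "iorient p q r = (fst q - fst p) * (snd r - snd p) - (snd q - snd p) * (fst r - fst p)"

definition same_side :: "ipoint \<times> ipoint \<Rightarrow> ipoint \<times> ipoint \<Rightarrow> bool" where
  "same_side e f \<longleftrightarrow> (let s = iorient (fst e) (snd e) (fst f); t = iorient (fst e) (snd e) (snd f)
     in if 0 < s then 0 < t else s < 0 \<and> t < 0)"

text \<open>A sufficient condition that needs only signs of integer determinants, so it can be
  evaluated exactly. Edges with a common end must not be collinear; other edges are separated by the
  line through one of them.\<close>

definition edges_ok :: "ipoint \<times> ipoint \<Rightarrow> ipoint \<times> ipoint \<Rightarrow> bool" where
  "edges_ok e f \<longleftrightarrow>
     (if fst e = fst f then iorient (fst e) (snd e) (snd f) \<noteq> 0
      else if snd e = snd f then iorient (snd e) (fst e) (fst f) \<noteq> 0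
      else same_side e f \<or> same_side f e)"

fun pairwise_ok :: "(ipoint \<times> ipoint) list \<Rightarrow> bool" where
  "pairwise_ok [] \<longleftrightarrow> True"
| "pairwise_ok (e # es) \<longleftrightarrow> list_all (edges_ok e) es \<and> pairwise_ok es"

text \<open>The edge list is the whole certificate: the two classes are read off as its first and
  second components, so every vertex has an edge.\<close>

definition straight_certificate :: "nat \<Rightarrow> nat \<Rightarrow> nat \<Rightarrow> nat \<Rightarrow> (ipoint \<times> ipoint) list \<Rightarrow> bool" where
  "straight_certificate a p b q es \<longleftrightarrow> (let xs = remdups (map fst es); ys = remdups (map snd es) in
     length xs = p \<and> length ys = q \<and> list_all (\<lambda>x. length (filter (\<lambda>e. fst e = x) es) = a) xs \<and>
     list_all (\<lambda>y. length (filter (\<lambda>e. snd e = y) es) = b) ys \<and> list_all (\<lambda>x. list_all (\<lambda>y. x \<noteq> y) ys) xs \<and>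
     pairwise_ok es)"

definition point :: "ipoint \<Rightarrow> complex" where
  "point p = Complex (of_int (fst p)) (of_int (snd p))"

lemma inj_point: "inj point"
  by (auto simp: inj_def point_def prod_eq_iff)

lemma orient_point: "orient (point p) (point q) (point r) = of_int (iorient p q r)"
  by (simp add: orient_def point_def iorient_def)

lemma same_side_disjoint:
  assumes "same_side e f"
  shows "closed_segment (point (fst e)) (point (snd e)) \<inter> closed_segment (point (fst f)) (point (snd f)) = {}"
proof (rule segments_same_side)
  show "0 < orient (point (fst e)) (point (snd e)) (point (fst f)) \<and> 0 < orient (point (fst e)) (point (snd e)) (point (snd f)) \<or>
    orient (point (fst e)) (point (snd e)) (point (fst f)) < 0 \<and> orient (point (fst e)) (point (snd e)) (point (snd f)) < 0"
    using assms unfolding orient_point same_side_def Let_def by (simp split: if_splits)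
qed

lemma edges_ok_compatible:
  assumes "edges_ok e f"
  shows "compatible (map_prod point point e) (map_prod point point f)"
proof -
  obtain x y where e: "e = (x, y)" by (cases e)
  obtain x' y' where f: "f = (x', y')" by (cases f)
  note ef = e f
  show ?thesis
  proof (cases "x = x'")
    case True
    then show ?thesis
      using assms by (auto simp: ef edges_ok_def orient_point intro!: compatible_common_fst)
  next
    case ne: False
    show ?thesis
    proof (cases "y = y'")
      case True
      then show ?thesis
        using assms ne by (auto simp: ef edges_ok_def orient_point intro!: compatible_common_snd)
    next
      case False
      then have "same_side e f \<or> same_side f e"
        using assms ne by (simp add: ef edges_ok_def)
      then show ?thesis
        using same_side_disjoint[of e f] same_side_disjoint[of f e] by (auto simp: ef compatible_def)
    qed
  qed
qed

lemma edges_ok_irrefl: "\<not> edges_ok e e"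
  by (simp add: edges_ok_def iorient_def algebra_simps)

text \<open>An edge is collinear with itself, so a repetition fails the test. Distinctness is what
  turns list lengths into degrees in \<open>certificate_straight\<close>.\<close>

lemma pairwise_ok_distinct: "pairwise_ok es \<Longrightarrow> distinct es"
  by (induction es) (auto simp: list_all_iff edges_ok_irrefl)

lemma pairwise_ok_noncrossing: "pairwise_ok es \<Longrightarrow> noncrossing (map_prod point point ` set es)"
proof (induction es)
  case Nil
  show ?case by (rule noncrossingI) simp
next
  case (Cons e es)
  have "noncrossing ({map_prod point point e} \<union> map_prod point point ` set es)"
  proof (rule noncrossing_Un)
    show "noncrossing {map_prod point point e}" by (rule noncrossingI) simp
    show "noncrossing (map_prod point point ` set es)" using Cons by simp
    fix d f assume d: "d \<in> {map_prod point point e}" and "f \<in> map_prod point point ` set es"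
    then obtain g where "f = map_prod point point g" "g \<in> set es" by (elim imageE)
    then show "compatible d f"
      using d Cons.prems edges_ok_compatible[of e g] by (simp add: list_all_iff)
  qed
  then show ?case by simp
qed

lemma snd_image_filter: "snd ` set (filter (\<lambda>e. fst e = u) es) = {v. (u, v) \<in> set es}"
  by force

lemma fst_image_filter: "fst ` set (filter (\<lambda>e. snd e = u) es) = {v. (v, u) \<in> set es}"
  by force

lemma certificate_straight:
  assumes "straight_certificate a p b q es"
  shows "straight_biregular a p b q"
proof -
  define X where "X = set (map fst es)"
  define Y where "Y = set (map snd es)"
  have c: "length (remdups (map fst es)) = p" "length (remdups (map snd es)) = q"
    "\<And>x. x \<in> X \<Longrightarrow> length (filter (\<lambda>e. fst e = x) es) = a" "\<And>y. y \<in> Y \<Longrightarrow> length (filter (\<lambda>e. snd e = y) es) = b"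
    and ne: "\<forall>x\<in>X. \<forall>y\<in>Y. x \<noteq> y" and ok: "pairwise_ok es"
    using assms unfolding straight_certificate_def Let_def X_def Y_def by (auto simp: list_all_iff)
  have disj: "X \<inter> Y = {}"
    using ne by blast
  have d: "distinct es"
    using ok by (rule pairwise_ok_distinct)
  let ?E = "map_prod point point ` set es"
  have pinj: "point u = point v \<longleftrightarrow> u = v" for u v
    using inj_point by (auto dest: injD)
  have mem: "(x, y) \<in> ?E \<longleftrightarrow> (\<exists>u v. x = point u \<and> y = point v \<and> (u, v) \<in> set es)" for x y
  proof
    assume "(x, y) \<in> ?E"
    then obtain d where "(x, y) = map_prod point point d" "d \<in> set es" by (rule imageE)
    then show "\<exists>u v. x = point u \<and> y = point v \<and> (u, v) \<in> set es"
      by (cases d) auto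
  next
    assume "\<exists>u v. x = point u \<and> y = point v \<and> (u, v) \<in> set es"
    then obtain u v where "x = point u" "y = point v" "(u, v) \<in> set es" by blast
    then show "(x, y) \<in> ?E"
      using imageI[of "(u, v)" "set es" "map_prod point point"] by simp
  qed
  have cp: "card (point ` A) = card A" for A
    using inj_point by (intro card_image) (auto intro: inj_on_subset)
  show ?thesis
    unfolding straight_biregular_def
  proof (intro exI conjI ballI)
    show "finite (point ` X)" "finite (point ` Y)"
      by (auto simp: X_def Y_def)
    show "point ` X \<inter> point ` Y = {}"
      using disj pinj by auto
    show "?E \<subseteq> point ` X \<times> point ` Y"
      by (force simp: X_def Y_def)
    show "card (point ` X) = p" "card (point ` Y) = q"
      using c(1,2) unfolding cp X_def Y_def by (simp_all add: length_remdups_card_conv)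
    show "card {y. (x, y) \<in> ?E} = a" if x: "x \<in> point ` X" for x
    proof -
      obtain u where u: "u \<in> X" "x = point u" using x by auto
      have "{y. (x, y) \<in> ?E} = point ` {v. (u, v) \<in> set es}"
        unfolding u(2) mem pinj by auto
      also have "{v. (u, v) \<in> set es} = snd ` set (filter (\<lambda>e. fst e = u) es)"
        by (rule snd_image_filter[symmetric])
      finally have "{y. (x, y) \<in> ?E} = point ` snd ` set (filter (\<lambda>e. fst e = u) es)" .
      moreover have "card (snd ` set (filter (\<lambda>e. fst e = u) es)) = card (set (filter (\<lambda>e. fst e = u) es))"
        by (intro card_image) (auto simp: inj_on_def prod_eq_iff)
      ultimately show ?thesis
        using c(3)[OF u(1)] d by (simp only: cp distinct_card distinct_filter)
    qed
    show "card {x. (x, y) \<in> ?E} = b" if y: "y \<in> point ` Y" for y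
    proof -
      obtain u where u: "u \<in> Y" "y = point u" using y by auto
      have "{x. (x, y) \<in> ?E} = point ` {v. (v, u) \<in> set es}"
        unfolding u(2) mem pinj by auto
      also have "{v. (v, u) \<in> set es} = fst ` set (filter (\<lambda>e. snd e = u) es)"
        by (rule fst_image_filter[symmetric])
      finally have "{x. (x, y) \<in> ?E} = point ` fst ` set (filter (\<lambda>e. snd e = u) es)" .
      moreover have "card (fst ` set (filter (\<lambda>e. snd e = u) es)) = card (set (filter (\<lambda>e. snd e = u) es))"
        by (intro card_image) (auto simp: inj_on_def prod_eq_iff)
      ultimately show ?thesis
        using c(4)[OF u(1)] d by (simp only: cp distinct_card distinct_filter)
    qed
  qed (rule pairwise_ok_noncrossing[OF ok])
qed

section \<open>The ten fixed drawings\<close>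

lemma straight_3_4_3_4: "straight_biregular 3 4 3 4"
proof (rule certificate_straight)
  \<comment> \<open>The graph of the cube: a tetrahedron with a vertex of degree 3 in each of its
    faces.\<close>
  show "straight_certificate 3 4 3 4
    [((4, 0), (1, 1)), ((4, 0), (4, 5)), ((4, 0), (3, 2)), ((2, 2), (1, 1)), ((2, 2), (3, 2)), ((2, 2), (2,
     4)), ((1, 4), (1, 1)), ((1, 4), (2, 4)), ((1, 4), (4, 5)), ((3, 3), (4, 5)), ((3, 3), (2, 4)), ((3, 3),
     (3, 2))]"
    by code_simp
qed

text \<open>The hexagonal prism, obtained from an octahedron in which two opposite faces are left
  empty.\<close>

lemma straight_3_6_3_6: "straight_biregular 3 6 3 6"
proof (rule certificate_straight)
  show "straight_certificate 3 6 3 6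
    [((3, 2), (3, 5)), ((3, 2), (5, 2)), ((3, 2), (0, 0)), ((5, 1), (5, 2)), ((5, 1), (10, 1)), ((5, 1), (0,
     0)), ((7, 6), (4, 9)), ((7, 6), (10, 1)), ((7, 6), (6, 5)), ((2, 5), (3, 5)), ((2, 5), (0, 0)), ((2, 5),
     (4, 9)), ((4, 6), (6, 5)), ((4, 6), (3, 5)), ((4, 6), (4, 9)), ((7, 3), (10, 1)), ((7, 3), (5, 2)), ((7,
     3), (6, 5))]"
    by code_simp
qed

lemma straight_3_7_3_7: "straight_biregular 3 7 3 7"
proof (rule certificate_straight)
  show "straight_certificate 3 7 3 7
    [((7, 1), (6, 3)), ((7, 1), (12, 3)), ((7, 1), (0, 1)), ((9, 8), (9, 7)), ((9, 8), (5, 12)), ((9, 8),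
     (12, 3)), ((10, 4), (12, 3)), ((10, 4), (6, 3)), ((10, 4), (9, 7)), ((3, 7), (5, 12)), ((3, 7), (3, 6)),
     ((3, 7), (0, 1)), ((2, 4), (0, 1)), ((2, 4), (3, 6)), ((2, 4), (4, 6)), ((5, 9), (4, 6)), ((5, 9), (3,
     6)), ((5, 9), (5, 12)), ((7, 5), (4, 6)), ((7, 5), (9, 7)), ((7, 5), (6, 3))]"
    by code_simp
qed

lemma straight_3_9_3_9: "straight_biregular 3 9 3 9"
proof (rule certificate_straight)
  show "straight_certificate 3 9 3 9
    [((21, 15), (18, 18)), ((21, 15), (21, 16)), ((21, 15), (22, 13)), ((16, 4), (31, 4)), ((16, 4), (1, 1)),
     ((16, 4), (16, 8)), ((25, 11), (31, 4)), ((25, 11), (22, 13)), ((25, 11), (21, 16)), ((10, 7), (12, 13)),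
     ((10, 7), (16, 8)), ((10, 7), (1, 1)), ((8, 14), (12, 29)), ((8, 14), (12, 13)), ((8, 14), (1, 1)), ((22,
     16), (21, 16)), ((22, 16), (12, 29)), ((22, 16), (31, 4)), ((20, 15), (22, 13)), ((20, 15), (18, 14)),
     ((20, 15), (18, 18)), ((17, 20), (12, 29)), ((17, 20), (18, 18)), ((17, 20), (18, 14)), ((15, 11), (18,
     14)), ((15, 11), (16, 8)), ((15, 11), (12, 13))]"
    by code_simp
qed

text \<open>The rhombic dodecahedron: all eight faces of the octahedron receive a vertex.\<close>

lemma straight_3_8_4_6: "straight_biregular 3 8 4 6"
proof (rule certificate_straight)
  show "straight_certificate 3 8 4 6
    [((9, 0), (0, 1)), ((9, 0), (9, 8)), ((9, 0), (6, 2)), ((7, 6), (9, 8)), ((7, 6), (6, 6)), ((7, 6), (6,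
     2)), ((4, 5), (4, 4)), ((4, 5), (6, 6)), ((4, 5), (3, 6)), ((3, 2), (0, 1)), ((3, 2), (6, 2)), ((3, 2),
     (4, 4)), ((5, 4), (6, 2)), ((5, 4), (6, 6)), ((5, 4), (4, 4)), ((1, 3), (3, 6)), ((1, 3), (0, 1)), ((1,
     3), (4, 4)), ((5, 7), (6, 6)), ((5, 7), (9, 8)), ((5, 7), (3, 6)), ((1, 9), (9, 8)), ((1, 9), (0, 1)),
     ((1, 9), (3, 6))]"
    by code_simp
qed

lemma straight_3_12_4_9: "straight_biregular 3 12 4 9"
proof (rule certificate_straight)
  show "straight_certificate 3 12 4 9
    [((4, 11), (8, 21)), ((4, 11), (6, 11)), ((4, 11), (1, 0)), ((16, 12), (15, 12)), ((16, 12), (8, 21)),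
     ((16, 12), (23, 3)), ((13, 11), (10, 13)), ((13, 11), (15, 12)), ((13, 11), (15, 7)), ((6, 2), (11, 3)),
     ((6, 2), (1, 0)), ((6, 2), (7, 6)), ((8, 16), (8, 21)), ((8, 16), (10, 13)), ((8, 16), (6, 11)), ((12,
     2), (23, 3)), ((12, 2), (1, 0)), ((12, 2), (11, 3)), ((17, 4), (11, 3)), ((17, 4), (15, 7)), ((17, 4),
     (23, 3)), ((4, 5), (6, 11)), ((4, 5), (7, 6)), ((4, 5), (1, 0)), ((19, 7), (23, 3)), ((19, 7), (15, 7)),
     ((19, 7), (15, 12)), ((11, 6), (7, 6)), ((11, 6), (15, 7)), ((11, 6), (11, 3)), ((11, 16), (8, 21)),
     ((11, 16), (15, 12)), ((11, 16), (10, 13)), ((8, 9), (10, 13)), ((8, 9), (7, 6)), ((8, 9), (6, 11))]"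
    by code_simp
qed

text \<open>The rhombic triacontahedron: all twenty faces of the icosahedron receive a vertex. Here
  m = 2n - 4 holds with equality.\<close>

lemma straight_3_20_5_12: "straight_biregular 3 20 5 12"
proof (rule certificate_straight)
  show "straight_certificate 3 20 5 12
    [((37, 1), (1, 1)), ((37, 1), (37, 37)), ((37, 1), (27, 10)), ((20, 18), (21, 22)), ((20, 18), (16, 16)),
     ((20, 18), (22, 15)), ((10, 20), (9, 14)), ((10, 20), (15, 22)), ((10, 20), (10, 28)), ((32, 31), (37,
     37)), ((32, 31), (25, 29)), ((32, 31), (29, 25)), ((12, 17), (16, 16)), ((12, 17), (15, 22)), ((12, 17),
     (9, 14)), ((28, 17), (29, 25)), ((28, 17), (22, 15)), ((28, 17), (27, 10)), ((25, 25), (25, 29)), ((25,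
     25), (21, 22)), ((25, 25), (29, 25)), ((1, 37), (37, 37)), ((1, 37), (1, 1)), ((1, 37), (10, 28)), ((24,
     32), (10, 28)), ((24, 32), (25, 29)), ((24, 32), (37, 37)), ((26, 21), (22, 15)), ((26, 21), (29, 25)),
     ((26, 21), (21, 22)), ((20, 11), (27, 10)), ((20, 11), (22, 15)), ((20, 11), (14, 9)), ((13, 12), (16,
     16)), ((13, 12), (9, 14)), ((13, 12), (14, 9)), ((17, 28), (25, 29)), ((17, 28), (10, 28)), ((17, 28),
     (15, 22)), ((5, 14), (10, 28)), ((5, 14), (1, 1)), ((5, 14), (9, 14)), ((6, 6), (1, 1)), ((6, 6), (14,
     9)), ((6, 6), (9, 14)), ((17, 13), (14, 9)), ((17, 13), (22, 15)), ((17, 13), (16, 16)), ((32, 24), (29,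
     25)), ((32, 24), (27, 10)), ((32, 24), (37, 37)), ((20, 26), (15, 22)), ((20, 26), (21, 22)), ((20, 26),
     (25, 29)), ((18, 20), (21, 22)), ((18, 20), (15, 22)), ((18, 20), (16, 16)), ((14, 5), (27, 10)), ((14,
     5), (14, 9)), ((14, 5), (1, 1))]"
    by code_simp
qed

lemma straight_3_30_5_18: "straight_biregular 3 30 5 18"
proof (rule certificate_straight)
  show "straight_certificate 3 30 5 18
    [((11, 27), (22, 53)), ((11, 27), (15, 25)), ((11, 27), (0, 0)), ((16, 21), (20, 23)), ((16, 21), (14,
     14)), ((16, 21), (15, 25)), ((39, 29), (57, 7)), ((39, 29), (36, 28)), ((39, 29), (22, 53)), ((10, 8),
     (14, 14)), ((10, 8), (18, 10)), ((10, 8), (0, 0)), ((18, 18), (14, 14)), ((18, 18), (20, 23)), ((18, 18),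
     (23, 18)), ((36, 23), (36, 28)), ((36, 23), (40, 18)), ((36, 23), (32, 25)), ((22, 13), (23, 18)), ((22,
     13), (28, 13)), ((22, 13), (18, 10)), ((9, 13), (0, 0)), ((9, 13), (15, 25)), ((9, 13), (14, 14)), ((42,
     9), (28, 8)), ((42, 9), (38, 12)), ((42, 9), (57, 7)), ((25, 31), (27, 34)), ((25, 31), (26, 25)), ((25,
     31), (22, 33)), ((45, 17), (57, 7)), ((45, 17), (40, 18)), ((45, 17), (36, 28)), ((29, 23), (26, 25)),
     ((29, 23), (32, 25)), ((29, 23), (31, 18)), ((25, 10), (28, 8)), ((25, 10), (18, 10)), ((25, 10), (28,
     13)), ((28, 40), (27, 34)), ((28, 40), (22, 53)), ((28, 40), (36, 28)), ((35, 20), (40, 18)), ((35, 20),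
     (31, 18)), ((35, 20), (32, 25)), ((19, 38), (22, 33)), ((19, 38), (15, 25)), ((19, 38), (22, 53)), ((32,
     14), (28, 13)), ((32, 14), (31, 18)), ((32, 14), (38, 12)), ((28, 28), (26, 25)), ((28, 28), (27, 34)),
     ((28, 28), (32, 25)), ((23, 22), (26, 25)), ((23, 22), (23, 18)), ((23, 22), (20, 23)), ((28, 4), (57,
     7)), ((28, 4), (0, 0)), ((28, 4), (28, 8)), ((32, 29), (36, 28)), ((32, 29), (32, 25)), ((32, 29), (27,
     34)), ((46, 12), (40, 18)), ((46, 12), (57, 7)), ((46, 12), (38, 12)), ((27, 17), (31, 18)), ((27, 17),
     (28, 13)), ((27, 17), (23, 18)), ((22, 27), (20, 23)), ((22, 27), (22, 33)), ((22, 27), (26, 25)), ((36,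
     16), (38, 12)), ((36, 16), (31, 18)), ((36, 16), (40, 18)), ((23, 41), (22, 53)), ((23, 41), (27, 34)),
     ((23, 41), (22, 33)), ((18, 27), (15, 25)), ((18, 27), (22, 33)), ((18, 27), (20, 23)), ((18, 14), (18,
     10)), ((18, 14), (14, 14)), ((18, 14), (23, 18)), ((31, 11), (38, 12)), ((31, 11), (28, 8)), ((31, 11),
     (28, 13)), ((15, 5), (0, 0)), ((15, 5), (18, 10)), ((15, 5), (28, 8))]"
    by code_simp
qed

lemma straight_3_35_5_21: "straight_biregular 3 35 5 21"
proof (rule certificate_straight)
  show "straight_certificate 3 35 5 21
    [((30, 14), (40, 10)), ((30, 14), (19, 11)), ((30, 14), (31, 22)), ((40, 45), (43, 38)), ((40, 45), (36,
     38)), ((40, 45), (39, 54)), ((15, 28), (21, 34)), ((15, 28), (12, 18)), ((15, 28), (16, 38)), ((27, 28),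
     (31, 22)), ((27, 28), (21, 24)), ((27, 28), (28, 36)), ((47, 30), (44, 24)), ((47, 30), (43, 38)), ((47,
     30), (53, 28)), ((41, 32), (36, 38)), ((41, 32), (43, 38)), ((41, 32), (44, 24)), ((9, 19), (0, 1)), ((9,
     19), (16, 38)), ((9, 19), (12, 18)), ((24, 31), (28, 36)), ((24, 31), (21, 24)), ((24, 31), (21, 34)),
     ((22, 44), (16, 38)), ((22, 44), (28, 52)), ((22, 44), (21, 34)), ((60, 12), (40, 10)), ((60, 12), (60,
     17)), ((60, 12), (80, 12)), ((44, 46), (39, 54)), ((44, 46), (51, 39)), ((44, 46), (43, 38)), ((70, 17),
     (64, 25)), ((70, 17), (80, 12)), ((70, 17), (60, 17)), ((17, 26), (12, 18)), ((17, 26), (21, 34)), ((17,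
     26), (21, 24)), ((32, 32), (36, 38)), ((32, 32), (31, 22)), ((32, 32), (28, 36)), ((52, 22), (53, 28)),
     ((52, 22), (60, 17)), ((52, 22), (44, 24)), ((37, 29), (31, 22)), ((37, 29), (36, 38)), ((37, 29), (44,
     24)), ((41, 59), (30, 75)), ((41, 59), (54, 42)), ((41, 59), (39, 54)), ((58, 23), (60, 17)), ((58, 23),
     (53, 28)), ((58, 23), (64, 25)), ((30, 44), (36, 38)), ((30, 44), (28, 36)), ((30, 44), (28, 52)), ((24,
     57), (16, 38)), ((24, 57), (30, 75)), ((24, 57), (28, 52)), ((46, 46), (54, 42)), ((46, 46), (51, 39)),
     ((46, 46), (39, 54)), ((68, 26), (80, 12)), ((68, 26), (64, 25)), ((68, 26), (54, 42)), ((9, 9), (19,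
     11)), ((9, 9), (0, 1)), ((9, 9), (12, 18)), ((40, 7), (0, 1)), ((40, 7), (40, 10)), ((40, 7), (80, 12)),
     ((24, 18), (21, 24)), ((24, 18), (31, 22)), ((24, 18), (19, 11)), ((25, 43), (21, 34)), ((25, 43), (28,
     52)), ((25, 43), (28, 36)), ((49, 34), (53, 28)), ((49, 34), (43, 38)), ((49, 34), (51, 39)), ((49, 16),
     (44, 24)), ((49, 16), (60, 17)), ((49, 16), (40, 10)), ((55, 43), (54, 42)), ((55, 43), (30, 75)), ((55,
     43), (80, 12)), ((58, 34), (51, 39)), ((58, 34), (54, 42)), ((58, 34), (64, 25)), ((15, 39), (30, 75)),
     ((15, 39), (16, 38)), ((15, 39), (0, 1)), ((20, 5), (19, 11)), ((20, 5), (40, 10)), ((20, 5), (0, 1)),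
     ((57, 31), (64, 25)), ((57, 31), (53, 28)), ((57, 31), (51, 39)), ((32, 63), (39, 54)), ((32, 63), (28,
     52)), ((32, 63), (30, 75)), ((18, 18), (12, 18)), ((18, 18), (21, 24)), ((18, 18), (19, 11))]"
    by code_simp
qed

lemma straight_3_45_5_27: "straight_biregular 3 45 5 27"
proof (rule certificate_straight)
  show "straight_certificate 3 45 5 27
    [((53, 32), (49, 31)), ((53, 32), (50, 35)), ((53, 32), (58, 32)), ((42, 79), (32, 52)), ((42, 79), (45,
     113)), ((42, 79), (49, 67)), ((47, 31), (44, 30)), ((47, 31), (45, 33)), ((47, 31), (49, 31)), ((25, 55),
     (45, 113)), ((25, 55), (32, 52)), ((25, 55), (1, 1)), ((47, 40), (52, 39)), ((47, 40), (46, 37)), ((47,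
     40), (43, 44)), ((60, 85), (78, 61)), ((60, 85), (60, 74)), ((60, 85), (45, 113)), ((29, 11), (33, 17)),
     ((29, 11), (57, 18)), ((29, 11), (1, 1)), ((48, 33), (50, 35)), ((48, 33), (49, 31)), ((48, 33), (45,
     33)), ((43, 27), (38, 26)), ((43, 27), (44, 30)), ((43, 27), (46, 25)), ((66, 64), (73, 56)), ((66, 64),
     (63, 58)), ((66, 64), (60, 74)), ((43, 39), (46, 37)), ((43, 39), (40, 33)), ((43, 39), (43, 44)), ((44,
     35), (40, 33)), ((44, 35), (46, 37)), ((44, 35), (45, 33)), ((42, 55), (43, 44)), ((42, 55), (32, 52)),
     ((42, 55), (49, 67)), ((51, 87), (45, 113)), ((51, 87), (60, 74)), ((51, 87), (49, 67)), ((57, 39), (58,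
     32)), ((57, 39), (52, 39)), ((57, 39), (59, 45)), ((58, 66), (49, 67)), ((58, 66), (60, 74)), ((58, 66),
     (63, 58)), ((69, 53), (72, 46)), ((69, 53), (63, 58)), ((69, 53), (73, 56)), ((47, 29), (44, 30)), ((47,
     29), (49, 31)), ((47, 29), (46, 25)), ((51, 29), (58, 32)), ((51, 29), (46, 25)), ((51, 29), (49, 31)),
     ((33, 24), (38, 26)), ((33, 24), (33, 17)), ((33, 24), (29, 28)), ((79, 40), (87, 40)), ((79, 40), (78,
     32)), ((79, 40), (72, 46)), ((70, 41), (59, 45)), ((70, 41), (72, 46)), ((70, 41), (78, 32)), ((57, 57),
     (59, 45)), ((57, 57), (49, 67)), ((57, 57), (63, 58)), ((78, 47), (72, 46)), ((78, 47), (73, 56)), ((78,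
     47), (87, 40)), ((46, 21), (57, 18)), ((46, 21), (33, 17)), ((46, 21), (46, 25)), ((48, 34), (45, 33)),
     ((48, 34), (46, 37)), ((48, 34), (50, 35)), ((88, 21), (121, 16)), ((88, 21), (57, 18)), ((88, 21), (78,
     32)), ((82, 63), (45, 113)), ((82, 63), (121, 16)), ((82, 63), (78, 61)), ((39, 23), (33, 17)), ((39,
     23), (38, 26)), ((39, 23), (46, 25)), ((35, 29), (40, 33)), ((35, 29), (38, 26)), ((35, 29), (29, 28)),
     ((70, 64), (60, 74)), ((70, 64), (78, 61)), ((70, 64), (73, 56)), ((80, 52), (78, 61)), ((80, 52), (87,
     40)), ((80, 52), (73, 56)), ((53, 35), (58, 32)), ((53, 35), (50, 35)), ((53, 35), (52, 39)), ((52, 43),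
     (52, 39)), ((52, 43), (43, 44)), ((52, 43), (59, 45)), ((20, 26), (29, 28)), ((20, 26), (1, 1)), ((20,
     26), (32, 52)), ((34, 41), (32, 52)), ((34, 41), (43, 44)), ((34, 41), (29, 28)), ((50, 37), (46, 37)),
     ((50, 37), (52, 39)), ((50, 37), (50, 35)), ((65, 49), (63, 58)), ((65, 49), (72, 46)), ((65, 49), (59,
     45)), ((41, 30), (44, 30)), ((41, 30), (38, 26)), ((41, 30), (40, 33)), ((66, 28), (58, 32)), ((66, 28),
     (78, 32)), ((66, 28), (57, 18)), ((19, 14), (1, 1)), ((19, 14), (29, 28)), ((19, 14), (33, 17)), ((97,
     38), (87, 40)), ((97, 38), (78, 61)), ((97, 38), (121, 16)), ((43, 32), (40, 33)), ((43, 32), (45, 33)),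
     ((43, 32), (44, 30)), ((97, 29), (78, 32)), ((97, 29), (87, 40)), ((97, 29), (121, 16)), ((61, 10), (1,
     1)), ((61, 10), (57, 18)), ((61, 10), (121, 16))]"
    by code_simp
qed

section \<open>Classification\<close>

lemma bipartition_edge_count:
  assumes "bipartition X Y E" "finite X" "finite E" "\<And>x. x \<in> X \<Longrightarrow> vertex_degree E x = a"
  shows "card E = a * card X"
proof -
  have XY: "X \<inter> Y = {}" and ends: "\<forall>e\<in>E. \<exists>x\<in>X. \<exists>y\<in>Y. e = {x, y}"
    using assms(1) by (simp_all add: bipartition_def)
  have "E = (\<Union>x\<in>X. {e \<in> E. x \<in> e})"
    using ends by auto
  also have "card \<dots> = (\<Sum>x\<in>X. card {e \<in> E. x \<in> e})"
  proof (rule card_UN_disjoint)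
    show "\<forall>x\<in>X. \<forall>x'\<in>X. x \<noteq> x' \<longrightarrow> {e \<in> E. x \<in> e} \<inter> {e \<in> E. x' \<in> e} = {}"
    proof (intro ballI impI)
      fix x x' assume x: "x \<in> X" "x' \<in> X" "x \<noteq> x'"
      have False if "e \<in> E" "x \<in> e" "x' \<in> e" for e
      proof -
        obtain u v where "u \<in> X" "v \<in> Y" "e = {u, v}"
          using ends \<open>e \<in> E\<close> by meson
        then show False using x that XY by auto
      qed
      then show "{e \<in> E. x \<in> e} \<inter> {e \<in> E. x' \<in> e} = {}" by blast
    qed
  qed (use assms in auto)
  also have "\<dots> = (\<Sum>x\<in>X. a)"
    using assms(4) by (intro sum.cong) (auto simp: vertex_degree_def)
  finally show ?thesis by simp
qed

lemma bipartition_commute: "bipartition X Y E \<Longrightarrow> bipartition Y X E"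
  unfolding bipartition_def by (metis Int_commute insert_commute)

lemma planar_graphic_eulerian:
  assumes "planar_graphic a p b q" "1 \<le> p"
  shows "eulerian_pair a p b q" "(a, p, b, q) \<noteq> (3, 5, 3, 5)" "(a, p, b, q) \<noteq> (3, 25, 5, 15)"
proof -
  obtain X Y :: "nat set" and E where pl: "planar_graph (X \<union> Y) E" and bp: "bipartition X Y E"
    and card: "card X = p" "card Y = q"
    and degX: "\<forall>x\<in>X. vertex_degree E x = a" and degY: "\<forall>y\<in>Y. vertex_degree E y = b"
    using assms(1) unfolding planar_graphic_def by (elim exE conjE)
  obtain pos \<gamma> where pg: "plane_graph (X \<union> Y) E pos \<gamma>"
    using pl by (auto simp: planar_graph_def plane_graph_def)
  interpret plane_graph "X \<union> Y" E pos \<gamma> by (rule pg)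
  have fin: "finite X" "finite Y"
    using finite_V by auto
  have XY: "X \<inter> Y = {}"
    using bp by (simp add: bipartition_def)
  have m: "card E = a * p" "card E = b * q"
    using bipartition_edge_count[OF bp fin(1) finite_E] bipartition_edge_count[OF bipartition_commute[OF bp] fin(2) finite_E]
      degX degY card by auto
  have n: "card (X \<union> Y) = p + q"
    using fin XY card by (simp add: card_Un_disjoint)
  have bip: "bip X E"
    by (rule bipartition_bip[OF bp])
  \<comment> \<open>The neighbours of a vertex of X are distinct vertices of Y, and p >= 1 provides
    such a vertex.\<close>
  have "a \<le> q"
  proof -
    obtain x where x: "x \<in> X"
      using card(1) assms(2) by fastforce
    have "{w. {x, w} \<in> E} \<subseteq> Y"
    proof
      fix w assume w: "w \<in> {w. {x, w} \<in> E}"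
      then have "w \<notin> X"
        using bip x by (simp add: bip_def)
      moreover have "w \<in> X \<union> Y"
        using darts_verts(2)[of x w] w by (simp add: darts_def)
      ultimately show "w \<in> Y" by simp
    qed
    then have "card {w. {x, w} \<in> E} \<le> card Y"
      using fin(2) by (rule card_mono[rotated])
    then show ?thesis
      using card_neighbours[OF simple, of x] degX x card by simp
  qed
  moreover have "a * p \<le> 2 * (p + q) - 4" if "3 \<le> p + q"
    using plane_bipartite_edges[OF pg bip] that n m by simp
  ultimately show "eulerian_pair a p b q"
    using m by (simp add: eulerian_pair_def)
  \<comment> \<open>Both pairs satisfy m = 2n - 5: 15 = 2 * 10 - 5 and 75 = 2 * 40 - 5.\<close>
  have exc: False if "a = 3" "b = 3 \<or> b = 5" "card E + 5 = 2 * (p + q)" "3 \<le> p + q"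
    using exceptional_not_planar[OF pg bp, of b] degX degY that n by simp
  show "(a, p, b, q) \<noteq> (3, 5, 3, 5)" "(a, p, b, q) \<noteq> (3, 25, 5, 15)"
    using exc m by auto
qed

text \<open>If a >= 4, then 4 (p + q) <= a p + b q = 2m, against m <= 2 (p + q) - 4. For a = 3 the
  relation 3 p = b q turns Euler's inequality into (6 - b) q >= 12, which bounds b by 5 and yields
  the lower bounds on p and r. For a <= 2 only the parity of q matters.\<close>

lemma eulerian_pair_cases:
  assumes "1 \<le> a" "a \<le> b" "1 \<le> p" "1 \<le> q" "eulerian_pair a p b q"
  obtains "a = 1" "p = b * q"
    | r where "1 \<le> r" "a = 2" "p = b * r" "q = 2 * r"
    | r where "1 \<le> r" "3 \<le> q" "odd q" "a = 2" "p = q * r" "b = 2 * r"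
    | "a = 3" "b = 3" "p = q" "4 \<le> p"
    | r where "2 \<le> r" "a = 3" "b = 4" "p = 4 * r" "q = 3 * r"
    | r where "4 \<le> r" "a = 3" "b = 5" "p = 5 * r" "q = 3 * r"
proof -
  have m: "a * p = b * q" and aq: "a \<le> q" and eul: "3 \<le> p + q \<Longrightarrow> a * p \<le> 2 * (p + q) - 4"
    using assms(5) by (auto simp: eulerian_pair_def)
  consider "a = 1" | "a = 2" "even q" | "a = 2" "odd q" | "3 \<le> a"
    using assms(1) by linarith
  then show thesis
  proof cases
    case 1
    then show thesis using that(1) m by simp
  next
    case 2
    then obtain r where "q = 2 * r" by (auto elim: evenE)
    then show thesis using that(2)[of r] m 2 assms(4) by auto
  next
    case 3
    have "even (b * q)" using m 3(1) by (metis dvd_triv_left)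
    then obtain r where "b = 2 * r" using 3(2) by (auto elim: evenE)
    \<comment> \<open>q is at least a = 2, and odd.\<close>
    moreover have "3 \<le> q"
      using aq 3 by (cases "q = 2") auto
    ultimately show thesis using that(3)[of r] m 3 assms(2) by auto
  next
    case 4
    have "3 \<le> p + q"
      using aq 4 assms(3) by simp
    then have e: "a * p + 4 \<le> 2 * p + 2 * q"
      using eul by (simp add: le_diff_conv2)
    have "a = 3"
    proof (rule ccontr)
      assume "a \<noteq> 3"
      then have "4 * p \<le> a * p" "4 * q \<le> b * q"
        using 4 assms(2) by (auto intro: mult_le_mono1)
      then show False using e m by linarith
    qed
    then have e3: "b * q + 12 \<le> 6 * q" and m3: "3 * p = b * q"
      using e m by simp_all
    have "b < 6"
    proof (rule ccontr)
      assume "\<not> b < 6"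
      then have "6 * q \<le> b * q" by (intro mult_le_mono1) simp
      then show False using e3 by linarith
    qed
    then consider "b = 3" | "b = 4" | "b = 5"
      using assms(2) \<open>a = 3\<close> by linarith
    then show thesis
    proof cases
      case 1
      then show thesis using that(4) \<open>a = 3\<close> e3 m3 by auto
    next
      case 2
      then have "3 dvd q" using m3 by presburger
      then obtain r where "q = 3 * r" ..
      then show thesis using that(5)[of r] \<open>a = 3\<close> e3 m3 2 by auto
    next
      case 3
      then have "3 dvd q" using m3 by presburger
      then obtain r where "q = 3 * r" ..
      then show thesis using that(6)[of r] \<open>a = 3\<close> e3 m3 3 by auto
    qed
  qed
qed

text \<open>Euler's inequality amounts to 4 <= b q + 2 q. This is clear for q >= 2, and for q = 1 it
  follows from p + q >= 3.\<close>

lemma eulerian_star: "1 \<le> b \<Longrightarrow> 1 \<le> q \<Longrightarrow> eulerian_pair 1 (b * q) b q"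
proof -
  assume b: "1 \<le> b" and q: "1 \<le> q"
  have "4 \<le> b * q + 2 * q" if "3 \<le> b * q + q"
  proof (cases "q = 1")
    case False
    moreover have "1 * q \<le> b * q" using b by (rule mult_le_mono1)
    ultimately show ?thesis using q by linarith
  qed (use that in auto)
  then show ?thesis using q by (auto simp: eulerian_pair_def)
qed

lemma eulerian_even: "1 \<le> r \<Longrightarrow> eulerian_pair 2 (b * r) b (2 * r)"
  by (auto simp: eulerian_pair_def)

lemma eulerian_odd: "3 \<le> q \<Longrightarrow> eulerian_pair 2 (q * r) (2 * r) q"
  by (auto simp: eulerian_pair_def)

lemma eulerian_cubic: "4 \<le> p \<Longrightarrow> eulerian_pair 3 p 3 p"
  "2 \<le> r \<Longrightarrow> eulerian_pair 3 (4 * r) 4 (3 * r)" "4 \<le> r \<Longrightarrow> eulerian_pair 3 (5 * r) 5 (3 * r)"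
  by (auto simp: eulerian_pair_def)

text \<open>8 is 4 + 4, and from 10 on n - 4 is again at least 6. The generator 9 is there because 9
  - 4 is the gap 5.\<close>

lemma semigroup_4_6_7_9:
  assumes "P 4" "P 6" "P 7" "P 9" "\<And>m n. P m \<Longrightarrow> P n \<Longrightarrow> P (m + n)" "4 \<le> n" "n \<noteq> (5::nat)"
  shows "P n"
  using assms(6,7)
proof (induction n rule: less_induct)
  case (less n)
  show ?case
  proof (cases "n < 8 \<or> n = 9")
    case True
    then have "n = 4 \<or> n = 6 \<or> n = 7 \<or> n = 9"
      using less.prems by linarith
    then show ?thesis using assms(1-4) by auto
  next
    case False
    then have "P (n - 4)"
      using less by auto
    then have "P (n - 4 + 4)"
      using assms(1,5) by blast
    then show ?thesis using False by simp
  qed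
qed

lemma straight_cubic: "4 \<le> p \<Longrightarrow> p \<noteq> 5 \<Longrightarrow> straight_biregular 3 p 3 p"
  using straight_3_4_3_4 straight_3_6_3_6 straight_3_7_3_7 straight_3_9_3_9 straight_biregular_union
  by (rule semigroup_4_6_7_9)

lemma straight_3_5: "4 \<le> r \<Longrightarrow> r \<noteq> 5 \<Longrightarrow> straight_biregular 3 (5 * r) 5 (3 * r)"
proof (rule semigroup_4_6_7_9[of "\<lambda>r. straight_biregular 3 (5 * r) 5 (3 * r)"])
  show "straight_biregular 3 (5 * (m + n)) 5 (3 * (m + n))"
    if "straight_biregular 3 (5 * m) 5 (3 * m)" "straight_biregular 3 (5 * n) 5 (3 * n)" for m n
    using straight_biregular_union[OF that] by (simp add: algebra_simps)
qed (use straight_3_20_5_12 straight_3_30_5_18 straight_3_35_5_21 straight_3_45_5_27 in simp_all)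

text \<open>Disjoint unions generate all r >= 2 from the drawings for 2 and 3.\<close>

lemma straight_3_4: "2 \<le> r \<Longrightarrow> straight_biregular 3 (4 * r) 4 (3 * r)"
proof (induction r rule: less_induct)
  case (less r)
  show ?case
  proof (cases "r < 4")
    case True
    then have "r = 2 \<or> r = 3" using less.prems by linarith
    then show ?thesis using straight_3_8_4_6 straight_3_12_4_9 by auto
  next
    case False
    then have "straight_biregular 3 (4 * (r - 2)) 4 (3 * (r - 2))"
      using less by auto
    from straight_biregular_union[OF this straight_3_8_4_6] show ?thesis
      using False by (simp add: algebra_simps)
  qed
qed

text \<open>A copy of K_{2,2r} contributes two vertices to the second class, so a single fat
  triangle, which contributes three, corrects the parity.\<close>

lemma straight_odd:
  assumes "3 \<le> q" "odd q"
  shows "straight_biregular 2 (q * r) (2 * r) q"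
proof -
  obtain m where "q = 2 * m + 1"
    using assms(2) by (auto elim: oddE)
  moreover define k where "k = m - 1"
  ultimately have k: "q = 3 + 2 * k"
    using assms(1) by simp
  show ?thesis
  proof (cases "k = 0")
    case True
    then show ?thesis using straight_fat_triangle[of r] k by simp
  next
    case False
    then have "straight_biregular 2 (2 * r * k) (2 * r) (2 * k)"
      using straight_biregular_copies[OF straight_two_poles] by simp
    from straight_biregular_union[OF straight_fat_triangle this] show ?thesis
      using k by (simp add: algebra_simps)
  qed
qed

lemma eulerian_planar_graphic:
  assumes "1 \<le> a" "a \<le> b" "1 \<le> p" "1 \<le> q" "eulerian_pair a p b q"
    "(a, p, b, q) \<noteq> (3, 5, 3, 5)" "(a, p, b, q) \<noteq> (3, 25, 5, 15)"
  shows "planar_graphic a p b q"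
proof (rule straight_planar_graphic)
  show "straight_biregular a p b q"
    using assms(1-5)
  proof (cases rule: eulerian_pair_cases)
    case 1
    then show ?thesis using straight_biregular_copies[OF straight_star assms(4), of b] by simp
  next
    case (2 r)
    then show ?thesis using straight_biregular_copies[OF straight_two_poles 2(1), of b] by simp
  next
    case (3 r)
    then show ?thesis using straight_odd by simp
  next
    case 4
    then show ?thesis using straight_cubic assms(6) by auto
  next
    case (5 r)
    then show ?thesis using straight_3_4 by simp
  next
    case (6 r)
    then show ?thesis using straight_3_5[of r] assms(7) by auto
  qed
qed (use assms in auto)

lemma biregular_pair_eq_iff:
  "1 \<le> p \<Longrightarrow> 1 \<le> q \<Longrightarrow>
    biregular_pair a p b q = biregular_pair a' p' b' q' \<longleftrightarrow> a = a' \<and> p = p' \<and> b = b' \<and> q = q'"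
  by (auto simp: biregular_pair_def replicate_eq_replicate)

theorem theorem2:
  fixes a b p q :: nat
  assumes "1 \<le> a" and "a \<le> b" and "p \<ge> 1" and "q \<ge> 1"
  defines "P \<equiv> biregular_pair a p b q"
  shows
    "(eulerian_pair a p b q \<longleftrightarrow>
        (\<exists>b' q'. b' \<ge> 1 \<and> q' \<ge> 1 \<and> P = biregular_pair 1 (b' * q') b' q') \<or>
        (\<exists>b' r. b' \<ge> 1 \<and> r \<ge> 1 \<and> P = biregular_pair 2 (b' * r) b' (2 * r)) \<or>
        (\<exists>q' r. q' \<ge> 3 \<and> odd q' \<and> r \<ge> 1 \<and> P = biregular_pair 2 (q' * r) (2 * r) q') \<or>
        (\<exists>p'. p' \<ge> 4 \<and> P = biregular_pair 3 p' 3 p') \<or>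
        (\<exists>r. r \<ge> 2 \<and> P = biregular_pair 3 (4 * r) 4 (3 * r)) \<or>
        (\<exists>r. r \<ge> 4 \<and> P = biregular_pair 3 (5 * r) 5 (3 * r)))
     \<and>
     (planar_graphic a p b q \<longleftrightarrow>
        eulerian_pair a p b q \<and>
        P \<noteq> biregular_pair 3 5 3 5 \<and> P \<noteq> biregular_pair 3 25 5 15)"
    (is "(_ \<longleftrightarrow> ?forms) \<and> _")
proof
  have P: "P = biregular_pair a' p' b' q' \<longleftrightarrow> a = a' \<and> p = p' \<and> b = b' \<and> q = q'" for a' p' b' q'
    unfolding P_def using assms(3,4) by (rule biregular_pair_eq_iff)
  show "eulerian_pair a p b q \<longleftrightarrow> ?forms"
  proof
    assume "eulerian_pair a p b q"
    from assms(1-4) this show ?forms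
    proof (cases rule: eulerian_pair_cases)
      case 1
      then show ?thesis unfolding P using assms(2,4) by auto
    next
      case (2 r)
      then show ?thesis unfolding P using assms(2) by auto
    qed (auto simp: P)
  next
    assume ?forms
    then show "eulerian_pair a p b q"
      unfolding P using eulerian_star eulerian_even eulerian_odd eulerian_cubic by auto
  qed
  show "planar_graphic a p b q \<longleftrightarrow>
    eulerian_pair a p b q \<and> P \<noteq> biregular_pair 3 5 3 5 \<and> P \<noteq> biregular_pair 3 25 5 15"
    (is "_ \<longleftrightarrow> ?eulerian")
  proof
    assume pg: "planar_graphic a p b q"
    show ?eulerian
      unfolding P using planar_graphic_eulerian[OF pg assms(3)] by simp
  next
    assume e: ?eulerian
    show "planar_graphic a p b q"
      by (rule eulerian_planar_graphic[OF assms(1-4)]) (use e in \<open>simp_all add: P\<close>)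
  qed
qed

end
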